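(* Let $n\geq 1$, let $[m]=(m_1,\ldots,m_n)\in\mathbb{Z}_{>1}^n$ and $[m']=(m_1',\ldots,m_n')\in\mathbb{Z}_{>1}^n$ be two multi-indices for which the subsets $\{m_1,\ldots,m_n\}$ and $\{m_1',\ldots,m_n'\}$ of $\mathbb{Z}$ are distinct, and let $\sigma=\{\sigma_i(\underline{x})\}_{i=1,\ldots,r}$ be a collection of $r\geq 2$ polynomials in $\mathbb{C}[\underline{x}]=\mathbb{C}[x_1,\ldots,x_n]$ such that (1) $\sigma_i(0,\ldots,0)\neq\sigma_j(0,\ldots,0)$ for every $i\neq j$, (2) $\sigma_i(\underline{x})-\sigma_i(0,\ldots,0)\in x_1\cdots x_n\,\mathbb{C}[\underline{x}]$ for every $i=1,\ldots,r$. Then the varieties $X_{[m],\sigma}$ and $X_{[m'],\sigma}$ are not isomorphic. In particular, there exists an infinite countable family of pairwise nonisomorphic varieties $X_{[m],\sigma}$ with the property that all the varieties $X_{[m],\sigma}\times\mathbb{C}$ are isomorphic.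
   Context: For a multi-index $[m]=(m_1,\ldots,m_n)\in\mathbb{Z}_{>0}^n$ and a collection $\sigma=\{\sigma_i\}_{i=1,\ldots,r}$ of polynomials satisfying (1) and (2) of the statement, $X_{[m],\sigma}\subset\mathbb{C}^{n+2}=\mathrm{Spec}(\mathbb{C}[x_1,\ldots,x_n,y,z])$ denotes the affine variety with equation $$x_1^{m_1}\cdots x_n^{m_n}z-\prod_{i=1}^r(y-\sigma_i(\underline{x}))=0.$$ Isomorphism means isomorphism of complex algebraic varieties. In the last assertion, $\sigma$ is fixed and the family is obtained by varying the multi-index $[m]$. *)

theory Defs
  imports Complex_Main "HOL-Library.Poly_Mapping"
begin

type_synonym 'v cpoly = "('v \<Rightarrow>\<^sub>0 nat) \<Rightarrow>\<^sub>0 complex"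

definition cvar :: "'v \<Rightarrow> 'v cpoly" where
  "cvar v = Poly_Mapping.single (Poly_Mapping.single v 1) 1"

definition cconst :: "complex \<Rightarrow> 'v cpoly" where
  "cconst c = Poly_Mapping.single 0 c"

definition ceval :: "'v::finite cpoly \<Rightarrow> ('v \<Rightarrow> complex) \<Rightarrow> complex" where
  "ceval p a = (\<Sum>\<alpha>\<in>Poly_Mapping.keys p.
     Poly_Mapping.lookup p \<alpha> * (\<Prod>v\<in>UNIV. a v ^ Poly_Mapping.lookup \<alpha> v))"

text \<open>
  Affine space with coordinates indexed by a finite type \<open>'v\<close> is \<open>'v \<Rightarrow> complex\<close>, and affine
  varieties are identified with their sets of complex points in it. Regular functions on a closed
  subset of affine space are the restrictions of polynomials, so a morphism between closed subsets
  is a map each of whose coordinates is given by a polynomial.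
\<close>

definition regular_map ::
  "('v::finite \<Rightarrow> complex) set \<Rightarrow> ('w::finite \<Rightarrow> complex) set \<Rightarrow>
   (('v \<Rightarrow> complex) \<Rightarrow> ('w \<Rightarrow> complex)) \<Rightarrow> bool" where
  "regular_map V W f \<longleftrightarrow>
     (\<forall>a\<in>V. f a \<in> W) \<and> (\<forall>w. \<exists>p. \<forall>a\<in>V. f a w = ceval p a)"

definition isomorphic_varieties ::
  "('v::finite \<Rightarrow> complex) set \<Rightarrow> ('w::finite \<Rightarrow> complex) set \<Rightarrow> bool" where
  "isomorphic_varieties V W \<longleftrightarrow>
     (\<exists>f g. regular_map V W f \<and> regular_map W V g \<and>
            (\<forall>a\<in>V. g (f a) = a) \<and> (\<forall>b\<in>W. f (g b) = b))"

definition variety_prod ::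
  "('v \<Rightarrow> complex) set \<Rightarrow> ('w \<Rightarrow> complex) set \<Rightarrow> ('v + 'w \<Rightarrow> complex) set" where
  "variety_prod V W = {a. (\<lambda>v. a (Inl v)) \<in> V \<and> (\<lambda>w. a (Inr w)) \<in> W}"

abbreviation affine_line :: "(unit \<Rightarrow> complex) set" where
  "affine_line \<equiv> UNIV"

text \<open>The index type of the coordinates \<open>x\<^sub>1, \<dots>, x\<^sub>n, y, z\<close> of the ambient space of dimension
  \<open>n + 2\<close>, where \<open>n\<close> is the number of elements of \<open>'n\<close>.\<close>

datatype 'n coord = CX 'n | CY | CZ

instance coord :: (finite) finite
proof
  have "(UNIV :: 'a coord set) = range CX \<union> {CY, CZ}"
    by (auto intro: coord.exhaust)
  then show "finite (UNIV :: 'a coord set)"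
    by (metis finite.emptyI finite.insertI finite_Un finite_imageI finite)
qed

definition danielewski_variety ::
  "('n::finite \<Rightarrow> nat) \<Rightarrow> nat \<Rightarrow> (nat \<Rightarrow> 'n cpoly) \<Rightarrow> ('n coord \<Rightarrow> complex) set" where
  "danielewski_variety m r \<sigma> =
     {a. (\<Prod>j\<in>UNIV. a (CX j) ^ m j) * a CZ
          - (\<Prod>i=1..r. a CY - ceval (\<sigma> i) (\<lambda>j. a (CX j))) = 0}"

end

theory Submission
  imports Defs "HOL-Computational_Algebra.Computational_Algebra" "HOL-Computational_Algebra.Field_as_Ring"
    "HOL-Library.Countable"
begin

text \<open>Where no \<open>x\<^sub>j\<close> vanishes the variety is a torus times a line, so its coordinate ring is a
  subring of \<open>\<complex>[x\<^sub>1\<^sup>\<plusminus>\<^sup>1, \<dots>, x\<^sub>n\<^sup>\<plusminus>\<^sup>1][y]\<close>. A locally nilpotent derivation of it has to lower the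
  degree in \<open>y\<close>: otherwise its leading homogeneous part would be a locally nilpotent derivation
  of a monomial ring that cannot exist when \<open>r\<close> and all \<open>m\<^sub>j\<close> are at least 2. So all of them are
  of the form \<open>b(x) x\<^sup>m \<partial>/\<partial>y\<close>. An isomorphism carries these derivations, and hence their kernels
  \<open>\<complex>[x]\<close>, to each other; comparing the images of \<open>y\<close> shows that it carries \<open>x\<^sup>m\<^sup>'\<close> to a scalar
  multiple of \<open>x\<^sup>m\<close>. Then the \<open>x\<^sub>j\<close> are permuted up to scalars, and the exponents agree.

  For the cylinders, Newton's method \<open>N\<close> for the roots \<open>y = \<sigma>\<^sub>i(x)\<close> is a contraction modulo
  \<open>q = x\<^sub>1 \<cdots> x\<^sub>n\<close>, since the roots are distinct modulo \<open>q\<close>. For large \<open>K\<close> the map given by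
  \<open>y' = N\<^sup>K(y) + x\<^sup>m\<^sup>' s\<close> and \<open>s' = (y - N\<^sup>K(y')) / x\<^sup>m\<close> is therefore regular, and its inverse is the
  map of the same form with the roles of \<open>m\<close> and \<open>m'\<close> exchanged.\<close>

text \<open>A derivation of the coordinate ring extends to the Laurent ring, but local nilpotency
  need not extend with it. The contradiction therefore comes from comparing the leading terms of the
  images of x_j, y and z with the poles allowed to regular functions: in degree b in y, the leading
  coefficient has at most the pole x^(-m floor(b / r)). No graded ring is formed. A total order on
  the exponents that is compatible with addition isolates one leading term, and supports are finite.

  For two varieties, transporting x^m' d/dy and applying it to the image of y forces that image to
  have degree 1 in y, so x^m divides the image of x^m'. The inverse gives the converse, and the
  quotient is a unit.

  For the cylinders, s' is the solution of y = N^K(y') + x^m s', which mirrors the formula for y';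
  so the inverse needs no computation of its own. Only regularity where some x_j vanishes is at
  stake. It holds because N^K(y) is a root up to a multiple of q^(K+1), and for large K both x^m and
  x^m' divide q^(K+1).\<close>

abbreviation "lookup \<equiv> Poly_Mapping.lookup"
abbreviation "keys \<equiv> Poly_Mapping.keys"
abbreviation "single \<equiv> Poly_Mapping.single"

section \<open>Evaluation of monoid algebras\<close>

lemma poly_mapping_sum_single:
  fixes p :: "'a \<Rightarrow>\<^sub>0 'b::comm_monoid_add"
  shows "p = (\<Sum>k\<in>keys p. single k (lookup p k))"
proof (rule poly_mapping_eqI)
  fix i
  have "lookup (\<Sum>k\<in>keys p. single k (lookup p k)) i
      = (\<Sum>k\<in>keys p. if k = i then lookup p i else 0)"
    by (auto simp: lookup_sum lookup_single when_def intro!: sum.cong)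
  also have "\<dots> = lookup p i"
    by (simp add: in_keys_iff)
  finally show "lookup p i = lookup (\<Sum>k\<in>keys p. single k (lookup p k)) i" by simp
qed

lemma poly_mapping_induct [case_names zero single add]:
  fixes p :: "'a \<Rightarrow>\<^sub>0 'b::comm_monoid_add"
  assumes "P 0" and s: "\<And>k c. P (single k c)" and a: "\<And>f g. P f \<Longrightarrow> P g \<Longrightarrow> P (f + g)"
  shows "P p"
proof -
  have "finite A \<Longrightarrow> P (\<Sum>k\<in>A. single k (lookup p k))" for A
    by (induction A rule: finite_induct) (auto intro: assms)
  then show ?thesis
    using poly_mapping_sum_single[of p] by (metis finite_keys)
qed

definition is_hom :: "('a::comm_ring_1 \<Rightarrow> 'b::comm_ring_1) \<Rightarrow> bool" where
  "is_hom h \<longleftrightarrow> h 1 = 1 \<and> (\<forall>x y. h (x + y) = h x + h y) \<and> (\<forall>x y. h (x * y) = h x * h y)"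

lemma is_homI:
  "h 1 = 1 \<Longrightarrow> (\<And>x y. h (x + y) = h x + h y) \<Longrightarrow> (\<And>x y. h (x * y) = h x * h y) \<Longrightarrow> is_hom h"
  by (simp add: is_hom_def)

context
  fixes h :: "'a::comm_ring_1 \<Rightarrow> 'b::comm_ring_1"
  assumes h: "is_hom h"
begin

lemma hom_one: "h 1 = 1"
  and hom_add: "h (x + y) = h x + h y"
  and hom_mult: "h (x * y) = h x * h y"
  using h by (auto simp: is_hom_def)

lemma hom_zero: "h 0 = 0"
  using hom_add[of 0 0] by simp

lemma hom_uminus: "h (- x) = - h x"
  using hom_add[of x "- x"] hom_zero by (simp add: eq_neg_iff_add_eq_0 add.commute)

lemma hom_diff: "h (x - y) = h x - h y"
  using hom_add[of x "- y"] hom_uminus by simp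

lemma hom_power: "h (x ^ n) = h x ^ n"
  by (induction n) (auto simp: hom_one hom_mult)

lemma hom_prod: "h (prod f A) = (\<Prod>x\<in>A. h (f x))"
  by (induction A rule: infinite_finite_induct) (auto simp: hom_one hom_mult)

lemma hom_sum: "h (sum f A) = (\<Sum>x\<in>A. h (f x))"
  by (induction A rule: infinite_finite_induct) (auto simp: hom_zero hom_add)

lemmas homs = hom_one hom_add hom_mult hom_zero hom_uminus hom_diff hom_power hom_prod hom_sum

end

lemma is_hom_comp: "is_hom f \<Longrightarrow> is_hom g \<Longrightarrow> is_hom (\<lambda>x. f (g x))"
  by (auto simp: is_hom_def)

lemma is_hom_id: "is_hom (\<lambda>x. x)"
  by (auto simp: is_hom_def)

lemma is_hom_const_poly: "is_hom (\<lambda>c. [:c:])"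
  by (auto simp: is_hom_def one_pCons)

lemma is_hom_single: "is_hom (\<lambda>c. single (0::'a::comm_monoid_add) (c::'b::comm_ring_1))"
  by (auto simp: is_hom_def mult_single single_add)

text \<open>Coefficients go through \<open>\<kappa>\<close> and exponents through the character
  \<open>\<chi>\<close>. Polynomials and Laurent polynomials are both monoid algebras, so
  evaluation, substitution and the maps into the Laurent ring are all instances of this one
  map.\<close>

definition mev :: "('c::comm_ring_1 \<Rightarrow> 'r::comm_ring_1) \<Rightarrow> ('k \<Rightarrow> 'r) \<Rightarrow> ('k \<Rightarrow>\<^sub>0 'c) \<Rightarrow> 'r" where
  "mev \<kappa> \<chi> p = (\<Sum>k\<in>keys p. \<kappa> (lookup p k) * \<chi> k)"

definition multiplicative :: "('k::comm_monoid_add \<Rightarrow> 'r::comm_ring_1) \<Rightarrow> bool" where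
  "multiplicative \<chi> \<longleftrightarrow> \<chi> 0 = 1 \<and> (\<forall>a b. \<chi> (a + b) = \<chi> a * \<chi> b)"

lemma mev_superset:
  assumes "is_hom \<kappa>" "finite A" "keys p \<subseteq> A"
  shows "mev \<kappa> \<chi> p = (\<Sum>k\<in>A. \<kappa> (lookup p k) * \<chi> k)"
  unfolding mev_def using assms
  by (intro sum.mono_neutral_left) (auto simp: in_keys_iff hom_zero)

lemma mev_single: "is_hom \<kappa> \<Longrightarrow> mev \<kappa> \<chi> (single k c) = \<kappa> c * \<chi> k"
  by (subst mev_superset[where A = "{k}"]) auto

lemma mev_add:
  assumes "is_hom \<kappa>"
  shows "mev \<kappa> \<chi> (p + q) = mev \<kappa> \<chi> p + mev \<kappa> \<chi> q"
  using keys_add[of p q]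
  by (subst (1 2 3) mev_superset[where A = "keys p \<union> keys q"])
    (auto simp: assms lookup_add hom_add algebra_simps sum.distrib)

lemma mev_zero: "mev \<kappa> \<chi> 0 = 0"
  by (simp add: mev_def)

lemma is_hom_mev:
  assumes \<kappa>: "is_hom \<kappa>" and \<chi>: "multiplicative \<chi>"
  shows "is_hom (mev \<kappa> \<chi>)"
proof (rule is_homI)
  have "mev \<kappa> \<chi> (single 0 1) = 1"
    using \<kappa> \<chi> by (simp add: mev_single multiplicative_def hom_one del: single_one)
  then show "mev \<kappa> \<chi> 1 = 1" by simp
  show "mev \<kappa> \<chi> (p + q) = mev \<kappa> \<chi> p + mev \<kappa> \<chi> q" for p q
    by (rule mev_add[OF \<kappa>])
  show "mev \<kappa> \<chi> (p * q) = mev \<kappa> \<chi> p * mev \<kappa> \<chi> q" for p q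
  proof (induction p rule: poly_mapping_induct)
    case (single k c)
    show ?case
    proof (induction q rule: poly_mapping_induct)
      case (single l d)
      show ?case using \<kappa> \<chi> by (simp add: mult_single mev_single hom_mult multiplicative_def)
    qed (auto simp: mev_zero mev_add[OF \<kappa>] algebra_simps)
  qed (auto simp: mev_zero mev_add[OF \<kappa>] algebra_simps)
qed

section \<open>Polynomials in finitely many variables\<close>

definition pow_fun :: "('v::finite \<Rightarrow> 'r::comm_ring_1) \<Rightarrow> ('v \<Rightarrow>\<^sub>0 nat) \<Rightarrow> 'r" where
  "pow_fun a \<alpha> = (\<Prod>v\<in>UNIV. a v ^ lookup \<alpha> v)"

lemma multiplicative_pow_fun: "multiplicative (pow_fun a)"
  by (simp add: multiplicative_def pow_fun_def lookup_add power_add prod.distrib)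

definition pev :: "(complex \<Rightarrow> 'r::comm_ring_1) \<Rightarrow> ('v::finite \<Rightarrow> 'r) \<Rightarrow> 'v cpoly \<Rightarrow> 'r" where
  "pev \<kappa> a = mev \<kappa> (pow_fun a)"

lemma ceval_conv_pev: "ceval p a = pev (\<lambda>c. c) a p"
  by (simp add: ceval_def pev_def mev_def pow_fun_def)

lemma is_hom_pev: "is_hom \<kappa> \<Longrightarrow> is_hom (pev \<kappa> a)"
  unfolding pev_def by (intro is_hom_mev multiplicative_pow_fun)

lemma is_hom_ceval: "is_hom (\<lambda>p. ceval p a)"
  unfolding ceval_conv_pev by (rule is_hom_pev[OF is_hom_id])

lemmas ceval_homs = homs[OF is_hom_ceval]

lemma pev_cconst: "is_hom \<kappa> \<Longrightarrow> pev \<kappa> a (cconst c) = \<kappa> c"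
  by (simp add: pev_def cconst_def mev_single pow_fun_def)

lemma pev_cvar: "is_hom \<kappa> \<Longrightarrow> pev \<kappa> a (cvar v) = a v"
proof -
  assume "is_hom \<kappa>"
  moreover have "(\<Prod>w\<in>UNIV. a w ^ lookup (single v (1::nat)) w) = (\<Prod>w\<in>UNIV. if w = v then a v else 1)"
    by (intro prod.cong) (auto simp: lookup_single)
  ultimately show ?thesis
    by (simp add: pev_def cvar_def mev_single pow_fun_def hom_one)
qed

lemma ceval_cconst [simp]: "ceval (cconst c) a = c"
  by (simp add: ceval_conv_pev pev_cconst is_hom_id)

lemma ceval_cvar [simp]: "ceval (cvar v) a = a v"
  by (simp add: ceval_conv_pev pev_cvar is_hom_id)

lemma single_conv_cvar: "single \<alpha> c = cconst c * (\<Prod>v\<in>UNIV. cvar v ^ lookup \<alpha> v)"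
  for \<alpha> :: "'v::finite \<Rightarrow>\<^sub>0 nat"
proof -
  have pw: "cvar v ^ k = single (single v k) 1" for v :: 'v and k
    by (induction k) (auto simp: cvar_def mult_single single_add[symmetric] single_one[symmetric] simp del: single_one)
  have "(\<Prod>v\<in>A. cvar v ^ lookup \<alpha> v) = single (\<Sum>v\<in>A. single v (lookup \<alpha> v)) 1" if "finite A" for A
    using that by (induction A rule: finite_induct) (auto simp: pw mult_single)
  moreover have "(\<Sum>v\<in>UNIV. single v (lookup \<alpha> v)) = \<alpha>"
    by (rule poly_mapping_eqI) (simp add: lookup_sum lookup_single when_def)
  ultimately show ?thesis
    by (simp add: cconst_def mult_single)
qed

lemma cpoly_induct [case_names const var add mult]:
  fixes p :: "'v::finite cpoly"
  assumes c: "\<And>c. P (cconst c)" and v: "\<And>v. P (cvar v)"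
    and a: "\<And>f g. P f \<Longrightarrow> P g \<Longrightarrow> P (f + g)" and m: "\<And>f g. P f \<Longrightarrow> P g \<Longrightarrow> P (f * g)"
  shows "P p"
proof (induction p rule: poly_mapping_induct)
  case zero
  show ?case using c[of 0] by (simp add: cconst_def)
next
  case (single \<alpha> c)
  have one: "P 1" using c[of 1] by (simp add: cconst_def)
  have "P (f ^ n)" if "P f" for f n
    by (induction n) (auto intro: that m one)
  then have "P (\<Prod>v\<in>A. cvar v ^ lookup \<alpha> v)" for A
    by (induction A rule: infinite_finite_induct) (auto intro: one m v)
  then show ?case by (simp add: single_conv_cvar c m)
qed (auto intro: a)

lemma hom_cpoly_eqI:
  fixes f g :: "'v::finite cpoly \<Rightarrow> 'r::comm_ring_1"
  assumes "is_hom f" "is_hom g"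
    and "\<And>c. f (cconst c) = g (cconst c)" "\<And>v. f (cvar v) = g (cvar v)"
  shows "f p = g p"
  by (induction p rule: cpoly_induct) (use assms in \<open>auto simp: homs\<close>)

lemma is_hom_cconst: "is_hom cconst"
  unfolding cconst_def by (rule is_hom_single)

definition csubst :: "('v::finite \<Rightarrow> 'w::finite cpoly) \<Rightarrow> 'v cpoly \<Rightarrow> 'w cpoly" where
  "csubst F = pev cconst F"

lemma is_hom_csubst: "is_hom (csubst F)"
  unfolding csubst_def by (rule is_hom_pev[OF is_hom_cconst])

lemma csubst_cconst [simp]: "csubst F (cconst c) = cconst c"
  by (simp add: csubst_def pev_cconst is_hom_cconst)

lemma csubst_cvar [simp]: "csubst F (cvar v) = F v"
  by (simp add: csubst_def pev_cvar is_hom_cconst)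

lemma ceval_csubst: "ceval (csubst F p) a = ceval p (\<lambda>v. ceval (F v) a)"
  by (rule hom_cpoly_eqI[where f = "\<lambda>p. ceval (csubst F p) a"])
    (auto intro!: is_hom_comp[OF is_hom_ceval] is_hom_csubst is_hom_ceval)

section \<open>Laurent polynomials\<close>

text \<open>The wrapper exists only to carry a linear order, which makes Laurent polynomials an
  integral domain and gives them leading exponents.\<close>

datatype 'n ix = Ix (unix: 'n)

instance ix :: (finite) finite
proof
  have "(UNIV :: 'a ix set) = range Ix" by (auto intro: ix.exhaust)
  then show "finite (UNIV :: 'a ix set)" by (metis finite finite_imageI)
qed

instantiation ix :: (finite) linorder
begin

definition less_eq_ix :: "'a ix \<Rightarrow> 'a ix \<Rightarrow> bool" where
  "i \<le> j \<longleftrightarrow> to_nat (unix i) \<le> to_nat (unix j)"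

definition less_ix :: "'a ix \<Rightarrow> 'a ix \<Rightarrow> bool" where
  "i < j \<longleftrightarrow> to_nat (unix i) < to_nat (unix j)"

instance
  by standard (auto simp: less_eq_ix_def less_ix_def ix.expand)

end

type_synonym 'n expo = "'n ix \<Rightarrow>\<^sub>0 int"
type_synonym 'n laurent = "'n expo \<Rightarrow>\<^sub>0 complex"

definition expo :: "('n::finite \<Rightarrow> int) \<Rightarrow> 'n expo" where
  "expo f = Abs_poly_mapping (\<lambda>i. f (unix i))"

definition ex :: "'n expo \<Rightarrow> 'n \<Rightarrow> int" where
  "ex a j = lookup a (Ix j)"

lemma ex_expo [simp]: "ex (expo f) j = f j"
  by (simp add: ex_def expo_def)

lemma ex_add [simp]: "ex (a + b) j = ex a j + ex b j"
  and ex_zero [simp]: "ex 0 j = 0"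
  by (simp_all add: ex_def lookup_add)

lemma ex_sum [simp]: "ex (sum f A) j = (\<Sum>i\<in>A. ex (f i) j)"
  by (simp add: ex_def lookup_sum)

lemma ex_eqI: "(\<And>j. ex a j = ex b j) \<Longrightarrow> a = b"
  by (rule poly_mapping_eqI) (metis ex_def ix.collapse)

abbreviation xmon :: "'k \<Rightarrow> 'k \<Rightarrow>\<^sub>0 complex" where
  "xmon a \<equiv> single a 1"

abbreviation kconst :: "complex \<Rightarrow> 'n laurent" where
  "kconst c \<equiv> single 0 c"

lemma xmon_mult: "xmon a * xmon b = xmon (a + b)"
  by (simp add: mult_single)

lemma single_eq_0_iff [simp]: "single k c = 0 \<longleftrightarrow> c = 0"
  by (metis inj_single[THEN injD] single_zero)

lemma xmon_power: "xmon a ^ n = xmon (\<Sum>i<n. a)"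
  by (induction n) (auto simp: xmon_mult add.commute)

lemma xmon_sum: "(\<Prod>i\<in>A. xmon (f i)) = xmon (sum f A)"
  by (induction A rule: infinite_finite_induct) (auto simp: xmon_mult)

lemma lookup_single_mult:
  fixes k :: "'a::ab_group_add" and g :: "'a \<Rightarrow>\<^sub>0 'b::comm_ring_1"
  shows "lookup (single k c * g) n = c * lookup g (n - k)"
proof (induction g rule: poly_mapping_induct)
  case (single l d)
  show ?case
    by (auto simp: mult_single lookup_single when_def algebra_simps)
qed (auto simp: lookup_add algebra_simps)

lemma lookup_mult_sum:
  fixes f g :: "'a::ab_group_add \<Rightarrow>\<^sub>0 'b::comm_ring_1"
  shows "lookup (f * g) n = (\<Sum>k\<in>keys f. lookup f k * lookup g (n - k))"
proof -
  have "f * g = (\<Sum>k\<in>keys f. single k (lookup f k)) * g"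
    by (simp flip: poly_mapping_sum_single)
  then show ?thesis
    by (simp only: sum_distrib_right lookup_sum lookup_single_mult)
qed

text \<open>Only the pair \<open>(a, b)\<close> of exponents can contribute to \<open>a + b\<close>.
  The bounds need not be attained: later one common bound serves several coefficients, some of which
  vanish there.\<close>

lemma lookup_mult_top:
  fixes f g :: "'a::linordered_ab_group_add \<Rightarrow>\<^sub>0 'b::comm_ring_1"
  assumes f: "\<And>k. k \<in> keys f \<Longrightarrow> k \<le> a" and g: "\<And>k. k \<in> keys g \<Longrightarrow> k \<le> b"
  shows "lookup (f * g) (a + b) = lookup f a * lookup g b"
    and "k \<in> keys (f * g) \<Longrightarrow> k \<le> a + b"
proof -
  have "lookup f k * lookup g (a + b - k) = (if k = a then lookup f a * lookup g b else 0)"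
    if "k \<in> keys f" for k
  proof (cases "k = a")
    case False
    then have "b < a + b - k" using f[OF that] by (simp add: less_diff_eq algebra_simps)
    then have "a + b - k \<notin> keys g" using g by force
    then show ?thesis using False by (simp add: in_keys_iff)
  qed simp
  then show "lookup (f * g) (a + b) = lookup f a * lookup g b"
    by (simp add: lookup_mult_sum in_keys_iff)
  show "k \<le> a + b" if "k \<in> keys (f * g)"
    using keys_mult[of f g] that f g by (auto intro!: add_mono)
qed

lemma lookup_mult_bot:
  fixes f g :: "'a::linordered_ab_group_add \<Rightarrow>\<^sub>0 'b::comm_ring_1"
  assumes f: "\<And>k. k \<in> keys f \<Longrightarrow> a \<le> k" and g: "\<And>k. k \<in> keys g \<Longrightarrow> b \<le> k"
  shows "lookup (f * g) (a + b) = lookup f a * lookup g b"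
proof -
  have "lookup f k * lookup g (a + b - k) = (if k = a then lookup f a * lookup g b else 0)"
    if "k \<in> keys f" for k
  proof (cases "k = a")
    case False
    then have "a + b - k < b" using f[OF that] by (simp add: diff_less_eq algebra_simps)
    then have "a + b - k \<notin> keys g" using g by force
    then show ?thesis using False by (simp add: in_keys_iff)
  qed simp
  then show ?thesis
    by (simp add: lookup_mult_sum in_keys_iff)
qed

text \<open>Maxima and minima of supports add under multiplication. If the product is a single term,
  the two sums agree, so in each factor the maximum equals the minimum.\<close>

lemma factor_of_single:
  fixes f g :: "'a::linordered_ab_group_add \<Rightarrow>\<^sub>0 'b::idom"
  assumes fg: "f * g = single a c" and "c \<noteq> 0"
  obtains b d where "f = single b d" "d \<noteq> 0"
proof -
  have "f \<noteq> 0" "g \<noteq> 0" using assms by auto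
  then have nf: "keys f \<noteq> {}" and ng: "keys g \<noteq> {}" by simp_all
  let ?M = "\<lambda>f. Max (keys f)" and ?m = "\<lambda>f. Min (keys f)"
  have M: "?M f \<in> keys f" "?m f \<in> keys f" if "keys f \<noteq> {}" for f :: "'a \<Rightarrow>\<^sub>0 'b"
    using that by simp_all
  have "lookup (f * g) (?M f + ?M g) \<noteq> 0"
    using M(1)[OF nf] M(1)[OF ng] by (subst lookup_mult_top) (auto simp: in_keys_iff)
  then have 1: "?M f + ?M g = a" using fg by (auto simp: lookup_single when_def split: if_splits)
  have "lookup (f * g) (?m f + ?m g) \<noteq> 0"
    using M(2)[OF nf] M(2)[OF ng] by (subst lookup_mult_bot) (auto simp: in_keys_iff)
  then have 2: "?m f + ?m g = a" using fg by (auto simp: lookup_single when_def split: if_splits)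
  have "?m f \<le> ?M f" "?m g \<le> ?M g" using nf ng by simp_all
  then have eq: "?m f = ?M f" using 1 2
    by (metis add_le_cancel_right add_left_mono antisym)
  have "k = ?M f" if "k \<in> keys f" for k
    using that eq by (metis Max_ge Min_le antisym finite_keys)
  then have "f = single (?M f) (lookup f (?M f))"
    by (intro poly_mapping_eqI) (auto simp: lookup_single when_def in_keys_iff)
  moreover have "lookup f (?M f) \<noteq> 0" using M(1)[OF nf] by (simp add: in_keys_iff)
  ultimately show ?thesis using that by blast
qed

text \<open>Euler operators and translations by torus points both act diagonally on monomials; this
  is their common form.\<close>

definition diag :: "('k \<Rightarrow> complex) \<Rightarrow> ('k \<Rightarrow>\<^sub>0 complex) \<Rightarrow> ('k \<Rightarrow>\<^sub>0 complex)" where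
  "diag w h = Poly_Mapping.mapp (\<lambda>k c. w k * c) h"

lemma lookup_diag [simp]: "lookup (diag w h) k = w k * lookup h k"
  by (auto simp: diag_def lookup_mapp when_def in_keys_iff)

lemma keys_diag: "keys (diag w h) \<subseteq> keys h"
  by (auto simp: in_keys_iff)

lemma diag_add: "diag w (f + g) = diag w f + diag w g"
  by (rule poly_mapping_eqI) (simp add: lookup_add algebra_simps)

lemma diag_zero [simp]: "diag w 0 = 0"
  by (rule poly_mapping_eqI) simp

lemma diag_single: "diag w (single k c) = single k (w k * c)"
  by (rule poly_mapping_eqI) (auto simp: lookup_single when_def)

text \<open>This is x_j d/dx_j. Unlike d/dx_j it leaves every exponent in place, so leading terms
  are only rescaled.\<close>

definition euler :: "'n \<Rightarrow> 'n laurent \<Rightarrow> 'n laurent" where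
  "euler j = diag (\<lambda>k. of_int (ex k j))"

lemma euler_add: "euler j (f + g) = euler j f + euler j g"
  and euler_zero [simp]: "euler j 0 = 0"
  and euler_single: "euler j (single k c) = single k (of_int (ex k j) * c)"
  and keys_euler: "keys (euler j h) \<subseteq> keys h"
  and lookup_euler: "lookup (euler j h) k = of_int (ex k j) * lookup h k"
  unfolding euler_def by (rule diag_add diag_zero diag_single keys_diag lookup_diag)+

lemma euler_mult: "euler j (f * g) = euler j f * g + f * euler j g"
proof (induction f rule: poly_mapping_induct)
  case (single k c)
  show ?case
  proof (induction g rule: poly_mapping_induct)
    case (single l d)
    show ?case by (simp add: mult_single euler_single algebra_simps flip: single_add)
  qed (auto simp: euler_add algebra_simps)
qed (auto simp: euler_add algebra_simps)

subsection \<open>Evaluation on the torus\<close>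

definition tchar :: "('n::finite \<Rightarrow> complex) \<Rightarrow> 'n expo \<Rightarrow> complex" where
  "tchar x a = (\<Prod>j\<in>UNIV. x j powi ex a j)"

definition keval :: "('n::finite \<Rightarrow> complex) \<Rightarrow> 'n laurent \<Rightarrow> complex" where
  "keval x = mev (\<lambda>c. c) (tchar x)"

lemma tchar_nz: "(\<And>j. x j \<noteq> 0) \<Longrightarrow> tchar x a \<noteq> 0"
  by (simp add: tchar_def)

lemma multiplicative_tchar: "(\<And>j. x j \<noteq> 0) \<Longrightarrow> multiplicative (tchar x)"
  by (simp add: multiplicative_def tchar_def power_int_add prod.distrib)

lemma is_hom_keval: "(\<And>j. x j \<noteq> 0) \<Longrightarrow> is_hom (keval x)"
  unfolding keval_def by (intro is_hom_mev is_hom_id multiplicative_tchar)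

lemma keval_single: "keval x (single k c) = c * tchar x k"
  by (simp add: keval_def mev_single is_hom_id)

lemma tchar_mult: "tchar (\<lambda>j. u j * x j) a = tchar u a * tchar x a"
  by (simp add: tchar_def power_int_mult_distrib prod.distrib)

lemma keval_diag: "keval x (diag (tchar u) h) = keval (\<lambda>j. u j * x j) h"
  unfolding keval_def
  by (subst mev_superset[where A = "keys h"])
    (auto simp: keys_diag is_hom_id mev_def tchar_mult in_keys_iff intro!: sum.cong)

text \<open>This is Dedekind's argument for the independence of characters.\<close>

lemma keval_faithful:
  fixes h :: "'n::finite laurent"
  assumes "\<And>x. (\<And>j. x j \<noteq> 0) \<Longrightarrow> keval x h = 0"
  shows "h = 0"
  using assms
proof (induction "card (keys h)" arbitrary: h rule: less_induct)
  case less
  show ?case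
  proof (rule ccontr)
    assume "h \<noteq> 0"
    then have "keys h \<noteq> {}" by simp
    then obtain a where a: "a \<in> keys h" by blast
    show False
    proof (cases "keys h = {a}")
      case True
      then have "keval (\<lambda>_. 1) h = lookup h a * tchar (\<lambda>_. 1) a"
        by (simp add: keval_def mev_def)
      moreover have "keval (\<lambda>_. 1) h = 0" by (rule less.prems) simp
      moreover have "tchar (\<lambda>_. 1) a \<noteq> 0" by (rule tchar_nz) simp
      moreover have "lookup h a \<noteq> 0" using a in_keys_iff by blast
      ultimately show False by simp
    next
      case False
      then have "\<exists>b\<in>keys h. b \<noteq> a" using a by auto
      then obtain b where b: "b \<in> keys h" "b \<noteq> a" by blast
      have "\<exists>j. ex a j \<noteq> ex b j" using b(2) ex_eqI[of a b] by metis
      then obtain j where j: "ex a j \<noteq> ex b j" ..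
      \<comment> \<open>Translation by \<open>u\<close> multiplies the monomial with exponent
        \<open>k\<close> by 2 to the power \<open>ex k j\<close>, so it has different eigenvalues at
        \<open>a\<close> and \<open>b\<close>.\<close>
      define u :: "'n \<Rightarrow> complex" where "u i = (if i = j then 2 else 1)" for i
      have u: "u i \<noteq> 0" for i by (simp add: u_def)
      have tu: "tchar u k = 2 powi ex k j" for k
      proof -
        have "tchar u k = (\<Prod>i\<in>UNIV. if i = j then 2 powi ex k j else 1)"
          unfolding tchar_def by (intro prod.cong) (auto simp: u_def)
        then show ?thesis by simp
      qed
      have "2 powi ex b j \<noteq> (2 powi ex a j :: complex)"
      proof
        assume "2 powi ex b j = (2 powi ex a j :: complex)"
        then have "norm (2 powi ex b j :: complex) = norm (2 powi ex a j :: complex)" by simp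
        then have "2 powi ex b j = (2 powi ex a j :: real)" by (simp add: norm_power_int)
        then show False
          using j power_int_strict_increasing[of "ex a j" "ex b j" "2::real"]
            power_int_strict_increasing[of "ex b j" "ex a j" "2::real"] by linarith
      qed
      then have ne: "tchar u b \<noteq> tchar u a" by (simp add: tu)
      \<comment> \<open>Subtracting the eigenvalue at \<open>a\<close> removes \<open>a\<close> from
        the support, while \<open>b\<close> survives.\<close>
      define h' where "h' = diag (tchar u) h - single 0 (tchar u a) * h"
      have lh': "lookup h' k = (tchar u k - tchar u a) * lookup h k" for k
        by (simp add: h'_def lookup_minus lookup_single_mult left_diff_distrib)
      have "keys h' \<subseteq> keys h - {a}" by (auto simp: in_keys_iff lh')
      then have "card (keys h') < card (keys h)"
        using a by (metis card_Diff1_less card_mono finite_Diff finite_keys order_le_less_trans)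
      moreover have "keval x h' = 0" if x: "\<And>j. x j \<noteq> 0" for x
      proof -
        have "keval x h' = keval (\<lambda>j. u j * x j) h - tchar u a * keval x h"
          using x unfolding h'_def
          by (simp add: hom_diff[OF is_hom_keval] hom_mult[OF is_hom_keval] keval_diag keval_single)
             (simp add: tchar_def)
        then show ?thesis using less.prems x u by simp
      qed
      ultimately have "h' = 0" by (rule less.hyps) blast
      then have "lookup h' b = 0" by simp
      then show False using ne b by (simp add: lh' in_keys_iff)
    qed
  qed
qed

subsection \<open>Polynomials inside Laurent polynomials\<close>

definition nonneg :: "'n laurent \<Rightarrow> bool" where
  "nonneg h \<longleftrightarrow> (\<forall>k\<in>keys h. \<forall>j. 0 \<le> ex k j)"

lemma nonneg_add: "nonneg f \<Longrightarrow> nonneg g \<Longrightarrow> nonneg (f + g)"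
  using keys_add[of f g] by (auto simp: nonneg_def)

lemma nonneg_mult: "nonneg f \<Longrightarrow> nonneg g \<Longrightarrow> nonneg (f * g)"
  using keys_mult[of f g] by (fastforce simp: nonneg_def)

lemma nonneg_single: "nonneg (single k c) \<longleftrightarrow> c = 0 \<or> (\<forall>j. 0 \<le> ex k j)"
  by (auto simp: nonneg_def)

lemma nonneg_zero [simp]: "nonneg 0"
  and nonneg_one [simp]: "nonneg 1"
  by (auto simp: nonneg_def)

definition kvar :: "'n::finite \<Rightarrow> 'n laurent" where
  "kvar j = xmon (expo (\<lambda>i. if i = j then 1 else 0))"

definition kemb :: "'n::finite cpoly \<Rightarrow> 'n laurent" where
  "kemb = pev kconst kvar"

lemma is_hom_kemb: "is_hom kemb"
  unfolding kemb_def by (rule is_hom_pev[OF is_hom_single])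

lemma kemb_cconst [simp]: "kemb (cconst c) = kconst c"
  by (simp add: kemb_def pev_cconst is_hom_single)

lemma kemb_cvar [simp]: "kemb (cvar j) = kvar j"
  by (simp add: kemb_def pev_cvar is_hom_single)

lemma keval_kvar: "keval x (kvar j) = x j"
proof -
  have "keval x (kvar j) = (\<Prod>i\<in>UNIV. if i = j then x j else 1)"
    unfolding kvar_def keval_single tchar_def mult_1 by (intro prod.cong) auto
  then show ?thesis by simp
qed

lemma keval_kconst: "keval x (kconst c) = c"
  by (simp add: keval_single tchar_def)

lemma keval_kemb:
  assumes "\<And>j. x j \<noteq> 0"
  shows "keval x (kemb p) = ceval p x"
  by (rule hom_cpoly_eqI[where f = "\<lambda>p. keval x (kemb p)"])
    (auto intro!: is_hom_comp[OF is_hom_keval] is_hom_kemb is_hom_ceval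
      simp: keval_kvar keval_kconst assms)

lemma nonneg_kemb: "nonneg (kemb p)"
proof (induction p rule: cpoly_induct)
  case (var j)
  show ?case by (simp add: kvar_def nonneg_single)
qed (auto simp: homs[OF is_hom_kemb] nonneg_add nonneg_mult nonneg_single)

lemma xmon_conv_kvar:
  fixes m :: "'n::finite \<Rightarrow> nat"
  shows "(\<Prod>j\<in>UNIV. kvar j ^ m j) = xmon (expo (\<lambda>j. int (m j)))"
proof -
  have "(\<Sum>j\<in>UNIV. \<Sum>i<m j. expo (\<lambda>i. if i = j then 1 else 0)) = expo (\<lambda>j. int (m j))"
    by (rule ex_eqI) (simp add: if_distrib cong: if_cong)
  then show ?thesis unfolding kvar_def by (simp only: xmon_power xmon_sum)
qed

lemma nonneg_imp_kemb:
  assumes "nonneg h"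
  obtains p where "kemb p = h"
proof -
  have "\<exists>p. kemb p = (\<Sum>k\<in>A. single k (lookup h k))" if "finite A" "A \<subseteq> keys h" for A
    using that
  proof (induction A rule: finite_induct)
    case empty
    show ?case by (rule exI[of _ 0]) (simp add: hom_zero[OF is_hom_kemb])
  next
    case (insert k A)
    then obtain p where p: "kemb p = (\<Sum>k\<in>A. single k (lookup h k))" by auto
    have "expo (\<lambda>j. int (nat (ex k j))) = k"
      using assms insert.prems by (intro ex_eqI) (simp add: nonneg_def)
    then have "kemb (cconst (lookup h k) * (\<Prod>j\<in>UNIV. cvar j ^ nat (ex k j))) = single k (lookup h k)"
      by (simp add: homs[OF is_hom_kemb] xmon_conv_kvar mult_single)
    then show ?case using insert.hyps p
      by (intro exI[of _ "cconst (lookup h k) * (\<Prod>j\<in>UNIV. cvar j ^ nat (ex k j)) + p"])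
        (simp add: hom_add[OF is_hom_kemb])
  qed
  from this[of "keys h"] show ?thesis
    using that by (auto simp flip: poly_mapping_sum_single)
qed

section \<open>The coordinate ring inside the Laurent polynomials\<close>

lemma nonneg_sum: "(\<And>i. i \<in> A \<Longrightarrow> nonneg (f i)) \<Longrightarrow> nonneg (sum f A)"
  by (induction A rule: infinite_finite_induct) (auto intro: nonneg_add)

lemma nonneg_uminus: "nonneg f \<Longrightarrow> nonneg (- f)"
  by (simp add: nonneg_def)

lemma nonneg_coeff_mult:
  "(\<And>i. nonneg (coeff p i)) \<Longrightarrow> (\<And>i. nonneg (coeff q i)) \<Longrightarrow> nonneg (coeff (p * q) i)"
  by (auto simp: coeff_mult intro!: nonneg_sum nonneg_mult)

definition xpow :: "('n::finite \<Rightarrow> int) \<Rightarrow> 'n laurent" where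
  "xpow f = xmon (expo f)"

lemma xpow_mult: "xpow f * xpow g = xpow (\<lambda>j. f j + g j)"
  unfolding xpow_def xmon_mult by (rule arg_cong[where f = xmon]) (auto intro: ex_eqI)

lemma xpow_0: "xpow (\<lambda>j. 0) = 1"
proof -
  have "expo (\<lambda>j. 0) = (0 :: 'a expo)" by (rule ex_eqI) simp
  then show ?thesis by (simp add: xpow_def)
qed

lemma xpow_power: "xpow f ^ k = xpow (\<lambda>j. f j * int k)"
  by (induction k) (auto simp: xpow_0 xpow_mult algebra_simps)

lemma xpow_nz [simp]: "xpow f \<noteq> 0"
  by (simp add: xpow_def)

lemma nonneg_xpow: "nonneg (xpow f) \<longleftrightarrow> (\<forall>j. f j \<ge> 0)"
  by (simp add: xpow_def nonneg_single)

locale danielewski =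
  fixes m :: "'n::finite \<Rightarrow> nat" and r :: nat and \<sigma> :: "nat \<Rightarrow> 'n cpoly"
  assumes r: "r \<ge> 2"
begin

definition "dP = (\<Prod>i=1..r. [: - kemb (\<sigma> i), 1 :])"

abbreviation "xm \<equiv> xpow (\<lambda>j. int (m j))"
abbreviation "xi \<equiv> xpow (\<lambda>j. - int (m j))"

definition "dZ = smult xi dP"

fun gen :: "'n coord \<Rightarrow> 'n laurent poly" where
  "gen (CX j) = [:kvar j:]"
| "gen CY = [:0, 1:]"
| "gen CZ = dZ"

text \<open>A regular function is identified with its restriction to the open set where no \<open>x\<^sub>j\<close>
  vanishes; there \<open>(x, y)\<close> are coordinates and \<open>z = x\<^sup>-\<^sup>m \<Prod>(y - \<sigma>\<^sub>i(x))\<close>.\<close>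

definition "theta = pev (\<lambda>c. [:kconst c:]) gen"

abbreviation "A \<equiv> range theta"

lemma is_hom_pconst: "is_hom (\<lambda>c. [:kconst c:])"
  by (rule is_hom_comp[OF is_hom_const_poly is_hom_single])

lemma is_hom_theta: "is_hom theta"
  unfolding theta_def by (rule is_hom_pev[OF is_hom_pconst])

lemmas theta_homs = homs[OF is_hom_theta]

lemma theta_cconst [simp]: "theta (cconst c) = [:kconst c:]"
  by (simp add: theta_def pev_cconst is_hom_pconst)

lemma theta_cvar [simp]: "theta (cvar v) = gen v"
  by (simp add: theta_def pev_cvar is_hom_pconst)

lemma A_add: "a \<in> A \<Longrightarrow> b \<in> A \<Longrightarrow> a + b \<in> A"
  by (auto simp: hom_add[OF is_hom_theta, symmetric])

lemma A_mult: "a \<in> A \<Longrightarrow> b \<in> A \<Longrightarrow> a * b \<in> A"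
  by (auto simp: hom_mult[OF is_hom_theta, symmetric])

lemma A_gen: "gen v \<in> A"
  by (metis theta_cvar rangeI)

lemma A_const: "[:kconst c:] \<in> A"
  by (metis theta_cconst rangeI)

lemma A_one: "1 \<in> A"
  using A_const[of 1] by (simp add: one_pCons)

lemma A_power: "a \<in> A \<Longrightarrow> a ^ n \<in> A"
  by (induction n) (auto simp: A_one A_mult)

lemma A_prod: "(\<And>i. i \<in> I \<Longrightarrow> f i \<in> A) \<Longrightarrow> prod f I \<in> A"
  by (induction I rule: infinite_finite_induct) (auto simp: A_one A_mult)

lemma A_kemb: "[:kemb p:] \<in> A"
proof (induction p rule: cpoly_induct)
  case (var v) show ?case using A_gen[of "CX v"] by simp
next
  case (add f g) then show ?case using A_add[OF add] by (simp add: homs[OF is_hom_kemb])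
next
  case (mult f g) then show ?case using A_mult[OF mult] by (simp add: homs[OF is_hom_kemb] ac_simps)
qed (simp add: A_const)

lemma A_nonneg: "nonneg h \<Longrightarrow> [:h:] \<in> A"
  by (metis A_kemb nonneg_imp_kemb)

lemma monic_dP: "degree dP = r" "coeff dP r = 1"
proof -
  have "degree dP = (\<Sum>i=1..r. degree [: - kemb (\<sigma> i), 1 :])"
    unfolding dP_def by (rule degree_prod_eq_sum_degree) auto
  then show deg: "degree dP = r" by simp
  have "lead_coeff dP = 1"
    unfolding dP_def by (simp add: lead_coeff_prod)
  then show "coeff dP r = 1" by (simp add: deg)
qed

lemma dP_nz [simp]: "dP \<noteq> 0"
  using monic_dP(2) by auto

lemma nonneg_coeff_dP: "nonneg (coeff dP k)"
proof -
  have "\<And>k. nonneg (coeff (\<Prod>i\<in>I. [: - kemb (\<sigma> i), 1 :]) k)" if "finite I" for I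
    using that
  proof (induction I rule: finite_induct)
    case empty then show ?case by (simp add: coeff_1)
  next
    case (insert i I)
    have "nonneg (coeff [: - kemb (\<sigma> i), 1 :] k)" for k
      by (auto simp: coeff_pCons nonneg_uminus nonneg_kemb split: nat.split)
    then show ?case using insert by (auto intro!: nonneg_coeff_mult simp del: mult_pCons_left)
  qed
  then show ?thesis unfolding dP_def by simp
qed

lemma xm_xi: "xm * xi = 1" "xi * xm = 1"
  by (simp_all add: xpow_mult xpow_0)

lemma xm_dZ: "smult xm dZ = dP"
  by (simp add: dZ_def xm_xi)

lemma dZ_nz [simp]: "dZ \<noteq> 0"
  by (simp add: dZ_def)

lemma degree_dZ: "degree dZ = r" and lead_dZ: "lead_coeff dZ = xi"
  by (simp_all add: dZ_def monic_dP)

text \<open>The \<open>dE b\<close> form a basis of the coordinate ring over the polynomials in \<open>x\<close>.\<close>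

definition "dE b = dZ ^ (b div r) * [:0, 1:] ^ (b mod r)"

lemma dE_nz [simp]: "dE b \<noteq> 0"
  by (simp add: dE_def)

lemma degree_dE: "degree (dE b) = b"
  by (simp add: dE_def degree_mult_eq degree_power_eq degree_dZ degree_linear_power[of 0, simplified] mult.commute)

lemma lead_dE: "lead_coeff (dE b) = xi ^ (b div r)"
  by (simp add: dE_def lead_coeff_mult lead_coeff_power lead_dZ)

definition "W h \<longleftrightarrow> (\<exists>g N. (\<forall>b. nonneg (g b)) \<and> h = (\<Sum>b<N. smult (g b) (dE b)))"

lemma W_0: "W 0"
  unfolding W_def by (rule exI[of _ "\<lambda>_. 0"], rule exI[of _ 0]) simp

lemma W_add:
  assumes "W h" "W h'" shows "W (h + h')"
proof -
  obtain g N where g: "\<forall>b. nonneg (g b)" "h = (\<Sum>b<N. smult (g b) (dE b))"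
    using assms(1) unfolding W_def by (elim exE conjE)
  obtain g' N' where g': "\<forall>b. nonneg (g' b)" "h' = (\<Sum>b<N'. smult (g' b) (dE b))"
    using assms(2) unfolding W_def by (elim exE conjE)
  define g'' where "g'' b = (if b < N then g b else 0) + (if b < N' then g' b else 0)" for b
  have ext: "(\<Sum>b<M. smult (f b) (dE b)) = (\<Sum>b<max N N'. smult (if b < M then f b else 0) (dE b))"
    if "M \<le> max N N'" for M f
    using that by (intro sum.mono_neutral_cong_left) auto
  have "h + h' = (\<Sum>b<max N N'. smult (g'' b) (dE b))"
    unfolding g''_def smult_add_left sum.distrib g(2) g'(2) by (intro arg_cong2[where f = plus] ext) simp_all
  then show ?thesis
    unfolding W_def using g(1) g'(1)
    by (intro exI[of _ g''] exI[of _ "max N N'"]) (auto simp: g''_def intro!: nonneg_add)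
qed

lemma W_sum: "(\<And>i. i \<in> I \<Longrightarrow> W (f i)) \<Longrightarrow> W (sum f I)"
  by (induction I rule: infinite_finite_induct) (auto intro: W_add W_0)

lemma W_smult:
  assumes "nonneg c" "W h" shows "W (smult c h)"
proof -
  obtain g N where g: "\<forall>b. nonneg (g b)" "h = (\<Sum>b<N. smult (g b) (dE b))"
    using assms(2) unfolding W_def by (elim exE conjE)
  have "smult c h = (\<Sum>b<N. smult (c * g b) (dE b))"
    using sum_distrib_left[of "[:c:]" "\<lambda>b. smult (g b) (dE b)" "{..<N}"] by (simp add: g(2) mult.commute)
  then show ?thesis unfolding W_def using assms(1) g(1)
    by (intro exI[of _ "\<lambda>b. c * g b"] exI[of _ N]) (simp add: nonneg_mult)
qed

lemma W_dE: "W (dE b)"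
  unfolding W_def
  by (intro exI[of _ "\<lambda>i. if i = b then 1 else 0"] exI[of _ "Suc b"])
    (auto simp: lessThan_Suc intro!: sum.neutral[symmetric])

lemma W_diff: "W h \<Longrightarrow> W h' \<Longrightarrow> W (h - h')"
  using W_add[of h "smult (- 1) h'"] W_smult[of "- 1" h'] by (simp add: nonneg_uminus)

text \<open>Closure under the generators gives closure under the whole coordinate ring.
  Multiplication by z shifts \<open>b\<close> by \<open>r\<close>; multiplication by y shifts it by
  one, unless the power of y is already r - 1 and y^r has to be rewritten.\<close>

lemma W_mult_gen:
  assumes "W h" shows "W (gen v * h)"
proof -
  have lin: "W (T * h)" if "\<And>b. W (T * dE b)" for T
  proof -
    obtain g N where g: "\<forall>b. nonneg (g b)" "h = (\<Sum>b<N. smult (g b) (dE b))"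
      using assms unfolding W_def by (elim exE conjE)
    then have "T * h = (\<Sum>b<N. smult (g b) (T * dE b))"
      by (simp add: sum_distrib_left)
    then show ?thesis using g that by (auto intro!: W_sum W_smult)
  qed
  have E: "dZ ^ k * [:0, 1:] ^ i = dE (k * r + i)" if "i < r" for k i
    using that by (simp add: dE_def)
  show ?thesis
  proof (cases v)
    case (CX j)
    have "nonneg (kvar j)" using nonneg_kemb[of "cvar j"] by simp
    then show ?thesis using CX assms W_smult by simp
  next
    case CZ
    have "dZ * dE b = dE (b + r)" for b
      using r by (simp add: dE_def)
    then show ?thesis unfolding CZ gen.simps by (intro lin) (simp add: W_dE)
  next
    case CY
    have "W ([:0, 1:] * dE b)" for b
    proof (cases "Suc (b mod r) < r")
      case True
      then have "[:0, 1:] * dE b = dE ((b div r) * r + Suc (b mod r))"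
        by (subst E[symmetric]) (auto simp: dE_def)
      then show ?thesis by (simp only: W_dE)
    next
      case False
      define k where "k = b div r"
      have mod: "Suc (b mod r) = r" using False r mod_less_divisor[of r b] by linarith
      have "T * (S * T ^ i) = S * T ^ Suc i" for T S :: "'n laurent poly" and i
        by (simp add: mult.left_commute)
      then have "[:0, 1:] * dE b = dZ ^ k * [:0, 1:] ^ Suc (b mod r)"
        by (simp only: dE_def k_def)
      also have "\<dots> = dZ ^ k * [:0, 1:] ^ r" by (simp only: mod)
      \<comment> \<open>The equation x^m z = P(y), with P monic of degree r, solved for y^r. The
        other terms have lower powers of y and polynomial coefficients.\<close>
      also have "[:0, 1:] ^ r = smult xm dZ - (\<Sum>i<r. smult (coeff dP i) ([:0, 1:] ^ i))"
      proof -
        have "dP = (\<Sum>i\<le>r. monom (coeff dP i) i)"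
          using poly_as_sum_of_monoms[of dP] by (simp add: monic_dP)
        also have "\<dots> = (\<Sum>i\<le>r. smult (coeff dP i) ([:0, 1:] ^ i))"
          by (simp add: monom_altdef)
        also have "\<dots> = (\<Sum>i<r. smult (coeff dP i) ([:0, 1:] ^ i)) + [:0, 1:] ^ r"
          using monic_dP by (simp add: lessThan_Suc_atMost[symmetric])
        finally show ?thesis unfolding xm_dZ eq_diff_eq by (rule trans[OF add.commute sym])
      qed
      also have "dZ ^ k * \<dots> = smult xm (dZ ^ Suc k * [:0, 1:] ^ 0)
          - (\<Sum>i<r. smult (coeff dP i) (dZ ^ k * [:0, 1:] ^ i))"
        by (simp add: right_diff_distrib sum_distrib_left mult.commute del: mult_pCons_left mult_pCons_right)
      also have "\<dots> = smult xm (dE (Suc k * r + 0))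
          - (\<Sum>i<r. smult (coeff dP i) (dE (k * r + i)))"
        by (intro arg_cong2[where f = minus] sum.cong arg_cong2[where f = smult] E refl) (use r in auto)
      finally show ?thesis
        by (simp only:) (intro W_diff W_sum W_smult W_dE nonneg_coeff_dP, simp add: nonneg_xpow)
    qed
    then show ?thesis unfolding CY gen.simps by (intro lin)
  qed
qed

lemma W_theta: "W (theta p)"
proof -
  have "\<And>h. W h \<Longrightarrow> W (theta p * h)"
  proof (induction p rule: cpoly_induct)
    case (const c) then show ?case by (simp add: W_smult nonneg_single)
  next
    case (var v) then show ?case by (simp add: W_mult_gen)
  next
    case (add f g) then show ?case by (simp add: theta_homs distrib_right W_add)
  next
    case (mult f g) then show ?case by (simp add: theta_homs mult.assoc)
  qed
  from this[of "dE 0"] show ?thesis by (simp add: W_dE) (simp add: dE_def)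
qed

text \<open>The normal form \<open>W\<close> enters the rest of the argument only through this bound on the pole
  order of a leading coefficient.\<close>

lemma A_lead:
  assumes "h \<in> A" "h \<noteq> 0"
  shows "nonneg (xm ^ (degree h div r) * lead_coeff h)"
proof -
  \<comment> \<open>Since \<open>dE b\<close> has degree exactly \<open>b\<close>, the last nonzero
    summand determines the leading term and nothing cancels; \<open>xm ^ (N div r)\<close> clears
    precisely the pole of \<open>dE N\<close>.\<close>
  have "(\<Sum>b<N. smult (g b) (dE b)) = 0 \<or>
      nonneg (xm ^ (degree (\<Sum>b<N. smult (g b) (dE b)) div r) * lead_coeff (\<Sum>b<N. smult (g b) (dE b)))"
    if "\<And>b. nonneg (g b)" for g N
  proof (induction N)
    case (Suc N)
    let ?s = "\<Sum>b<N. smult (g b) (dE b)"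
    show ?case
    proof (cases "g N = 0")
      case False
      have deg: "degree (smult (g N) (dE N)) = N" using False by (simp add: degree_dE)
      have lt: "?s = 0 \<or> degree ?s < N"
      proof (cases N)
        case (Suc M)
        have "degree ?s \<le> M"
          using Suc by (intro degree_sum_le) (auto simp: degree_dE intro!: order_trans[OF degree_smult_le])
        then show ?thesis using Suc by simp
      qed simp
      have "degree (?s + smult (g N) (dE N)) = N"
        "lead_coeff (?s + smult (g N) (dE N)) = g N * xi ^ (N div r)"
        using lt deg degree_add_eq_right[of ?s "smult (g N) (dE N)"]
          lead_coeff_add_le[of ?s "smult (g N) (dE N)"]
        by (auto simp: lead_dE[unfolded degree_dE] degree_dE)
      moreover have "xm ^ k * (g N * xi ^ k) = g N" for k
        by (metis (no_types, lifting) mult.left_commute mult.right_neutral power_mult_distrib power_one xm_xi(1))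
      ultimately have "xm ^ (degree (?s + smult (g N) (dE N)) div r) * lead_coeff (?s + smult (g N) (dE N)) = g N"
        by (simp only:)
      then show ?thesis unfolding sum.lessThan_Suc using that[of N] by (simp only: simp_thms)
    qed (use Suc in simp)
  qed simp
  note lead = this
  obtain p where p: "h = theta p" using assms by auto
  obtain g N where g: "\<forall>b. nonneg (g b)" and h: "h = (\<Sum>b<N. smult (g b) (dE b))"
    using W_theta[of p] unfolding W_def p by (elim exE conjE)
  show ?thesis using lead[of g N] g assms(2) unfolding h by simp
qed

lemma A_degree_0:
  assumes "h \<in> A" "degree h = 0"
  obtains c where "nonneg c" "h = [:c:]"
proof -
  obtain c where c: "h = [:c:]" using assms(2) by (rule degree_eq_zeroE)
  moreover have "nonneg c"
    using A_lead[OF assms(1)] c by (cases "c = 0") simp_all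
  ultimately show ?thesis using that by simp
qed

end

section \<open>Locally nilpotent derivations\<close>

text \<open>Here \<open>\<mu>, \<mu>0\<close> are the nonnegative weights and \<open>(e, f)\<close> is the degree of a homogeneous
  locally nilpotent derivation that does not lower the degree in \<open>y\<close>; the sharp inputs are
  \<open>m j \<ge> 2\<close> and \<open>r \<ge> 2\<close>.\<close>

lemma no_homogeneous_lnd:
  fixes \<mu> e m :: "'n::finite \<Rightarrow> int" and \<mu>0 f r :: int
  assumes \<mu>: "\<And>j. \<mu> j \<ge> 0" and \<mu>0: "\<mu>0 \<ge> 0" and m: "\<And>j. m j \<ge> 2" and r: "r \<ge> 2" and f: "f \<ge> 0"
    and S1: "(\<Sum>j\<in>UNIV. \<mu> j * e j) + \<mu>0 * f = - 1"
    and S2: "r * \<mu>0 - (\<Sum>j\<in>UNIV. m j * \<mu> j) \<ge> 0"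
    and Hy: "\<And>j. \<mu>0 > 0 \<Longrightarrow> e j + m j * ((f + 1) div r) \<ge> 0"
    and Hx: "\<And>j. \<mu> j > 0 \<Longrightarrow> 1 + e j + m j * (f div r) \<ge> 0"
    and Hz: "\<And>j. r * \<mu>0 - (\<Sum>j\<in>UNIV. m j * \<mu> j) > 0 \<Longrightarrow> - m j + e j + m j * ((f + r) div r) \<ge> 0"
  shows False
proof -
  define M where "M = (\<Sum>j\<in>UNIV. m j * \<mu> j)"
  have "\<exists>j. \<mu> j > 0"
  proof (rule ccontr)
    assume "\<not> ?thesis"
    then have "\<mu> j = 0" for j using \<mu>[of j] by (meson antisym_conv not_le)
    then have "\<mu>0 * f = - 1" using S1 by simp
    then show False using \<mu>0 f mult_nonneg_nonneg[of \<mu>0 f] by linarith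
  qed
  then obtain i where i: "\<mu> i > 0" by blast
  have "0 < m i * \<mu> i" using m[of i] i by simp
  also have "m i * \<mu> i \<le> M"
    unfolding M_def using m \<mu> by (intro member_le_sum) (auto intro!: mult_nonneg_nonneg order_trans[OF _ m])
  finally have "0 < r * \<mu>0" using S2 M_def by linarith
  then have \<mu>0': "\<mu>0 > 0" using \<mu>0 by (cases "\<mu>0 = 0") auto
  \<comment> \<open>A derivation of degree \<open>(e, f)\<close> sends y to degree
    \<open>(e, f + 1)\<close>, where the pole x^(-m Q) is allowed. So \<open>w j\<close> is the
    exponent of x_j that is left after clearing it.\<close>
  define Q where "Q = (f + 1) div r"
  define w where "w j = e j + m j * Q" for j
  have sw: "(\<Sum>j\<in>UNIV. \<mu> j * w j) = - 1 - \<mu>0 * f + Q * M"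
    using S1 by (simp add: w_def M_def algebra_simps sum.distrib sum_distrib_left)
  have w0: "w j \<ge> 0" for j using Hy[OF \<mu>0', of j] by (simp add: w_def Q_def)
  \<comment> \<open>Nonnegativity of the weighted sum of the \<open>w j\<close> gives f < Q r, while
    Q r \<le> f + 1 by the choice of \<open>Q\<close>. Hence f = Q r - 1: passing from degree f to f
    + 1 is just where one more pole is allowed.\<close>
  have "0 \<le> - 1 - \<mu>0 * f + Q * M" unfolding sw[symmetric] using w0 \<mu> by (intro sum_nonneg) simp
  moreover have "Q * M \<le> Q * (r * \<mu>0)"
    using S2 M_def f r by (intro mult_left_mono) (auto simp: Q_def pos_imp_zdiv_nonneg_iff)
  ultimately have "0 < (Q * r - f) * \<mu>0" by (simp add: algebra_simps)
  then have "f < Q * r" using \<mu>0' by (simp add: zero_less_mult_iff)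
  moreover have "Q * r \<le> f + 1" unfolding Q_def using r div_mult_mod_eq[of "f + 1" r] pos_mod_sign[of r "f + 1"] by linarith
  ultimately have f_eq: "f = Q * r - 1" by linarith
  have fdiv: "f div r = Q - 1"
  proof -
    have "f = (r - 1) + (Q - 1) * r" by (simp add: f_eq algebra_simps)
    then show ?thesis using r by (simp only: div_mult_self1) simp
  qed
  have frdiv: "(f + r) div r = Q"
    using fdiv r by simp
  have sw': "(\<Sum>j\<in>UNIV. \<mu> j * w j) = \<mu>0 - 1 - Q * (r * \<mu>0 - M)"
    unfolding sw f_eq by (simp add: algebra_simps)
  have Q1: "Q \<ge> 1"
    using f f_eq r by (smt (verit) mult_nonneg_nonneg mult_nonpos_nonneg)
  have S2': "r * \<mu>0 - M \<ge> 0" using S2 by (simp add: M_def)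
  have rge: "2 * \<mu>0 \<le> r * \<mu>0" using r \<mu>0 by (intro mult_right_mono) auto
  \<comment> \<open>If z had positive weight, its bound would read \<open>w j \<ge> m j\<close>, and
    the weighted sum would exceed the value found in \<open>sw'\<close>.\<close>
  have Mz: "r * \<mu>0 - M = 0"
  proof (rule ccontr)
    assume "r * \<mu>0 - M \<noteq> 0"
    then have z: "r * \<mu>0 - M > 0" using S2' by simp
    have "w j \<ge> m j" for j
      using Hz[of j] z frdiv by (simp add: w_def M_def)
    then have "M \<le> (\<Sum>j\<in>UNIV. \<mu> j * w j)"
      unfolding M_def using \<mu> by (intro sum_mono) (metis mult.commute mult_left_mono)
    moreover have "1 * (r * \<mu>0 - M) \<le> Q * (r * \<mu>0 - M)"
      using Q1 S2' by (intro mult_right_mono)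
    ultimately show False unfolding sw' mult_1 using rge \<mu>0'
      by (smt (verit))
  qed
  \<comment> \<open>The bound from x_j gives only m_j - 1, which is still at least m_j / 2.
    Summation yields r \<mu>0 = M \<le> 2 (\<mu>0 - 1), against r \<ge> 2.\<close>
  have "m j * \<mu> j \<le> 2 * (\<mu> j * w j)" for j
  proof (cases "\<mu> j = 0")
    case False
    then have "\<mu> j > 0" using \<mu>[of j] by simp
    then have "w j \<ge> m j - 1" using Hx[of j] fdiv by (simp add: w_def algebra_simps)
    then have "m j \<le> 2 * w j" using m[of j] by linarith
    then have "\<mu> j * m j \<le> \<mu> j * (2 * w j)" using \<mu>[of j] by (rule mult_left_mono)
    then show ?thesis by (simp add: algebra_simps)
  qed simp
  then have "M \<le> 2 * (\<Sum>j\<in>UNIV. \<mu> j * w j)"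
    unfolding M_def sum_distrib_left by (intro sum_mono)
  then show False using sw' Mz rge \<mu>0' by simp
qed

section \<open>Leading terms of derivations of the Laurent ring\<close>

lemma coeff_mult_top:
  fixes p q :: "'a::comm_ring_1 poly"
  assumes "degree p \<le> a" "degree q \<le> b"
  shows "coeff (p * q) (a + b) = coeff p a * coeff q b"
proof (cases "degree p = a \<and> degree q = b")
  case True then show ?thesis using coeff_mult_degree_sum[of p q] by auto
next
  case False
  then have "degree p + degree q < a + b" using assms by linarith
  then have "coeff (p * q) (a + b) = 0"
    by (intro coeff_eq_0) (metis degree_mult_le le_less_trans)
  moreover have "coeff p a = 0 \<or> coeff q b = 0"
    using False assms by (metis coeff_eq_0 le_neq_implies_less)
  ultimately show ?thesis by auto
qed

abbreviation peuler :: "'n \<Rightarrow> 'n laurent poly \<Rightarrow> 'n laurent poly" where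
  "peuler j \<equiv> map_poly (euler j)"

lemma coeff_peuler: "coeff (peuler j h) n = euler j (coeff h n)"
  by (simp add: coeff_map_poly)

lemma euler_sum: "euler j (sum f I) = (\<Sum>i\<in>I. euler j (f i))"
  by (induction I rule: infinite_finite_induct) (auto simp: euler_add)

lemma peuler_add: "peuler j (f + g) = peuler j f + peuler j g"
  by (rule poly_eqI) (simp add: coeff_peuler euler_add)

lemma peuler_mult: "peuler j (f * g) = peuler j f * g + f * peuler j g"
  by (rule poly_eqI) (simp add: coeff_peuler coeff_mult euler_sum euler_mult sum.distrib)

lemma degree_peuler: "degree (peuler j h) \<le> degree h"
  by (rule degree_le) (simp add: coeff_peuler coeff_eq_0)

lemma lookup_of_nat_mult: "lookup (of_nat b * h) k = of_nat b * lookup (h :: 'n::finite laurent) k"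
  by (simp add: lookup_single_mult flip: single_of_nat)

context danielewski
begin

text \<open>Here \<open>c j\<close> is a logarithmic coefficient, the image of x_j divided by x_j,
  whereas \<open>d\<close> is the image of y itself. Therefore terms of degree f in
  \<open>c j\<close> and of degree f + 1 in \<open>d\<close> shift the degree in y equally.\<close>

definition deriv :: "('n \<Rightarrow> 'n laurent poly) \<Rightarrow> 'n laurent poly \<Rightarrow> 'n laurent poly \<Rightarrow> 'n laurent poly" where
  "deriv c d h = (\<Sum>j\<in>UNIV. c j * peuler j h) + d * pderiv h"

lemma deriv_add: "deriv c d (f + g) = deriv c d f + deriv c d g"
  by (simp add: deriv_def peuler_add pderiv_add algebra_simps sum.distrib)

lemma deriv_mult: "deriv c d (f * g) = deriv c d f * g + f * deriv c d g"
  by (simp add: deriv_def peuler_mult pderiv_mult algebra_simps sum.distrib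
      sum_distrib_left sum_distrib_right)

lemma euler_kconst: "euler j (kconst a) = 0"
  by (simp add: euler_single)

lemma euler_kvar: "euler i (kvar j) = (if i = j then kvar j else 0)"
  by (simp add: kvar_def euler_single)

lemma deriv_gens:
  "deriv c d [:kconst a:] = 0"
  "deriv c d [:kvar j:] = c j * [:kvar j:]"
  "deriv c d [:0, 1:] = d"
proof -
  have pc: "peuler i [:a:] = [:euler i a:]" for i :: 'n and a
    by (rule poly_eqI) (simp add: coeff_peuler coeff_pCons split: nat.split)
  have "peuler i [:0, 1:] = 0" for i :: 'n
    using euler_kconst[of i 1] by (intro poly_eqI) (simp add: coeff_peuler coeff_pCons split: nat.split)
  then show "deriv c d [:0, 1:] = d" by (simp add: deriv_def pderiv_pCons)
  show "deriv c d [:kconst a:] = 0" by (simp add: deriv_def pc euler_kconst pderiv_pCons)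
  have "(\<Sum>i\<in>UNIV. c i * peuler i [:kvar j:]) = (\<Sum>i\<in>UNIV. if i = j then c j * [:kvar j:] else 0)"
    by (intro sum.cong) (auto simp: pc euler_kvar)
  then show "deriv c d [:kvar j:] = c j * [:kvar j:]" by (simp add: deriv_def pderiv_pCons)
qed

text \<open>On a monomial of degree \<open>(s, b)\<close> the Euler operators act by the entries of
  \<open>s\<close> and y d/dy acts by \<open>b\<close>. So the top part of the derivation shifts it
  by \<open>(e, f)\<close> and multiplies it by a number linear in \<open>(s, b)\<close>. Upper
  bounds are used throughout, which keeps the statement valid when this number is 0.\<close>

lemma deriv_lead:
  assumes c: "\<And>j. degree (c j) \<le> f" and d: "degree d \<le> Suc f"
    and kc: "\<And>j k. k \<in> keys (coeff (c j) f) \<Longrightarrow> k \<le> e" and kd: "\<And>k. k \<in> keys (coeff d (Suc f)) \<Longrightarrow> k \<le> e"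
    and h: "degree h \<le> b" and kh: "\<And>k. k \<in> keys (coeff h b) \<Longrightarrow> k \<le> s"
  shows "degree (deriv c d h) \<le> f + b"
    and "k \<in> keys (coeff (deriv c d h) (f + b)) \<Longrightarrow> k \<le> e + s"
    and "lookup (coeff (deriv c d h) (f + b)) (e + s) =
      ((\<Sum>j\<in>UNIV. lookup (coeff (c j) f) e * of_int (ex s j)) + lookup (coeff d (Suc f)) e * of_nat b)
        * lookup (coeff h b) s"
proof -
  have pe: "degree (peuler j h) \<le> b" for j by (rule order_trans[OF degree_peuler h])
  have ke: "k \<le> s" if "k \<in> keys (euler j (coeff h b))" for j k
    by (rule kh[OF subsetD[OF keys_euler that]])
  have kb: "k \<le> s" if "k \<in> keys (of_nat b * coeff h b)" for k
    by (rule kh) (use that in \<open>auto simp: in_keys_iff lookup_of_nat_mult\<close>)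
  have pd: "degree (d * pderiv h) \<le> f + b"
    "coeff (d * pderiv h) (f + b) = coeff d (Suc f) * (of_nat b * coeff h b)"
  proof -
    show "degree (d * pderiv h) \<le> f + b"
    proof (cases "degree h")
      case 0 then show ?thesis using pderiv_eq_0_iff[of h] by simp
    next
      case (Suc n)
      then show ?thesis using degree_mult_le[of d "pderiv h"] degree_pderiv[of h] d h by linarith
    qed
    show "coeff (d * pderiv h) (f + b) = coeff d (Suc f) * (of_nat b * coeff h b)"
    proof (cases b)
      case 0 then show ?thesis using h pderiv_eq_0_iff[of h] by simp
    next
      case (Suc n)
      have "degree (pderiv h) \<le> n" using degree_pderiv[of h] h Suc by linarith
      from coeff_mult_top[OF d this] show ?thesis by (simp add: Suc coeff_pderiv)
    qed
  qed
  show "degree (deriv c d h) \<le> f + b"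
    unfolding deriv_def
    by (intro degree_add_le degree_sum_le pd) (auto intro!: order_trans[OF degree_mult_le] add_mono c pe)
  have co: "coeff (deriv c d h) (f + b) =
      (\<Sum>j\<in>UNIV. coeff (c j) f * euler j (coeff h b)) + coeff d (Suc f) * (of_nat b * coeff h b)"
    by (simp add: deriv_def coeff_sum coeff_mult_top[OF c pe] coeff_peuler pd)
  have 1: "k \<le> e + s" if "k \<in> keys (coeff (c j) f * euler j (coeff h b))" for j k
    using that by (rule lookup_mult_top(2)[rotated 2]) (use kc ke in auto)
  have 2: "k \<le> e + s" if "k \<in> keys (coeff d (Suc f) * (of_nat b * coeff h b))" for k
    using that by (rule lookup_mult_top(2)[rotated 2]) (use kd kb in auto)
  show "k \<le> e + s" if "k \<in> keys (coeff (deriv c d h) (f + b))"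
  proof -
    have "k \<in> keys (\<Sum>j\<in>UNIV. coeff (c j) f * euler j (coeff h b)) \<union> keys (coeff d (Suc f) * (of_nat b * coeff h b))"
      by (rule subsetD[OF keys_add that[unfolded co]])
    moreover have "keys (\<Sum>j\<in>UNIV. coeff (c j) f * euler j (coeff h b))
        \<subseteq> (\<Union>j. keys (coeff (c j) f * euler j (coeff h b)))"
      by (auto simp: in_keys_iff lookup_sum intro: ccontr)
    ultimately show ?thesis using 1 2 by blast
  qed
  have "lookup (coeff (c j) f * euler j (coeff h b)) (e + s) = lookup (coeff (c j) f) e * (of_int (ex s j) * lookup (coeff h b) s)" for j
    by (subst lookup_mult_top(1)) (use kc ke in \<open>auto simp: lookup_euler\<close>)
  moreover have "lookup (coeff d (Suc f) * (of_nat b * coeff h b)) (e + s) = lookup (coeff d (Suc f)) e * (of_nat b * lookup (coeff h b) s)"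
    by (subst lookup_mult_top(1)) (use kd kb in \<open>auto simp: lookup_of_nat_mult\<close>)
  ultimately show "lookup (coeff (deriv c d h) (f + b)) (e + s) =
      ((\<Sum>j\<in>UNIV. lookup (coeff (c j) f) e * of_int (ex s j)) + lookup (coeff d (Suc f)) e * of_nat b)
        * lookup (coeff h b) s"
    unfolding co lookup_add lookup_sum by (simp add: sum_distrib_right distrib_right mult.assoc)
qed


text \<open>After i steps the degree is (s, b) + i (e, f), so by linearity the successive factors
  form an arithmetic progression with difference \<open>lam e f\<close>. The sum of \<open>e\<close>
  over \<open>i < n\<close> is the multiple n e.\<close>

lemma deriv_sum_iterate:
  assumes c: "\<And>j. degree (c j) \<le> f" and d: "degree d \<le> Suc f"
    and kc: "\<And>j k. k \<in> keys (coeff (c j) f) \<Longrightarrow> k \<le> e" and kd: "\<And>k. k \<in> keys (coeff d (Suc f)) \<Longrightarrow> k \<le> e"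
    and h: "degree h \<le> b" and kh: "\<And>k. k \<in> keys (coeff h b) \<Longrightarrow> k \<le> s"
  defines "lam \<equiv> \<lambda>s b. (\<Sum>j\<in>UNIV. lookup (coeff (c j) f) e * of_int (ex s j)) + lookup (coeff d (Suc f)) e * of_nat b"
  shows "degree ((deriv c d ^^ n) h) \<le> n * f + b \<and>
    (\<forall>k\<in>keys (coeff ((deriv c d ^^ n) h) (n * f + b)). k \<le> (\<Sum>i<n. e) + s) \<and>
    lookup (coeff ((deriv c d ^^ n) h) (n * f + b)) ((\<Sum>i<n. e) + s)
      = (\<Prod>i<n. lam s b + of_nat i * lam e f) * lookup (coeff h b) s"
proof (induction n)
  case 0
  then show ?case using h kh by simp
next
  case (Suc n)
  let ?h = "(deriv c d ^^ n) h"
  have deg: "degree ?h \<le> n * f + b" and k: "\<And>k. k \<in> keys (coeff ?h (n * f + b)) \<Longrightarrow> k \<le> (\<Sum>i<n. e) + s"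
    using Suc by blast+
  note L = deriv_lead[where c = c, OF c d kc kd deg k]
  have lam: "lam ((\<Sum>i<n. e) + s) (n * f + b) = lam s b + of_nat n * lam e f"
    by (simp add: lam_def algebra_simps sum.distrib sum_distrib_left)
  have 1: "Suc n * f + b = f + (n * f + b)" "(\<Sum>i<Suc n. e) + s = e + ((\<Sum>i<n. e) + s)"
    by (simp_all add: ac_simps)
  have 2: "(deriv c d ^^ Suc n) h = deriv c d ?h" by simp
  have 3: "lookup (coeff (deriv c d ?h) (f + (n * f + b))) (e + ((\<Sum>i<n. e) + s))
      = lam ((\<Sum>i<n. e) + s) (n * f + b) * lookup (coeff ?h (n * f + b)) ((\<Sum>i<n. e) + s)"
    using L(3) by (simp only: lam_def)
  show ?case unfolding 1 2
  proof (intro conjI ballI)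
    show "lookup (coeff (deriv c d ?h) (f + (n * f + b))) (e + ((\<Sum>i<n. e) + s))
      = (\<Prod>i<Suc n. lam s b + of_nat i * lam e f) * lookup (coeff h b) s"
      unfolding 3 lam prod.lessThan_Suc using Suc by (simp only: mult.assoc mult.left_commute mult.commute simp_thms)
  qed (use L in auto)
qed

text \<open>Reads \<open>A_lead\<close> off one exponent. An upper bound \<open>b\<close> on the
  degree is enough, since a coefficient of \<open>b\<close> with nonempty support is the leading
  one.\<close>

lemma A_lead_key:
  assumes "h \<in> A" "degree h \<le> b" "k \<in> keys (coeff h b)"
  shows "0 \<le> int (m j) * int (b div r) + ex k j"
proof -
  have nz: "coeff h b \<noteq> 0" using assms(3) by auto
  then have b: "degree h = b" using assms(2) le_degree[of h b] by simp
  have h: "h \<noteq> 0" using nz by auto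
  have "lookup (xm ^ (b div r) * coeff h b) (expo (\<lambda>j. int (m j) * int (b div r)) + k) = lookup (coeff h b) k"
    unfolding xpow_power unfolding xpow_def by (simp add: lookup_single_mult)
  then have "expo (\<lambda>j. int (m j) * int (b div r)) + k \<in> keys (xm ^ (b div r) * coeff h b)"
    using assms(3) by (simp add: in_keys_iff)
  moreover have "nonneg (xm ^ (b div r) * coeff h b)"
    using A_lead[OF assms(1) h] b by simp
  ultimately show ?thesis by (auto simp: nonneg_def dest!: bspec[of _ _ "expo (\<lambda>j. int (m j) * int (b div r)) + k"])
qed

text \<open>\<open>(e, f)\<close> is the leading degree of the derivation, with the degree in \<open>y\<close> compared first.
  It multiplies a term of degree \<open>(s, b)\<close> by the linear form \<open>lam s b\<close>, so by nilpotency
  \<open>lam\<close> vanishes somewhere on \<open>(s, b) + \<nat>(e, f)\<close> for each leading degree \<open>(s, b)\<close> of a regular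
  function.\<close>

lemma lnd_deriv:
  assumes DA: "\<And>h. h \<in> A \<Longrightarrow> deriv c d h \<in> A" and nil: "\<And>h. h \<in> A \<Longrightarrow> \<exists>k. (deriv c d ^^ k) h = 0"
    and m: "\<And>j. m j \<ge> 2"
  shows "(\<forall>j. c j = 0) \<and> degree d = 0"
proof (rule ccontr)
  assume contr: "\<not> ?thesis"
  \<comment> \<open>The shift by one in \<open>d\<close> reflects that d/dy lowers the degree in y.
    That no \<open>n\<close> qualifies is exactly the desired conclusion.\<close>
  define top where "top n \<longleftrightarrow> (\<exists>j. coeff (c j) n \<noteq> 0) \<or> coeff d (Suc n) \<noteq> 0" for n
  have "\<exists>n. top n"
  proof (rule ccontr)
    assume no: "\<not> (\<exists>n. top n)"
    then have "c j = 0" for j by (intro poly_eqI) (auto simp: top_def)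
    moreover have "degree d = 0"
      using no leading_coeff_0_iff[of d] by (cases "degree d") (auto simp: top_def)
    ultimately show False using contr by blast
  qed
  moreover have fin: "finite {n. top n}"
  proof (rule finite_subset)
    show "{n. top n} \<subseteq> (\<Union>j. {..degree (c j)}) \<union> {..degree d}"
      by (auto simp: top_def dest!: le_degree)
  qed simp
  ultimately have "top (Max {n. top n})" using Max_in[OF fin] by auto
  define f where "f = Max {n. top n}"
  have topf: "top f" unfolding f_def by fact
  have above: "n \<le> f" if "top n" for n unfolding f_def using fin that by simp
  have c: "degree (c j) \<le> f" for j
    by (rule degree_le) (meson above top_def not_le)
  have d: "degree d \<le> Suc f"
  proof (rule degree_le, intro allI impI)
    fix i assume i: "Suc f < i"
    then obtain i' where "i = Suc i'" by (cases i) auto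
    then show "coeff d i = 0" using above[of i'] i by (auto simp: top_def)
  qed
  define K where "K = (\<Union>j. keys (coeff (c j) f)) \<union> keys (coeff d (Suc f))"
  have finK: "finite K" by (auto simp: K_def)
  have neK: "K \<noteq> {}" using topf by (auto simp: K_def top_def)
  define e where "e = Max K"
  have eK: "e \<in> K" unfolding e_def using finK neK by simp
  have Ke: "k \<le> e" if "k \<in> K" for k unfolding e_def using finK that by simp
  have kc: "k \<le> e" if "k \<in> keys (coeff (c j) f)" for j k using that by (intro Ke) (auto simp: K_def)
  have kd: "k \<le> e" if "k \<in> keys (coeff d (Suc f))" for k using that by (intro Ke) (auto simp: K_def)
  define l where "l j = lookup (coeff (c j) f) e" for j
  define l0 where "l0 = lookup (coeff d (Suc f)) e"
  define lam where "lam s b = (\<Sum>j\<in>UNIV. l j * of_int (ex s j)) + l0 * of_nat b" for s b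
  define L where "L = lam e f"
  have iter: "degree ((deriv c d ^^ n) h) \<le> n * f + b \<and>
      lookup (coeff ((deriv c d ^^ n) h) (n * f + b)) ((\<Sum>i<n. e) + s)
        = (\<Prod>i<n. lam s b + of_nat i * L) * lookup (coeff h b) s"
    if "degree h \<le> b" "\<And>k. k \<in> keys (coeff h b) \<Longrightarrow> k \<le> s" for n h b s
    unfolding L_def lam_def l_def l0_def
    using deriv_sum_iterate[of c f d e h b s n] c d kc kd that by blast
  have star: "\<exists>i::nat. lam s b = - of_nat i * L"
    if h: "h \<in> A" "degree h \<le> b" "\<And>k. k \<in> keys (coeff h b) \<Longrightarrow> k \<le> s" "s \<in> keys (coeff h b)" for h b s
  proof -
    obtain n where n: "(deriv c d ^^ n) h = 0" using nil h by blast
    have "(\<Prod>i<n. lam s b + of_nat i * L) * lookup (coeff h b) s = 0"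
      using iter[of h b s n] h(2,3) unfolding n by simp
    then obtain i where "lam s b + of_nat i * L = 0" using h(4) by (auto simp: in_keys_iff)
    then show ?thesis by (intro exI[of _ i]) (simp add: eq_neg_iff_add_eq_0)
  qed
  have bound: "0 \<le> int (m j) * int ((f + b) div r) + ex e j + ex s j"
    if h: "h \<in> A" "degree h \<le> b" "\<And>k. k \<in> keys (coeff h b) \<Longrightarrow> k \<le> s" "s \<in> keys (coeff h b)"
      "lam s b \<noteq> 0" for h b s j
  proof -
    have "e + s \<in> keys (coeff (deriv c d h) (f + b))"
      using iter[of h b s 1] h(2-5) by (simp add: in_keys_iff)
    then show ?thesis
      using A_lead_key[OF DA[OF h(1)], of "f + b" "e + s" j] iter[of h b s 1] h(2,3) by (simp add: add.assoc)
  qed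
  have X: "lam (expo (\<lambda>i. if i = j then 1 else 0)) 0 = l j" for j
    by (simp add: lam_def if_distrib[of "\<lambda>x. _ * x"] if_distrib[of of_int] cong: if_cong)
  have kZ: "keys (coeff dZ r) = {expo (\<lambda>j. - int (m j))}"
    using lead_dZ by (simp add: degree_dZ xpow_def)
  have AX: "[:kvar j:] \<in> A" and AY: "[:0, 1:] \<in> A" and AZ: "dZ \<in> A" for j
    using A_gen[of "CX j"] A_gen[of CY] A_gen[of CZ] by simp_all
  have Y: "lam 0 1 = l0" by (simp add: lam_def)
  have Z: "lam (expo (\<lambda>j. - int (m j))) r = of_nat r * l0 - (\<Sum>j\<in>UNIV. of_nat (m j) * l j)"
    by (simp add: lam_def sum_negf mult.commute)
  \<comment> \<open>The values of \<open>lam\<close> at the leading degrees of x_j, y and z are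
    natural multiples of \<open>- L\<close>. These multiples are the weights; that of z is r \<mu>0
    minus the sum of the m_j \<mu>_j.\<close>
  have "\<exists>i::nat. l j = - of_nat i * L" for j
    unfolding X[symmetric] by (rule star[OF AX[of j]]) (auto simp: kvar_def)
  then obtain \<mu> :: "'n \<Rightarrow> nat" where \<mu>: "\<And>j. l j = - of_nat (\<mu> j) * L" by metis
  have "\<exists>i::nat. l0 = - of_nat i * L"
    unfolding Y[symmetric] by (rule star[OF AY]) auto
  then obtain \<mu>0 :: nat where \<mu>0: "l0 = - of_nat \<mu>0 * L" ..
  have "\<exists>i::nat. of_nat r * l0 - (\<Sum>j\<in>UNIV. of_nat (m j) * l j) = - of_nat i * L"
    unfolding Z[symmetric] by (rule star[OF AZ]) (auto simp: kZ degree_dZ)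
  then obtain \<mu>z :: nat where \<mu>z: "of_nat r * l0 - (\<Sum>j\<in>UNIV. of_nat (m j) * l j) = - of_nat \<mu>z * L" ..
  have L: "L \<noteq> 0"
  proof
    assume "L = 0"
    then have "l j = 0" "l0 = 0" for j using \<mu> \<mu>0 by simp_all
    then show False using eK by (auto simp: K_def l_def l0_def in_keys_iff)
  qed
  have toint: "x = y" if "complex_of_int x * L = complex_of_int y * L" for x y
    using that L by simp
  \<comment> \<open>The derivation itself has weight -1, because \<open>L\<close> is the value of
    \<open>lam\<close> at its own degree \<open>(e, f)\<close>.\<close>
  have "complex_of_int ((\<Sum>j\<in>UNIV. int (\<mu> j) * ex e j) + int \<mu>0 * int f) * L = complex_of_int (- 1) * L"
  proof -
    have "L = (\<Sum>j\<in>UNIV. (- of_nat (\<mu> j) * L) * of_int (ex e j)) + (- of_nat \<mu>0 * L) * of_nat f"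
      using L_def unfolding lam_def \<mu> \<mu>0 .
    then show ?thesis
      by (simp add: sum_distrib_left sum_distrib_right sum_negf algebra_simps eq_neg_iff_add_eq_0)
  qed
  from toint[OF this] have S1: "(\<Sum>j\<in>UNIV. int (\<mu> j) * ex e j) + int \<mu>0 * int f = - 1" .
  have "complex_of_int (int r * int \<mu>0 - (\<Sum>j\<in>UNIV. int (m j) * int (\<mu> j))) * L = complex_of_int (int \<mu>z) * L"
    using \<mu>z unfolding \<mu> \<mu>0
    by (simp add: sum_distrib_left sum_distrib_right sum_negf algebra_simps)
  from toint[OF this] have S2: "int r * int \<mu>0 - (\<Sum>j\<in>UNIV. int (m j) * int (\<mu> j)) = int \<mu>z" .
  show False
  proof (rule no_homogeneous_lnd[of "\<lambda>j. int (\<mu> j)" "int \<mu>0" "\<lambda>j. int (m j)" "int r" "int f" "ex e"])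
    show "0 \<le> ex e j + int (m j) * ((int f + 1) div int r)" if "int \<mu>0 > 0" for j
    proof -
      have "lam 0 1 \<noteq> 0" using that L unfolding Y \<mu>0 by simp
      then have "0 \<le> int (m j) * int ((f + 1) div r) + ex e j + ex 0 j"
        by (intro bound[OF AY]) auto
      then show ?thesis by (simp add: zdiv_int add.commute)
    qed
    show "0 \<le> 1 + ex e j + int (m j) * (int f div int r)" if "int (\<mu> j) > 0" for j
    proof -
      have "lam (expo (\<lambda>i. if i = j then 1 else 0)) 0 \<noteq> 0" using that L unfolding X \<mu> by simp
      then have "0 \<le> int (m j) * int ((f + 0) div r) + ex e j + ex (expo (\<lambda>i. if i = j then 1 else 0)) j"
        by (intro bound[OF AX]) (auto simp: kvar_def)
      then show ?thesis by (simp add: zdiv_int)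
    qed
    show "0 \<le> - int (m j) + ex e j + int (m j) * ((int f + int r) div int r)"
      if "int r * int \<mu>0 - (\<Sum>j\<in>UNIV. int (m j) * int (\<mu> j)) > 0" for j
    proof -
      have "lam (expo (\<lambda>j. - int (m j))) r \<noteq> 0" using that L unfolding Z \<mu>z S2 by simp
      then have "0 \<le> int (m j) * int ((f + r) div r) + ex e j + ex (expo (\<lambda>j. - int (m j))) j"
        by (intro bound[OF AZ]) (auto simp: kZ degree_dZ)
      then show ?thesis by (simp add: zdiv_int)
    qed
  qed (use S1 S2 m r in auto)
qed

text \<open>Once the degree in \<open>y\<close> is known to drop, the \<open>x\<^sub>j\<close> are in the kernel, and regularity
  of the image of \<open>z\<close> forces the factor \<open>x\<^sup>m\<close>.\<close>

theorem lnd_characterization: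
  assumes DA: "\<And>h. h \<in> A \<Longrightarrow> D h \<in> A"
    and Dadd: "\<And>f g. f \<in> A \<Longrightarrow> g \<in> A \<Longrightarrow> D (f + g) = D f + D g"
    and Dmult: "\<And>f g. f \<in> A \<Longrightarrow> g \<in> A \<Longrightarrow> D (f * g) = D f * g + f * D g"
    and Dconst: "\<And>a. D [:kconst a:] = 0"
    and nil: "\<And>h. h \<in> A \<Longrightarrow> \<exists>k. (D ^^ k) h = 0"
    and m: "\<And>j. m j \<ge> 2"
  obtains b where "nonneg b" "\<And>h. h \<in> A \<Longrightarrow> D h = smult (b * xm) (pderiv h)"
proof -
  define inv where "inv j = [:xpow (\<lambda>i. if i = j then - 1 else 0):]" for j :: 'n
  have inv: "inv j * [:kvar j:] = 1" for j
  proof -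
    have "xpow (\<lambda>i. if i = j then - 1 else 0) * kvar j = xpow (\<lambda>i. 0)"
      unfolding kvar_def xpow_def[symmetric] xpow_mult by (rule arg_cong[where f = xpow]) auto
    then show ?thesis by (simp add: inv_def xpow_0 one_pCons mult.commute)
  qed
  define c where "c j = inv j * D [:kvar j:]" for j
  define d where "d = D [:0, 1:]"
  define G where "G h \<longleftrightarrow> h \<in> A \<and> D h = deriv c d h" for h
  have G_add: "G (f + g)" if "G f" "G g" for f g
    using that by (auto simp: G_def A_add Dadd deriv_add)
  have G_mult: "G (f * g)" if "G f" "G g" for f g
    using that by (auto simp: G_def A_mult Dmult deriv_mult)
  have G_const: "G [:kconst a:]" for a
    by (simp add: G_def A_const Dconst deriv_gens)
  have G_one: "G 1" using G_const[of 1] by (simp add: one_pCons)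
  have G_X: "G [:kvar j:]" for j
  proof -
    have "inv j * D [:kvar j:] * [:kvar j:] = (inv j * [:kvar j:]) * D [:kvar j:]"
      by (simp only: ac_simps)
    then show ?thesis using A_gen[of "CX j"] unfolding inv by (simp add: G_def deriv_gens(2) c_def)
  qed
  have G_Y: "G [:0, 1:]" using A_gen[of CY] by (simp add: G_def deriv_gens d_def)
  have G_kemb: "G [:kemb p:]" for p
  proof (induction p rule: cpoly_induct)
    case (add f g) then show ?case using G_add[OF add] by (simp add: homs[OF is_hom_kemb])
  next
    case (mult f g) then show ?case using G_mult[OF mult] by (simp add: homs[OF is_hom_kemb] ac_simps)
  qed (auto simp: G_const G_X)
  have G_lin: "G [: - kemb p, 1:]" for p
    using G_add[OF G_Y G_kemb[of "- p"]] by (simp add: homs[OF is_hom_kemb])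
  have "G (\<Prod>i\<in>I. [: - kemb (\<sigma> i), 1:])" for I
    by (induction I rule: infinite_finite_induct) (auto simp: G_one intro!: G_mult G_lin simp del: mult_pCons_left)
  then have G_P: "G dP" by (simp add: dP_def)
  have "nonneg xm" by (simp add: nonneg_xpow)
  then obtain p where p: "kemb p = xm" by (rule nonneg_imp_kemb)
  have G_xm: "G [:xm:]" using G_kemb[of p] p by simp
  \<comment> \<open>Agreement of \<open>D\<close> and \<open>deriv c d\<close> at z follows from
    agreement at x^m z = P(y), by cancelling x^m in the Laurent ring.\<close>
  have "dP = [:xm:] * dZ" using xm_dZ by simp
  then have "D ([:xm:] * dZ) = deriv c d ([:xm:] * dZ)" using G_P by (simp add: G_def)
  then have "[:xm:] * D dZ = [:xm:] * deriv c d dZ"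
    using G_xm A_gen[of CZ] unfolding deriv_mult
    by (subst (asm) Dmult) (simp_all add: G_def)
  then have "D dZ = deriv c d dZ" by (subst (asm) mult_left_cancel) simp_all
  then have G_Z: "G dZ" using A_gen[of CZ] by (simp add: G_def)
  have "G (theta p)" for p
  proof (induction p rule: cpoly_induct)
    case (var v) then show ?case by (cases v) (auto simp: G_X G_Y G_Z)
  qed (auto simp: theta_homs G_const G_add G_mult)
  then have D: "D h = deriv c d h" if "h \<in> A" for h using that by (auto simp: G_def)
  have Dk: "(deriv c d ^^ k) h = (D ^^ k) h \<and> (D ^^ k) h \<in> A" if "h \<in> A" for h k
    by (induction k) (use that D DA in auto)
  have "(\<forall>j. c j = 0) \<and> degree d = 0"
  proof (rule lnd_deriv)
    show "deriv c d h \<in> A" if "h \<in> A" for h using DA[OF that] D[OF that] by simp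
    show "\<exists>k. (deriv c d ^^ k) h = 0" if "h \<in> A" for h using nil[OF that] Dk[OF that] by metis
  qed (rule m)
  then have c0: "c j = 0" and d0: "degree d = 0" for j by auto
  have D': "D h = d * pderiv h" if "h \<in> A" for h
    using D[OF that] c0 by (simp add: deriv_def)
  obtain a where a: "d = [:a:]" using d0 by (rule degree_eq_zeroE)
  define b where "b = a * xi"
  have b: "a = b * xm" by (simp add: b_def mult.assoc xm_xi)
  have "nonneg b"
  proof (cases "a = 0")
    case False
    have AZ: "D dZ \<in> A" using DA A_gen[of CZ] by simp
    have DZ: "D dZ = smult a (pderiv dZ)" using D' A_gen[of CZ] a by simp
    have deg: "degree (D dZ) = r - 1" using False by (simp add: DZ degree_pderiv degree_dZ)
    \<comment> \<open>The image of z has degree r - 1 in y. This is below r, so its leading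
      coefficient r b can have no pole.\<close>
    have "coeff (D dZ) (r - 1) = of_nat r * b"
      using r lead_dZ by (simp add: DZ coeff_pderiv degree_dZ b_def algebra_simps Suc_diff_Suc)
    moreover have "D dZ \<noteq> 0" using False r degree_dZ by (auto simp: DZ pderiv_eq_0_iff)
    ultimately have "nonneg (of_nat r * b)" using A_lead[OF AZ] r unfolding deg by simp
    then have "nonneg (kconst (1 / of_nat r) * (of_nat r * b))"
      by (rule nonneg_mult[rotated]) (simp add: nonneg_single)
    moreover have "kconst (1 / of_nat r) * of_nat r = (1 :: 'n laurent)"
      using r by (simp add: mult_single flip: single_of_nat)
    then have "kconst (1 / of_nat r) * (of_nat r * b) = b"
      by (simp flip: mult.assoc)
    ultimately show ?thesis by simp
  qed (simp add: b_def)
  then show ?thesis using that D' a b by simp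
qed

end

section \<open>Regular functions\<close>

text \<open>For monic \<open>p\<close>, \<open>norm (poly p y)\<close> is the product of the
  distances from \<open>y\<close> to the roots, and the nearest root gives the bound. This is the
  continuity of roots that the density argument needs.\<close>

lemma root_near:
  fixes p :: "complex poly"
  assumes "lead_coeff p = 1" "degree p > 0"
  shows "\<exists>w. poly p w = 0 \<and> norm (y - w) ^ degree p \<le> norm (poly p y)"
  using assms
proof (induction "degree p" arbitrary: p)
  case (Suc n)
  have "\<not> constant (poly p)" using Suc by (simp add: constant_degree)
  then obtain \<rho> where \<rho>: "poly p \<rho> = 0" using fundamental_theorem_of_algebra by blast
  then obtain q where q: "p = [:- \<rho>, 1:] * q" by (metis dvdE poly_eq_0_iff_dvd)
  have q0: "q \<noteq> 0" using q Suc.prems by auto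
  have deg: "degree p = Suc (degree q)" and lead: "lead_coeff q = 1"
    using q q0 Suc.prems lead_coeff_mult[of "[:- \<rho>, 1:]" q] degree_mult_eq[of "[:- \<rho>, 1:]" q] by auto
  have norm: "norm (poly p y) = norm (y - \<rho>) * norm (poly q y)"
    by (simp add: q norm_mult algebra_simps flip: norm_mult)
  show ?case
  proof (cases "degree q = 0")
    case True
    then have "poly q y = 1" using lead by (auto elim: degree_eq_zeroE)
    then show ?thesis using \<rho> norm deg True by (intro exI[of _ \<rho>]) simp
  next
    case False
    then obtain w where w: "poly q w = 0" "norm (y - w) ^ degree q \<le> norm (poly q y)"
      using Suc.hyps(1)[of q] Suc.hyps(2) deg lead by auto
    show ?thesis
    proof (cases "norm (y - \<rho>) \<le> norm (y - w)")
      case True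
      then have "norm (y - \<rho>) ^ degree q \<le> norm (poly q y)"
        using w(2) by (meson norm_ge_zero order_trans power_mono)
      then show ?thesis using \<rho> norm deg by (intro exI[of _ \<rho>]) (simp add: mult_left_mono)
    next
      case False
      then show ?thesis using w norm deg q
        by (intro exI[of _ w]) (simp add: mult_mono)
    qed
  qed
qed simp

lemma tendsto_ceval:
  "(\<And>v. (\<lambda>n. a n v) \<longlonglongrightarrow> b v) \<Longrightarrow> (\<lambda>n. ceval p (a n)) \<longlonglongrightarrow> ceval p b"
  unfolding ceval_def by (intro tendsto_intros)

text \<open>Vanishing x_j are replaced by small nonzero numbers, z is kept, and y moves to a nearby
  root of the perturbed equation, which is monic in y. The value of that equation at the old y tends
  to 0, and \<open>root_near\<close> makes the roots converge to it.\<close>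

lemma danielewski_dense:
  fixes a :: "'n::finite coord \<Rightarrow> complex"
  assumes a: "a \<in> danielewski_variety m r \<sigma>" and r: "r > 0"
  obtains b where "\<And>n. b n \<in> danielewski_variety m r \<sigma>" "\<And>n j. b n (CX j) \<noteq> 0"
    "\<And>v. (\<lambda>n. b n v) \<longlonglongrightarrow> a v"
proof -
  define x where "x n j = (if a (CX j) = 0 then 1 / of_nat (Suc n) else a (CX j))" for n :: nat and j
  have x0: "x n j \<noteq> 0" for n j by (auto simp: x_def simp del: of_nat_Suc)
  have xl: "(\<lambda>n. x n j) \<longlonglongrightarrow> a (CX j)" for j
    using LIMSEQ_Suc[OF lim_1_over_n[where 'a = complex]]
    by (cases "a (CX j) = 0") (simp_all add: x_def)
  define Q where "Q n = (\<Prod>i=1..r. [: - ceval (\<sigma> i) (x n), 1:])" for n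
  define p where "p n = Q n + [:- ((\<Prod>j\<in>UNIV. x n j ^ m j) * a CZ):]" for n
  have Q: "degree (Q n) = r" "lead_coeff (Q n) = 1" for n
  proof -
    have "degree (Q n) = (\<Sum>i=1..r. degree [: - ceval (\<sigma> i) (x n), 1:])"
      unfolding Q_def by (rule degree_prod_eq_sum_degree) auto
    then show "degree (Q n) = r" by simp
    show "lead_coeff (Q n) = 1" unfolding Q_def by (simp add: lead_coeff_prod)
  qed
  have p: "degree (p n) = r" "lead_coeff (p n) = 1" for n
  proof -
    have "degree [:- ((\<Prod>j\<in>UNIV. x n j ^ m j) * a CZ):] < degree (Q n)" using Q r by simp
    then show d: "degree (p n) = r"
      unfolding p_def by (subst degree_add_eq_left) (simp_all add: Q)
    have "coeff [:- ((\<Prod>j\<in>UNIV. x n j ^ m j) * a CZ):] r = 0" using r by (cases r) auto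
    then have "coeff (p n) r = 1" using Q[of n] unfolding p_def by simp
    then show "lead_coeff (p n) = 1" using d by simp
  qed
  have "\<exists>w. poly (p n) w = 0 \<and> norm (a CY - w) ^ r \<le> norm (poly (p n) (a CY))" for n
    using root_near[of "p n" "a CY"] p[of n] r by simp
  then obtain w where w: "\<And>n. poly (p n) (w n) = 0" "\<And>n. norm (a CY - w n) ^ r \<le> norm (poly (p n) (a CY))"
    by metis
  have pv: "poly (p n) y = (\<Prod>i=1..r. y - ceval (\<sigma> i) (x n)) - (\<Prod>j\<in>UNIV. x n j ^ m j) * a CZ" for n y
    by (simp add: p_def Q_def poly_prod)
  have "(\<lambda>n. poly (p n) (a CY)) \<longlonglongrightarrow>
      (\<Prod>i=1..r. a CY - ceval (\<sigma> i) (\<lambda>j. a (CX j))) - (\<Prod>j\<in>UNIV. a (CX j) ^ m j) * a CZ"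
    unfolding pv by (intro tendsto_intros tendsto_ceval xl)
  also have "(\<Prod>i=1..r. a CY - ceval (\<sigma> i) (\<lambda>j. a (CX j))) - (\<Prod>j\<in>UNIV. a (CX j) ^ m j) * a CZ = 0"
    using a by (simp add: danielewski_variety_def)
  finally have lim: "(\<lambda>n. norm (poly (p n) (a CY))) \<longlonglongrightarrow> 0" by (simp add: tendsto_norm_zero)
  have "(\<lambda>n. norm (a CY - w n) ^ r) \<longlonglongrightarrow> 0"
    by (rule tendsto_sandwich[OF _ _ tendsto_const lim]) (auto simp: w)
  then have "(\<lambda>n. root r (norm (a CY - w n) ^ r)) \<longlonglongrightarrow> root r 0" by (rule tendsto_real_root)
  then have "(\<lambda>n. a CY - w n) \<longlonglongrightarrow> 0"
    using r by (simp add: real_root_power_cancel tendsto_norm_zero_iff)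
  then have wl: "w \<longlonglongrightarrow> a CY" using tendsto_diff[OF tendsto_const[of "a CY"]] by fastforce
  define b where "b n v = (case v of CX j \<Rightarrow> x n j | CY \<Rightarrow> w n | CZ \<Rightarrow> a CZ)" for n v
  show ?thesis
  proof (rule that[of b])
    show "b n \<in> danielewski_variety m r \<sigma>" for n
      using w(1)[of n] by (simp add: danielewski_variety_def b_def pv)
    show "b n (CX j) \<noteq> 0" for n j by (simp add: b_def x0)
    show "(\<lambda>n. b n v) \<longlonglongrightarrow> a v" for v
      by (cases v) (simp_all add: b_def xl wl)
  qed
qed

lemma is_hom_map_poly:
  assumes h: "is_hom h" shows "is_hom (map_poly h)"
  by (rule is_homI; rule poly_eqI)
    (auto simp: coeff_map_poly homs[OF h] coeff_mult coeff_1)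

lemma is_hom_poly: "is_hom (\<lambda>p. poly p y)"
  by (simp add: is_hom_def)

context danielewski
begin

abbreviation "V \<equiv> danielewski_variety m r \<sigma>"

definition "leval x y h = poly (map_poly (keval x) h) y"

lemma is_hom_leval: "(\<And>j. x j \<noteq> 0) \<Longrightarrow> is_hom (leval x y)"
  unfolding leval_def by (intro is_hom_comp[OF is_hom_poly] is_hom_map_poly is_hom_keval)

lemma leval_const: "(\<And>j. x j \<noteq> 0) \<Longrightarrow> leval x y [:c:] = keval x c"
  using hom_zero[OF is_hom_keval, of x] by (simp add: leval_def map_poly_pCons)

lemma leval_Y: "(\<And>j. x j \<noteq> 0) \<Longrightarrow> leval x y [:0, 1:] = y"
  using hom_zero[OF is_hom_keval, of x] hom_one[OF is_hom_keval, of x]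
  by (simp add: leval_def map_poly_pCons)

lemma keval_xm: "keval x xm = (\<Prod>j\<in>UNIV. x j ^ m j)"
  by (simp add: xpow_def keval_single tchar_def)

lemma leval_dP:
  assumes x: "\<And>j. x j \<noteq> 0"
  shows "leval x y dP = (\<Prod>i=1..r. y - ceval (\<sigma> i) x)"
proof -
  have "leval x y [: - kemb (\<sigma> i), 1:] = y - ceval (\<sigma> i) x" for i
  proof -
    have "[: - kemb (\<sigma> i), 1:] = [:0, 1:] - [:kemb (\<sigma> i):]" by simp
    then show ?thesis
      by (simp only: hom_diff[OF is_hom_leval[OF x]] leval_const[OF x] leval_Y[OF x] keval_kemb[OF x])
  qed
  then show ?thesis unfolding dP_def by (simp add: hom_prod[OF is_hom_leval[OF x]])
qed

lemma leval_theta: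
  assumes a: "a \<in> V" and x: "\<And>j. a (CX j) \<noteq> 0"
  shows "leval (\<lambda>j. a (CX j)) (a CY) (theta p) = ceval p a"
proof (rule hom_cpoly_eqI[where f = "\<lambda>p. leval (\<lambda>j. a (CX j)) (a CY) (theta p)"])
  note L = is_hom_leval[OF x]
  show "is_hom (\<lambda>p. leval (\<lambda>j. a (CX j)) (a CY) (theta p))"
    by (rule is_hom_comp[OF L is_hom_theta])
  show "leval (\<lambda>j. a (CX j)) (a CY) (theta (cconst c)) = ceval (cconst c) a" for c
    by (simp add: leval_const[OF x] keval_kconst)
  show "leval (\<lambda>j. a (CX j)) (a CY) (theta (cvar v)) = ceval (cvar v) a" for v
  proof (cases v)
    case (CX j) then show ?thesis by (simp add: leval_const[OF x] keval_kvar)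
  next
    case CY then show ?thesis by (simp add: leval_Y[OF x])
  next
    case CZ
    have P: "[:xm:] * dZ = dP" using xm_dZ by simp
    have "keval (\<lambda>j. a (CX j)) xm * leval (\<lambda>j. a (CX j)) (a CY) dZ = leval (\<lambda>j. a (CX j)) (a CY) dP"
      unfolding P[symmetric] by (simp only: hom_mult[OF L] leval_const[OF x])
    also have "\<dots> = keval (\<lambda>j. a (CX j)) xm * a CZ"
      using a by (simp add: leval_dP[OF x] keval_xm danielewski_variety_def)
    finally show ?thesis using x CZ by (simp add: keval_xm)
  qed
qed (rule is_hom_ceval)

lemma ceval_eq_on_V:
  assumes "\<And>a. a \<in> V \<Longrightarrow> (\<And>j. a (CX j) \<noteq> 0) \<Longrightarrow> ceval p a = ceval q a" and a: "a \<in> V"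
  shows "ceval p a = ceval q a"
proof -
  obtain b where b: "\<And>n. b n \<in> V" "\<And>n j. b n (CX j) \<noteq> 0" "\<And>v. (\<lambda>n. b n v) \<longlonglongrightarrow> a v"
    using danielewski_dense[OF a] r by auto
  have "(\<lambda>n. ceval p (b n)) = (\<lambda>n. ceval q (b n))" using assms b by auto
  moreover have l: "(\<lambda>n. ceval s (b n)) \<longlonglongrightarrow> ceval s a" for s by (rule tendsto_ceval) (rule b)
  ultimately show ?thesis using LIMSEQ_unique[OF l[of p]] l[of q] by simp
qed

text \<open>Makes \<open>A\<close> a faithful copy of the ring of regular functions. From left to
  right, \<open>theta\<close> determines the values on the open part, which is dense. From right to
  left, every (x, y) with all x_j nonzero comes from a point of the variety, so
  \<open>keval_faithful\<close> kills all coefficients of the difference.\<close>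

lemma theta_eq_iff: "theta p = theta q \<longleftrightarrow> (\<forall>a\<in>V. ceval p a = ceval q a)"
proof
  assume eq: "theta p = theta q"
  have "ceval p a = ceval q a" if "a \<in> V" "\<And>j. a (CX j) \<noteq> 0" for a
    using leval_theta[OF that, of p] leval_theta[OF that, of q] unfolding eq by (rule trans[OF sym])
  then show "\<forall>a\<in>V. ceval p a = ceval q a" using ceval_eq_on_V by blast
next
  assume eq: "\<forall>a\<in>V. ceval p a = ceval q a"
  define h where "h = theta p - theta q"
  have z: "leval x y h = 0" if x: "\<And>j. x j \<noteq> 0" for x y
  proof -
    define a where "a v = (case v of CX j \<Rightarrow> x j | CY \<Rightarrow> y
      | CZ \<Rightarrow> (\<Prod>i=1..r. y - ceval (\<sigma> i) x) / (\<Prod>j\<in>UNIV. x j ^ m j))" for v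
    have a: "a \<in> V" "\<And>j. a (CX j) \<noteq> 0"
      using x by (simp_all add: danielewski_variety_def a_def)
    have "leval x y h = leval x y (theta p) - leval x y (theta q)"
      unfolding h_def by (rule hom_diff[OF is_hom_leval[OF x]])
    moreover have "(\<lambda>j. a (CX j)) = x" "a CY = y" by (simp_all add: a_def)
    then have "leval x y (theta s) = ceval s a" for s using leval_theta[OF a, of s] by simp
    moreover have "ceval p a = ceval q a" using eq a(1) by blast
    ultimately show ?thesis by simp
  qed
  have "keval x (coeff h n) = 0" if x: "\<And>j. x j \<noteq> 0" for x n
  proof -
    have "poly (map_poly (keval x) h) = poly 0" using z[OF x] by (auto simp: leval_def)
    then have "map_poly (keval x) h = 0" by (simp only: poly_eq_poly_eq_iff)
    then have "coeff (map_poly (keval x) h) n = 0" by simp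
    moreover have "keval x 0 = 0" by (rule hom_zero[OF is_hom_keval]) (rule x)
    ultimately show ?thesis by (simp add: coeff_map_poly)
  qed
  then have "coeff h n = 0" for n by (rule keval_faithful) blast
  then have "h = 0" by (intro poly_eqI) simp
  then show "theta p = theta q" by (simp add: h_def)
qed

lemma A_coeffs: "(\<And>k. nonneg (coeff h k)) \<Longrightarrow> h \<in> A"
proof -
  assume h: "\<And>k. nonneg (coeff h k)"
  have "[:coeff h k:] * [:0, 1:] ^ k \<in> A" for k
    using A_gen[of CY] h by (intro A_mult A_power A_nonneg) auto
  then have S: "(\<Sum>k\<in>K. [:coeff h k:] * [:0, 1:] ^ k) \<in> A" for K
    by (induction K rule: infinite_finite_induct) (auto intro!: A_add A_nonneg[of 0, simplified])
  have "(\<Sum>k\<le>degree h. [:coeff h k:] * [:0, 1:] ^ k) = h"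
    using poly_as_sum_of_monoms[of h] by (simp add: monom_altdef)
  then show ?thesis using S[of "{..degree h}"] by (simp only:)
qed

text \<open>The standard locally nilpotent derivation: it kills the x_j and sends y to x^m and z to
  P'(y), hence preserves \<open>A\<close>.\<close>

definition "del h = smult xm (pderiv h)"

lemma del_add: "del (f + g) = del f + del g"
  and del_mult: "del (f * g) = del f * g + f * del g"
  by (simp_all add: del_def pderiv_add pderiv_mult smult_add_right algebra_simps)

lemma del_const [simp]: "del [:c:] = 0"
  by (simp add: del_def pderiv_pCons)

lemma del_Y: "del [:0, 1:] = [:xm:]"
  by (simp add: del_def pderiv_pCons)

lemma A_del: "h \<in> A \<Longrightarrow> del h \<in> A"
proof -
  have "del (theta p) \<in> A" for p
  proof (induction p rule: cpoly_induct)
    case (const c) then show ?case using A_const[of 0] by simp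
  next
    case (add f g) then show ?case by (simp add: theta_homs del_add A_add)
  next
    case (mult f g) then show ?case by (simp add: theta_homs del_mult A_add A_mult)
  next
    case (var v)
    show ?case
    proof (cases v)
      case (CX j) then show ?thesis using A_const[of 0] by simp
    next
      case CY then show ?thesis by (auto simp: del_Y nonneg_xpow intro!: A_nonneg)
    next
      case CZ
      have "nonneg (coeff (pderiv dP) k)" for k
      proof -
        have "nonneg (of_nat (Suc k) :: 'n laurent)"
          by (simp only: nonneg_single ex_zero flip: single_of_nat) simp
        then show ?thesis unfolding coeff_pderiv by (intro nonneg_mult nonneg_coeff_dP)
      qed
      then have "pderiv dP \<in> A" by (rule A_coeffs)
      moreover have "del dZ = pderiv dP"
        unfolding del_def pderiv_smult[symmetric] xm_dZ ..
      ultimately show ?thesis using CZ by simp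
    qed
  qed
  then show "h \<in> A \<Longrightarrow> del h \<in> A" by auto
qed

lemma del_nilpotent: "degree h < k \<Longrightarrow> (del ^^ k) h = 0"
proof (induction k arbitrary: h)
  case (Suc k)
  have del0: "(del ^^ i) 0 = 0" for i
    by (induction i) (simp_all add: del_def)
  show ?case
  proof (cases "degree h = 0")
    case True
    then have "del h = 0" by (auto elim!: degree_eq_zeroE)
    then show ?thesis by (simp add: funpow_swap1 del0)
  next
    case False
    then have "degree (del h) < k" using Suc.prems by (simp add: del_def degree_pderiv)
    then show ?thesis using Suc.IH[of "del h"] by (simp add: funpow_swap1)
  qed
qed simp

end

section \<open>Isomorphisms\<close>

text \<open>In the product of \<open>F\<close> and \<open>E\<close> nonnegative terms cannot cancel.
  Some \<open>j\<close> has \<open>F i j * E j i\<close> nonzero, and the zeros off the diagonal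
  make row \<open>j\<close> of \<open>E\<close> a unit vector. So \<open>E\<close> is a permutation
  matrix, and \<open>m\<close> is \<open>m'\<close> with its indices relabelled.\<close>

lemma monomial_permutation:
  fixes E F :: "'n::finite \<Rightarrow> 'n \<Rightarrow> int" and m m' :: "'n \<Rightarrow> int"
  assumes E: "\<And>j k. E j k \<ge> 0" and F: "\<And>i j. F i j \<ge> 0"
    and FE: "\<And>i k. (\<Sum>j\<in>UNIV. F i j * E j k) = (if i = k then 1 else 0)"
    and m: "\<And>i. (\<Sum>j\<in>UNIV. m' j * E j i) = m i"
  shows "range m = range m'"
proof -
  have "\<exists>j. E j = (\<lambda>k. if k = i then 1 else 0)" for i
  proof -
    have "\<exists>j. F i j * E j i \<noteq> 0"
    proof (rule ccontr)
      assume "\<not> ?thesis"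
      then have "(\<Sum>j\<in>UNIV. F i j * E j i) = 0" by (intro sum.neutral) auto
      then show False using FE[of i i] by simp
    qed
    then obtain j where j: "F i j * E j i \<noteq> 0" by blast
    have z: "E j k = 0" if "k \<noteq> i" for k
    proof -
      have "(\<Sum>j\<in>UNIV. F i j * E j k) = 0" using FE[of i k] that by simp
      then have "F i j * E j k = 0" using E F by (simp add: sum_nonneg_eq_0_iff)
      then show ?thesis using j by auto
    qed
    have "F i j * E j i \<le> (\<Sum>j\<in>UNIV. F i j * E j i)"
      using E F by (intro member_le_sum) auto
    then have "F i j * E j i \<le> 1" using FE[of i i] by simp
    moreover have "F i j \<ge> 1" "E j i \<ge> 1"
      using j E[of j i] F[of i j] by (auto simp: order_less_le)
    moreover have "1 * E j i \<le> F i j * E j i"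
      using \<open>F i j \<ge> 1\<close> E by (intro mult_right_mono)
    ultimately have "E j i = 1" by linarith
    then show ?thesis using z by (intro exI[of _ j]) auto
  qed
  then obtain \<tau> where \<tau>: "\<And>i. E (\<tau> i) = (\<lambda>k. if k = i then 1 else 0)" by metis
  have "inj \<tau>"
  proof (rule injI)
    fix i i' assume "\<tau> i = \<tau> i'"
    then have "E (\<tau> i) i = E (\<tau> i') i" by simp
    then show "i = i'" by (simp add: \<tau> split: if_splits)
  qed
  then have bij: "bij \<tau>" by (simp add: bij_def finite_UNIV_inj_surj)
  have "m i = m' (\<tau> i)" for i
  proof -
    have "m i = (\<Sum>j\<in>UNIV. m' (\<tau> j) * E (\<tau> j) i)"
      unfolding m[symmetric] using bij by (subst sum.reindex_bij_betw) auto
    also have "\<dots> = (\<Sum>j\<in>UNIV. if i = j then m' (\<tau> i) else 0)"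
      by (intro sum.cong) (auto simp: \<tau>)
    finally show ?thesis by simp
  qed
  then have "m = m' \<circ> \<tau>" by auto
  then show ?thesis using bij by (metis bij_is_surj image_comp)
qed

locale danielewski_iso = X: danielewski m r \<sigma> + Y: danielewski m' r \<sigma>
  for m m' :: "'n::finite \<Rightarrow> nat" and r \<sigma> +
  fixes F G :: "'n coord \<Rightarrow> 'n coord cpoly"
  assumes F: "\<And>a. a \<in> X.V \<Longrightarrow> (\<lambda>v. ceval (F v) a) \<in> Y.V"
    and G: "\<And>b. b \<in> Y.V \<Longrightarrow> (\<lambda>v. ceval (G v) b) \<in> X.V"
    and GF: "\<And>a. a \<in> X.V \<Longrightarrow> (\<lambda>v. ceval (G v) (\<lambda>w. ceval (F w) a)) = a"
    and FG: "\<And>b. b \<in> Y.V \<Longrightarrow> (\<lambda>v. ceval (F v) (\<lambda>w. ceval (G w) b)) = b"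
    and m2: "\<And>j. m j \<ge> 2" and m2': "\<And>j. m' j \<ge> 2"
begin

text \<open>Pullback of regular functions along \<open>F\<close>, expressed on the copies
  \<open>Y.A\<close> and \<open>X.A\<close>. \<open>SOME\<close> picks a representing polynomial;
  \<open>\<Phi>_theta\<close> shows that the choice does not matter.\<close>

definition "\<Phi> h = X.theta (csubst F (SOME p. Y.theta p = h))"
definition "\<Psi> h = Y.theta (csubst G (SOME p. X.theta p = h))"

lemma \<Phi>_theta: "\<Phi> (Y.theta p) = X.theta (csubst F p)"
proof -
  define q where "q = (SOME q. Y.theta q = Y.theta p)"
  have "Y.theta q = Y.theta p" unfolding q_def by (rule someI[of _ p]) simp
  then have "\<forall>b\<in>Y.V. ceval q b = ceval p b" by (simp add: Y.theta_eq_iff)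
  then have "X.theta (csubst F q) = X.theta (csubst F p)"
    unfolding X.theta_eq_iff ceval_csubst using F by blast
  then show ?thesis by (simp add: \<Phi>_def q_def)
qed

lemma \<Psi>_theta: "\<Psi> (X.theta p) = Y.theta (csubst G p)"
proof -
  define q where "q = (SOME q. X.theta q = X.theta p)"
  have "X.theta q = X.theta p" unfolding q_def by (rule someI[of _ p]) simp
  then have "\<forall>b\<in>X.V. ceval q b = ceval p b" by (simp add: X.theta_eq_iff)
  then have "Y.theta (csubst G q) = Y.theta (csubst G p)"
    unfolding Y.theta_eq_iff ceval_csubst using G by blast
  then show ?thesis by (simp add: \<Psi>_def q_def)
qed

lemma swap: "danielewski_iso m' m r \<sigma> G F"
  by unfold_locales (fact F G GF FG m2 m2')+

lemma \<Phi>_A: "h \<in> Y.A \<Longrightarrow> \<Phi> h \<in> X.A" and \<Psi>_A: "h \<in> X.A \<Longrightarrow> \<Psi> h \<in> Y.A"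
  by (auto simp: \<Phi>_theta \<Psi>_theta)

lemma \<Phi>_\<Psi>: "h \<in> X.A \<Longrightarrow> \<Phi> (\<Psi> h) = h"
  by (auto simp: \<Phi>_theta \<Psi>_theta X.theta_eq_iff ceval_csubst GF)

lemma \<Psi>_\<Phi>: "h \<in> Y.A \<Longrightarrow> \<Psi> (\<Phi> h) = h"
  by (auto simp: \<Phi>_theta \<Psi>_theta Y.theta_eq_iff ceval_csubst FG)

lemma \<Phi>_add: "f \<in> Y.A \<Longrightarrow> g \<in> Y.A \<Longrightarrow> \<Phi> (f + g) = \<Phi> f + \<Phi> g"
  by (auto simp: \<Phi>_theta hom_add[OF is_hom_csubst] hom_add[OF X.is_hom_theta] simp flip: hom_add[OF Y.is_hom_theta])

lemma \<Phi>_mult: "f \<in> Y.A \<Longrightarrow> g \<in> Y.A \<Longrightarrow> \<Phi> (f * g) = \<Phi> f * \<Phi> g"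
  by (auto simp: \<Phi>_theta hom_mult[OF is_hom_csubst] hom_mult[OF X.is_hom_theta] simp flip: hom_mult[OF Y.is_hom_theta])

lemma \<Psi>_add: "f \<in> X.A \<Longrightarrow> g \<in> X.A \<Longrightarrow> \<Psi> (f + g) = \<Psi> f + \<Psi> g"
  by (auto simp: \<Psi>_theta hom_add[OF is_hom_csubst] hom_add[OF Y.is_hom_theta] simp flip: hom_add[OF X.is_hom_theta])

lemma \<Psi>_mult: "f \<in> X.A \<Longrightarrow> g \<in> X.A \<Longrightarrow> \<Psi> (f * g) = \<Psi> f * \<Psi> g"
  by (auto simp: \<Psi>_theta hom_mult[OF is_hom_csubst] hom_mult[OF Y.is_hom_theta] simp flip: hom_mult[OF X.is_hom_theta])

lemma \<Phi>_const: "\<Phi> [:kconst c:] = [:kconst c:]"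
  using \<Phi>_theta[of "cconst c"] by simp

lemma \<Psi>_const: "\<Psi> [:kconst c:] = [:kconst c:]"
  using \<Psi>_theta[of "cconst c"] by simp

lemma \<Phi>_0: "\<Phi> 0 = 0"
  using \<Phi>_const[of 0] by simp

lemma \<Phi>_1: "\<Phi> 1 = 1"
  using \<Phi>_const[of 1] by (simp add: one_pCons)

lemma \<Phi>_power: "f \<in> Y.A \<Longrightarrow> \<Phi> (f ^ k) = \<Phi> f ^ k"
  by (induction k) (auto simp: \<Phi>_1 \<Phi>_mult Y.A_power)

lemma \<Phi>_prod: "(\<And>i. i \<in> I \<Longrightarrow> f i \<in> Y.A) \<Longrightarrow> \<Phi> (prod f I) = (\<Prod>i\<in>I. \<Phi> (f i))"
  by (induction I rule: infinite_finite_induct) (auto simp: \<Phi>_1 \<Phi>_mult Y.A_prod)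

lemma prod_const_poly: "(\<Prod>i\<in>I. [:f i:]) = [:\<Prod>i\<in>I. f i:]"
  by (induction I rule: infinite_finite_induct) (auto simp: one_pCons mult.commute)

text \<open>Conjugating \<open>Y.del\<close> by the isomorphism gives a locally nilpotent derivation
  of \<open>X.A\<close>, to which \<open>X.lnd_characterization\<close> applies. It is nonzero
  because \<open>Y.del\<close> sends y to x^m'.\<close>

lemma transported:
  obtains b where "nonneg b" "b \<noteq> 0"
    "\<And>h. h \<in> Y.A \<Longrightarrow> \<Phi> (Y.del h) = smult (b * X.xm) (pderiv (\<Phi> h))"
proof -
  define D where "D h = \<Phi> (Y.del (\<Psi> h))" for h
  have iter: "(D ^^ k) h = \<Phi> ((Y.del ^^ k) (\<Psi> h)) \<and> (Y.del ^^ k) (\<Psi> h) \<in> Y.A" if "h \<in> X.A" for h k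
    by (induction k) (use that in \<open>auto simp: D_def \<Phi>_\<Psi> \<Psi>_\<Phi> \<Psi>_A Y.A_del\<close>)
  obtain b where b: "nonneg b" "\<And>h. h \<in> X.A \<Longrightarrow> D h = smult (b * X.xm) (pderiv h)"
  proof (rule X.lnd_characterization[of D])
    show "D h \<in> X.A" if "h \<in> X.A" for h
      unfolding D_def by (intro \<Phi>_A Y.A_del \<Psi>_A that)
    show "D (f + g) = D f + D g" if "f \<in> X.A" "g \<in> X.A" for f g
      unfolding D_def using that by (simp add: \<Psi>_add Y.del_add \<Phi>_add Y.A_del \<Psi>_A)
    show "D (f * g) = D f * g + f * D g" if "f \<in> X.A" "g \<in> X.A" for f g
      unfolding D_def using that
      by (simp add: \<Psi>_mult Y.del_mult \<Phi>_add \<Phi>_mult Y.A_mult Y.A_del \<Psi>_A \<Phi>_\<Psi>)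
    show "D [:kconst a:] = 0" for a
      by (simp add: D_def \<Psi>_const \<Phi>_0)
    show "\<exists>k. (D ^^ k) h = 0" if "h \<in> X.A" for h
      using iter[OF that, of "Suc (degree (\<Psi> h))"] Y.del_nilpotent[of "\<Psi> h" "Suc (degree (\<Psi> h))"] \<Phi>_0
      by (metis lessI)
  qed (use m2 in auto)
  have D: "\<Phi> (Y.del h) = smult (b * X.xm) (pderiv (\<Phi> h))" if "h \<in> Y.A" for h
    using b(2)[OF \<Phi>_A[OF that]] by (simp add: D_def \<Psi>_\<Phi> that)
  have "b \<noteq> 0"
  proof
    assume "b = 0"
    then have "\<Phi> (Y.del [:0, 1:]) = 0" using D[OF Y.A_gen[of CY]] by simp
    then have "\<Psi> (\<Phi> (Y.del [:0, 1:])) = \<Psi> [:kconst 0:]" by simp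
    then have "Y.del [:0, 1:] = 0"
      unfolding \<Psi>_const using Y.A_del[OF Y.A_gen[of CY]] by (simp add: \<Psi>_\<Phi>)
    then show False by (simp add: Y.del_Y)
  qed
  then show ?thesis using that b(1) D by blast
qed

text \<open>Polynomials in x are killed by \<open>Y.del\<close>, so their images have y-derivative
  0; and a regular function of degree 0 in y is a polynomial in x.\<close>

lemma \<Phi>_nonneg:
  assumes "nonneg v" obtains w where "nonneg w" "\<Phi> [:v:] = [:w:]"
proof -
  obtain b where b: "b \<noteq> 0" "\<And>h. h \<in> Y.A \<Longrightarrow> \<Phi> (Y.del h) = smult (b * X.xm) (pderiv (\<Phi> h))"
    using transported by metis
  have v: "[:v:] \<in> Y.A" using Y.A_nonneg[OF assms] .
  have "pderiv (\<Phi> [:v:]) = 0" using b(2)[OF v] b(1) by (simp add: \<Phi>_0)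
  then show ?thesis
    using X.A_degree_0[OF \<Phi>_A[OF v]] that by (auto simp: pderiv_eq_0_iff)
qed

text \<open>By transport, the image of x^m' is b x^m times the y-derivative of the image of y. It
  has degree 0 in y, so the image of y has degree 1. The leading coefficient \<open>c\<close> of
  that image has no pole because 1 < r, and \<open>u\<close> is \<open>b * c\<close>.\<close>

lemma \<Phi>_vars:
  obtains \<phi> u where "\<And>j. nonneg (\<phi> j)" "\<And>j. \<Phi> [:kvar j:] = [:\<phi> j:]" "nonneg u"
    "(\<Prod>j\<in>UNIV. \<phi> j ^ m' j) = u * X.xm" "\<Phi> [:Y.xm:] = [:u * X.xm:]"
proof -
  obtain b where b: "nonneg b" "b \<noteq> 0" "\<And>h. h \<in> Y.A \<Longrightarrow> \<Phi> (Y.del h) = smult (b * X.xm) (pderiv (\<Phi> h))"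
    by (rule transported) blast
  have nk: "nonneg (kvar j)" for j :: 'n using nonneg_kemb[of "cvar j"] by simp
  have "\<exists>w. nonneg w \<and> \<Phi> [:kvar j:] = [:w:]" for j using \<Phi>_nonneg[OF nk] by metis
  then obtain \<phi> where \<phi>: "\<And>j. nonneg (\<phi> j)" "\<And>j. \<Phi> [:kvar j:] = [:\<phi> j:]" by metis
  have kA: "[:kvar j:] \<in> Y.A" for j by (rule Y.A_nonneg[OF nk])
  have xmk: "[:Y.xm:] = (\<Prod>j\<in>UNIV. [:kvar j:] ^ m' j)"
    by (simp add: prod_const_poly poly_const_pow xmon_conv_kvar xpow_def)
  have "\<Phi> [:Y.xm:] = (\<Prod>j\<in>UNIV. \<Phi> [:kvar j:] ^ m' j)"
    unfolding xmk by (subst \<Phi>_prod) (auto intro!: Y.A_power kA simp: \<Phi>_power[OF kA])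
  then have xm: "\<Phi> [:Y.xm:] = [:\<Prod>j\<in>UNIV. \<phi> j ^ m' j:]"
    by (simp add: \<phi> prod_const_poly poly_const_pow)
  define y where "y = \<Phi> [:0, 1:]"
  have yA: "y \<in> X.A" unfolding y_def using \<Phi>_A[OF Y.A_gen[of CY]] by simp
  have eq: "\<Phi> [:Y.xm:] = smult (b * X.xm) (pderiv y)"
    using b(3)[OF Y.A_gen[of CY]] by (simp add: Y.del_Y y_def)
  have "[:Y.xm:] \<in> Y.A" by (intro Y.A_nonneg) (simp add: nonneg_xpow)
  then have "\<Phi> [:Y.xm:] \<noteq> 0" using \<Psi>_\<Phi>[of "[:Y.xm:]"] \<Psi>_const[of 0] by auto
  then have p0: "pderiv y \<noteq> 0" using eq by auto
  have "degree (pderiv y) = 0"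
    using arg_cong[OF eq, of degree] b(2) xm by simp
  then have dy: "degree y = 1" using p0 pderiv_eq_0_iff[of y] by (simp add: degree_pderiv)
  define c where "c = lead_coeff y"
  have "nonneg c" using X.A_lead[OF yA] dy X.r unfolding c_def by fastforce
  have "pderiv y = [:c:]"
  proof -
    obtain c' where c': "pderiv y = [:c':]" using \<open>degree (pderiv y) = 0\<close> by (rule degree_eq_zeroE)
    then have "c' = coeff (pderiv y) 0" by simp
    also have "\<dots> = c" unfolding coeff_pderiv using dy by (simp add: c_def)
    finally show ?thesis using c' by simp
  qed
  then have *: "\<Phi> [:Y.xm:] = [:(b * c) * X.xm:]" using eq by (simp add: ac_simps)
  show ?thesis
  proof (rule that[OF \<phi>, of "b * c"])
    show "nonneg (b * c)" using b(1) \<open>nonneg c\<close> by (rule nonneg_mult)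
    show "(\<Prod>j\<in>UNIV. \<phi> j ^ m' j) = b * c * X.xm" using * xm by simp
    show "\<Phi> [:Y.xm:] = [:b * c * X.xm:]" by (rule *)
  qed
qed

text \<open>Applying \<open>\<Phi>_vars\<close> in both directions shows that \<open>x\<^sup>m\<close> corresponds to \<open>x\<^sup>m\<^sup>'\<close> up to a scalar;
  hence each variable is mapped to a divisor of a monomial, that is, to a monomial.\<close>

lemma same_exponents: "range m = range m'"
proof -
  obtain \<phi> u where \<phi>: "\<And>j. nonneg (\<phi> j)" "\<And>j. \<Phi> [:kvar j:] = [:\<phi> j:]" "nonneg u"
    and xm: "(\<Prod>j\<in>UNIV. \<phi> j ^ m' j) = u * X.xm" "\<Phi> [:Y.xm:] = [:u * X.xm:]"
    by (rule \<Phi>_vars) blast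
  interpret S: danielewski_iso m' m r \<sigma> G F by (rule swap)
  have S: "S.\<Phi> = \<Psi>" "S.\<Psi> = \<Phi>" by (auto simp: S.\<Phi>_def S.\<Psi>_def \<Phi>_def \<Psi>_def)
  obtain \<psi> v where \<psi>: "\<And>j. nonneg (\<psi> j)" "\<And>j. \<Psi> [:kvar j:] = [:\<psi> j:]" "nonneg v"
    and xm': "(\<Prod>j\<in>UNIV. \<psi> j ^ m j) = v * Y.xm" "\<Psi> [:X.xm:] = [:v * Y.xm:]"
    using S.\<Phi>_vars unfolding S by blast
  have nk: "nonneg (kvar j)" for j :: 'n using nonneg_kemb[of "cvar j"] by simp
  have kA: "[:kvar j:] \<in> Y.A" for j by (rule Y.A_nonneg[OF nk])
  \<comment> \<open>Going there and back, x^m equals \<open>\<Phi> [:v:]\<close> times u x^m. Hence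
    \<open>u\<close> is a unit.\<close>
  have "\<exists>w. nonneg w \<and> u * w = 1"
  proof -
    obtain w where w: "nonneg w" "\<Phi> [:v:] = [:w:]" by (rule \<Phi>_nonneg[OF \<psi>(3)])
    have "[:X.xm:] = \<Phi> (\<Psi> [:X.xm:])"
      by (intro \<Phi>_\<Psi>[symmetric] X.A_nonneg) (simp add: nonneg_xpow)
    also have "\<dots> = \<Phi> ([:v:] * [:Y.xm:])" by (simp add: xm' mult.commute)
    also have "\<dots> = [:w:] * [:u * X.xm:]"
      by (subst \<Phi>_mult) (auto intro!: Y.A_nonneg \<psi> simp: nonneg_xpow w xm)
    finally have "1 * X.xm = (u * w) * X.xm" by (simp add: ac_simps)
    then have "u * w = 1" by (subst (asm) mult_right_cancel) simp_all
    then show ?thesis using w by blast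
  qed
  then obtain w where w: "nonneg w" "u * w = 1" by blast
  \<comment> \<open>A unit of the Laurent ring is a single term. Neither \<open>u\<close> nor its
    inverse has negative exponents, so this term is a constant.\<close>
  obtain c0 where u: "u = kconst c0" "c0 \<noteq> 0"
  proof -
    have uw: "u * w = single 0 1" "w * u = single 0 1" using w by (simp_all add: mult.commute)
    obtain a c where a: "u = single a c" "c \<noteq> 0" by (rule factor_of_single[OF uw(1)]) auto
    obtain b d where b: "w = single b d" "d \<noteq> 0" by (rule factor_of_single[OF uw(2)]) auto
    have "single (a + b) (c * d) = single 0 1" using uw(1) by (simp add: a b mult_single)
    then have "lookup (single (a + b) (c * d)) 0 = 1" by simp
    then have ab: "a + b = 0" by (simp add: lookup_single when_def split: if_splits)
    have "ex a j = 0" for j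
    proof -
      have "ex a j + ex b j = 0" using arg_cong[OF ab, of "\<lambda>e. ex e j"] by simp
      moreover have "0 \<le> ex a j" "0 \<le> ex b j"
        using \<phi>(3) w(1) a b by (auto simp: nonneg_single)
      ultimately show ?thesis by linarith
    qed
    then have "a = 0" by (intro ex_eqI) simp
    then show ?thesis using that a by blast
  qed
  have monomial: "\<exists>e d. f j = single e d \<and> d \<noteq> 0" if "(\<Prod>j\<in>UNIV. f j ^ k j) * g = single a 1" "k j \<ge> 2"
    for f :: "'n \<Rightarrow> 'n laurent" and g a j and k :: "'n \<Rightarrow> nat"
  proof -
    have "f j dvd f j ^ k j" using that(2) by (intro dvd_power) simp
    also have "\<dots> dvd (\<Prod>j\<in>UNIV. f j ^ k j)" by (rule dvd_prodI) auto
    also have "\<dots> dvd (\<Prod>j\<in>UNIV. f j ^ k j) * g" by simp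
    finally have "f j dvd single a 1" unfolding that(1) .
    then obtain h where "single a 1 = f j * h" by (rule dvdE)
    then have fh: "f j * h = single a 1" by simp
    obtain b d where "f j = single b d" "d \<noteq> 0" by (rule factor_of_single[OF fh]) auto
    then show ?thesis by blast
  qed
  have phi_unit: "(\<Prod>j\<in>UNIV. \<phi> j ^ m' j) * w = single (expo (\<lambda>j. int (m j))) 1"
  proof -
    have "u * X.xm * w = (u * w) * X.xm" by (simp only: ac_simps)
    then show ?thesis unfolding xm(1) w(2) by (simp add: xpow_def)
  qed
  have "\<exists>e d. \<phi> j = single e d \<and> d \<noteq> 0" for j
    by (rule monomial[OF phi_unit m2'])
  then obtain E d where E: "\<And>j. \<phi> j = single (E j) (d j)" "\<And>j. d j \<noteq> 0" by metis
  obtain w' where w': "v * w' = 1"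
  proof -
    obtain x where x: "\<Psi> [:u:] = [:x:]" using S.\<Phi>_nonneg[OF \<phi>(3)] unfolding S by metis
    have "[:Y.xm:] = \<Psi> (\<Phi> [:Y.xm:])"
      by (intro \<Psi>_\<Phi>[symmetric] Y.A_nonneg) (simp add: nonneg_xpow)
    also have "\<dots> = \<Psi> ([:u:] * [:X.xm:])" by (simp add: xm mult.commute)
    also have "\<dots> = [:x:] * [:v * Y.xm:]"
      by (subst \<Psi>_mult) (auto intro!: X.A_nonneg \<phi> simp: nonneg_xpow x xm')
    finally have "1 * Y.xm = (v * x) * Y.xm" by (simp add: ac_simps)
    then have "v * x = 1" by (subst (asm) mult_right_cancel) simp_all
    then show ?thesis by (rule that)
  qed
  have psi_unit: "(\<Prod>j\<in>UNIV. \<psi> j ^ m j) * w' = single (expo (\<lambda>j. int (m' j))) 1"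
  proof -
    have "v * Y.xm * w' = (v * w') * Y.xm" by (simp only: ac_simps)
    then show ?thesis unfolding xm'(1) w' by (simp add: xpow_def)
  qed
  have "\<exists>e d. \<psi> j = single e d \<and> d \<noteq> 0" for j
    by (rule monomial[OF psi_unit m2])
  then obtain F' d' where F': "\<And>j. \<psi> j = single (F' j) (d' j)" "\<And>j. d' j \<noteq> 0" by metis
  have E_nonneg: "ex (E j) k \<ge> 0" for j k using \<phi>(1)[of j] E by (simp add: nonneg_single)
  have F_nonneg: "ex (F' j) k \<ge> 0" for j k using \<psi>(1)[of j] F' by (simp add: nonneg_single)
  have prodE: "(\<Prod>j\<in>UNIV. \<phi> j ^ k j) = single (\<Sum>j\<in>UNIV. \<Sum>i<k j. E j) (\<Prod>j\<in>UNIV. d j ^ k j)" for k :: "'n \<Rightarrow> nat"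
  proof -
    have p: "single a c ^ n = single (\<Sum>i<n. a) (c ^ n)" for a :: "'n expo" and c :: complex and n
      by (induction n) (auto simp: mult_single add.commute)
    have "(\<Prod>j\<in>I. single (e j) (c j)) = single (sum e I) (prod c I)" if "finite I"
      for I and e :: "'n \<Rightarrow> 'n expo" and c :: "'n \<Rightarrow> complex"
      using that by (induction I rule: finite_induct) (auto simp: mult_single)
    then show ?thesis by (simp add: E p)
  qed
  have single_eqD: "a = b" if "single a c = single b e" "c \<noteq> 0" for a b :: "'n expo" and c e :: complex
    using that by (metis keys_single single_zero singleton_insert_inj_eq' single_eq_0_iff)
  have "range (\<lambda>j. int (m j)) = range (\<lambda>j. int (m' j))"
  proof (rule monomial_permutation[of "\<lambda>j. ex (E j)" "\<lambda>i. ex (F' i)"])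
    show "(\<Sum>j\<in>UNIV. int (m' j) * ex (E j) i) = int (m i)" for i
    proof -
      have "single (\<Sum>j\<in>UNIV. \<Sum>i<m' j. E j) (\<Prod>j\<in>UNIV. d j ^ m' j) = single (expo (\<lambda>j. int (m j))) c0"
        using xm(1) unfolding prodE u xpow_def by (simp add: mult_single)
      then have "(\<Sum>j\<in>UNIV. \<Sum>i<m' j. E j) = expo (\<lambda>j. int (m j))"
        by (rule single_eqD) (simp add: E)
      from arg_cong[OF this, of "\<lambda>e. ex e i"] show ?thesis by simp
    qed
    \<comment> \<open>On exponents, the fact that \<open>\<Phi>\<close> after \<open>\<Psi>\<close>
      fixes x_i says that the two exponent matrices multiply to the identity.\<close>
    show "(\<Sum>j\<in>UNIV. ex (F' i) j * ex (E j) k) = (if i = k then 1 else 0)" for i k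
    proof -
      have "[:\<psi> i:] = [:kconst (d' i):] * (\<Prod>j\<in>UNIV. [:kvar j:] ^ nat (ex (F' i) j))"
      proof -
        have "expo (\<lambda>j. int (nat (ex (F' i) j))) = F' i" using F_nonneg by (intro ex_eqI) simp
        then show ?thesis
          by (simp add: poly_const_pow prod_const_poly xmon_conv_kvar F' mult_single)
      qed
      then have "[:kvar i:] = \<Phi> ([:kconst (d' i):] * (\<Prod>j\<in>UNIV. [:kvar j:] ^ nat (ex (F' i) j)))"
        using \<Phi>_\<Psi>[OF X.A_nonneg[OF nk], of i] \<psi>(2)[of i] by simp
      also have "\<dots> = [:kconst (d' i):] * (\<Prod>j\<in>UNIV. \<Phi> [:kvar j:] ^ nat (ex (F' i) j))"
        by (subst \<Phi>_mult, rule Y.A_const, intro Y.A_prod Y.A_power kA, subst \<Phi>_prod)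
          (auto intro!: Y.A_power kA simp: \<Phi>_power[OF kA] \<Phi>_const)
      finally have "kvar i = kconst (d' i) * (\<Prod>j\<in>UNIV. \<phi> j ^ nat (ex (F' i) j))"
        by (simp add: \<phi> poly_const_pow prod_const_poly)
      then have "expo (\<lambda>k. if k = i then 1 else 0) = (\<Sum>j\<in>UNIV. \<Sum>l<nat (ex (F' i) j). E j)"
        unfolding prodE kvar_def mult_single by (intro single_eqD[where c = 1]) simp_all
      from arg_cong[OF this, of "\<lambda>e. ex e k"]
      have "(if k = i then 1 else 0) = (\<Sum>j\<in>UNIV. ex (F' i) j * ex (E j) k)" using F_nonneg by simp
      then show ?thesis by (auto split: if_splits)
    qed
  qed (rule E_nonneg F_nonneg)+
  then have "nat ` range (\<lambda>j. int (m j)) = nat ` range (\<lambda>j. int (m' j))" by simp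
  then show ?thesis by (simp add: image_image)
qed

end

theorem isomorphic_imp_same_exponents:
  fixes \<sigma> :: "nat \<Rightarrow> 'n::finite cpoly"
  assumes "r \<ge> 2" and m: "\<And>j. m j \<ge> 2" "\<And>j. m' j \<ge> 2"
    and iso: "isomorphic_varieties (danielewski_variety m r \<sigma>) (danielewski_variety m' r \<sigma>)"
  shows "range m = range m'"
proof -
  obtain f g where f: "regular_map (danielewski_variety m r \<sigma>) (danielewski_variety m' r \<sigma>) f"
    and g: "regular_map (danielewski_variety m' r \<sigma>) (danielewski_variety m r \<sigma>) g"
    and gf: "\<And>a. a \<in> danielewski_variety m r \<sigma> \<Longrightarrow> g (f a) = a"
    and fg: "\<And>b. b \<in> danielewski_variety m' r \<sigma> \<Longrightarrow> f (g b) = b"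
    using iso unfolding isomorphic_varieties_def by blast
  obtain F where F: "\<And>a w. a \<in> danielewski_variety m r \<sigma> \<Longrightarrow> f a w = ceval (F w) a"
    using f unfolding regular_map_def by metis
  obtain G where G: "\<And>a w. a \<in> danielewski_variety m' r \<sigma> \<Longrightarrow> g a w = ceval (G w) a"
    using g unfolding regular_map_def by metis
  have F': "(\<lambda>w. ceval (F w) a) = f a" if "a \<in> danielewski_variety m r \<sigma>" for a
    using F[OF that] by auto
  have G': "(\<lambda>w. ceval (G w) a) = g a" if "a \<in> danielewski_variety m' r \<sigma>" for a
    using G[OF that] by auto
  have fV: "f a \<in> danielewski_variety m' r \<sigma>" if "a \<in> danielewski_variety m r \<sigma>" for a
    using f that unfolding regular_map_def by blast
  have gV: "g a \<in> danielewski_variety m r \<sigma>" if "a \<in> danielewski_variety m' r \<sigma>" for a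
    using g that unfolding regular_map_def by blast
  interpret danielewski_iso m m' r \<sigma> F G
    by unfold_locales (simp_all add: assms F' G' fV gV fg gf)
  show ?thesis by (rule same_exponents)
qed

section \<open>Stable isomorphism\<close>

text \<open>For a new linear factor l, the derivative of l p is p + l p', which is p modulo l and l
  p' modulo p; it is therefore prime to both. The resulting \<open>Q\<close> inverts the derivative
  modulo the polynomial.\<close>

lemma bezout_distinct_roots:
  fixes c :: "'i \<Rightarrow> complex"
  assumes "finite I" "inj_on c I"
  obtains Q R where "Q * pderiv (\<Prod>i\<in>I. [:- c i, 1:]) + R * (\<Prod>i\<in>I. [:- c i, 1:]) = 1"
proof -
  have lin: "coprime [:- a, 1:] [:- b, 1:]" if "a \<noteq> b" for a b :: complex
  proof (rule coprimeI)
    fix g assume "g dvd [:- a, 1:]" "g dvd [:- b, 1:]"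
    then have "g dvd [:- a, 1:] - [:- b, 1:]" by (rule dvd_diff)
    then have "g dvd [:b - a:]" by simp
    moreover have "is_unit [:b - a:]" using that by (simp add: is_unit_pCons_iff)
    ultimately show "is_unit g" by (rule dvd_trans)
  qed
  have "coprime (pderiv (\<Prod>i\<in>I. [:- c i, 1:])) (\<Prod>i\<in>I. [:- c i, 1:])"
    using assms
  proof (induction I rule: finite_induct)
    case (insert k I)
    let ?p = "\<Prod>i\<in>I. [:- c i, 1:]" and ?l = "[:- c k, 1:]"
    have "c k \<noteq> c i" if "i \<in> I" for i
      using insert.prems insert.hyps(2) that unfolding inj_on_def by blast
    then have lp: "coprime ?l ?p"
      by (intro prod_coprime_right lin)
    have IH: "coprime (pderiv ?p) ?p" using insert by (intro insert.IH) auto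
    have pd: "pderiv (?l * ?p) = ?p + ?l * pderiv ?p"
      unfolding pderiv_mult by (simp add: pderiv_pCons add.commute)
    have "coprime (?p + ?l * pderiv ?p) ?l"
    proof (rule coprimeI)
      fix g assume "g dvd ?p + ?l * pderiv ?p" "g dvd ?l"
      then have "g dvd ?p" by (metis dvd_add_left_iff dvd_mult2)
      then show "is_unit g" using \<open>g dvd ?l\<close> lp coprime_common_divisor by blast
    qed
    moreover have "coprime (?p + ?l * pderiv ?p) ?p"
    proof (rule coprimeI)
      fix g assume g: "g dvd ?p + ?l * pderiv ?p" "g dvd ?p"
      then have "g dvd ?l * pderiv ?p" by (metis dvd_add_right_iff)
      moreover have "coprime (?l * pderiv ?p) ?p" by (simp only: coprime_mult_left_iff lp IH simp_thms)
      ultimately show "is_unit g" using g(2) coprime_common_divisor by blast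
    qed
    ultimately have "coprime (pderiv (?l * ?p)) (?l * ?p)"
      unfolding pd by (simp only: coprime_mult_right_iff simp_thms)
    then show ?case using insert.hyps by (simp del: mult_pCons_left)
  qed simp
  then have "gcd (pderiv (\<Prod>i\<in>I. [:- c i, 1:])) (\<Prod>i\<in>I. [:- c i, 1:]) = 1"
    by simp
  then show ?thesis
    using bezout_coefficients_fst_snd[of "pderiv (\<Prod>i\<in>I. [:- c i, 1:])" "\<Prod>i\<in>I. [:- c i, 1:]"] that
    by metis
qed

section \<open>Congruences between regular functions and Newton's method\<close>

definition reg :: "('v::finite \<Rightarrow> complex) set \<Rightarrow> (('v \<Rightarrow> complex) \<Rightarrow> complex) \<Rightarrow> bool" where
  "reg V f \<longleftrightarrow> (\<exists>p. \<forall>a\<in>V. f a = ceval p a)"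

lemma reg_const [simp, intro]: "reg V (\<lambda>_. c)"
  unfolding reg_def by (intro exI[of _ "cconst c"]) simp

lemma reg_coord: "reg V (\<lambda>a. a v)"
  unfolding reg_def by (intro exI[of _ "cvar v"]) simp

lemma reg_add [intro]: "reg V f \<Longrightarrow> reg V g \<Longrightarrow> reg V (\<lambda>a. f a + g a)"
  unfolding reg_def by (metis ceval_homs(2))

lemma reg_mult [intro]: "reg V f \<Longrightarrow> reg V g \<Longrightarrow> reg V (\<lambda>a. f a * g a)"
  unfolding reg_def by (metis ceval_homs(3))

lemma reg_minus [intro]: "reg V f \<Longrightarrow> reg V (\<lambda>a. - f a)"
  unfolding reg_def by (metis ceval_homs(5))

lemma reg_diff [intro]: "reg V f \<Longrightarrow> reg V g \<Longrightarrow> reg V (\<lambda>a. f a - g a)"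
  unfolding reg_def by (metis ceval_homs(6))

lemma reg_power [intro]: "reg V f \<Longrightarrow> reg V (\<lambda>a. f a ^ n)"
  by (induction n) auto

lemma reg_prod [intro]: "(\<And>i. i \<in> I \<Longrightarrow> reg V (f i)) \<Longrightarrow> reg V (\<lambda>a. \<Prod>i\<in>I. f i a)"
  by (induction I rule: infinite_finite_induct) auto

lemma reg_poly [intro]: "reg V f \<Longrightarrow> reg V (\<lambda>a. poly p (f a))"
  by (induction p) auto

lemma reg_ceval:
  assumes "\<And>v. reg V (\<lambda>a. f a v)"
  shows "reg V (\<lambda>a. ceval p (f a))"
proof -
  obtain F where F: "\<And>v a. a \<in> V \<Longrightarrow> f a v = ceval (F v) a"
    using assms unfolding reg_def by metis
  have "ceval p (f a) = ceval (csubst F p) a" if "a \<in> V" for a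
  proof -
    have "f a = (\<lambda>v. ceval (F v) a)" using F[OF that] by auto
    then show ?thesis by (simp add: ceval_csubst)
  qed
  then show ?thesis unfolding reg_def by blast
qed

text \<open>Congruence modulo the ideal generated by \<open>q\<close> in the ring of regular
  functions. The quotient has to be regular also where \<open>q\<close> vanishes.\<close>

definition cg :: "('v::finite \<Rightarrow> complex) set \<Rightarrow> (('v \<Rightarrow> complex) \<Rightarrow> complex) \<Rightarrow>
    (('v \<Rightarrow> complex) \<Rightarrow> complex) \<Rightarrow> (('v \<Rightarrow> complex) \<Rightarrow> complex) \<Rightarrow> bool" where
  "cg V q f g \<longleftrightarrow> (\<exists>h. reg V h \<and> (\<forall>a\<in>V. f a - g a = q a * h a))"

lemma cgI: "reg V h \<Longrightarrow> (\<And>a. a \<in> V \<Longrightarrow> f a - g a = q a * h a) \<Longrightarrow> cg V q f g"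
  unfolding cg_def by blast

lemma cgE:
  assumes "cg V q f g"
  obtains h where "reg V h" "\<And>a. a \<in> V \<Longrightarrow> f a - g a = q a * h a"
  using assms unfolding cg_def by blast

lemma cg_refl: "cg V q f f"
  by (rule cgI[where h = "\<lambda>_. 0"]) auto

lemma cg_weaken:
  assumes "cg V q f g" "reg V k" "\<And>a. a \<in> V \<Longrightarrow> q a = q' a * k a"
  shows "cg V q' f g"
  using assms(1) by (rule cgE) (rule cgI[OF reg_mult[OF assms(2)]], auto simp: assms(3) mult.assoc)

lemma poly_taylor2:
  assumes "reg V f" "reg V d"
  shows "\<exists>t. reg V t \<and> (\<forall>a. poly p (f a + d a) = poly p (f a) + d a * poly (pderiv p) (f a) + d a ^ 2 * t a)"
proof (induction p)
  case 0
  show ?case by (intro exI[of _ "\<lambda>_. 0"]) simp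
next
  case (pCons c p)
  then obtain t where t: "reg V t"
    "\<And>a. poly p (f a + d a) = poly p (f a) + d a * poly (pderiv p) (f a) + d a ^ 2 * t a" by blast
  have "reg V (\<lambda>a. poly (pderiv p) (f a) + (f a + d a) * t a)"
    by (intro reg_add reg_mult reg_poly assms t)
  then show ?case
    by (intro exI[of _ "\<lambda>a. poly (pderiv p) (f a) + (f a + d a) * t a"] conjI allI)
      (assumption, unfold poly_pCons pderiv_pCons poly_add t(2), simp add: algebra_simps power2_eq_square)
qed

lemma poly_lipschitz:
  assumes "reg V f" "reg V d"
  shows "\<exists>t. reg V t \<and> (\<forall>a. poly p (f a + d a) = poly p (f a) + d a * t a)"
proof -
  obtain t where t: "reg V t"
    "\<And>a. poly p (f a + d a) = poly p (f a) + d a * poly (pderiv p) (f a) + d a ^ 2 * t a"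
    using poly_taylor2[OF assms] by blast
  have "reg V (\<lambda>a. poly (pderiv p) (f a) + d a * t a)"
    by (intro reg_add reg_mult reg_poly assms t)
  then show ?thesis
    by (intro exI[of _ "\<lambda>a. poly (pderiv p) (f a) + d a * t a"] conjI allI)
      (simp_all add: t(2) distrib_left power2_eq_square mult.assoc)
qed

text \<open>The roots \<open>s i\<close> vary with the point, but modulo \<open>q\<close> they are
  the constants \<open>c i\<close>. Thus one Bezout identity over the complex numbers serves all
  points.\<close>

locale newton =
  fixes V :: "('v::finite \<Rightarrow> complex) set" and q :: "('v \<Rightarrow> complex) \<Rightarrow> complex"
    and r :: nat and s :: "nat \<Rightarrow> ('v \<Rightarrow> complex) \<Rightarrow> complex" and c :: "nat \<Rightarrow> complex"
    and Q R :: "complex poly"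
  assumes q: "reg V q"
    and s: "\<And>i. i \<in> {1..r} \<Longrightarrow> reg V (s i)" "\<And>i. i \<in> {1..r} \<Longrightarrow> cg V q (s i) (\<lambda>_. c i)"
    and QR: "Q * pderiv (\<Prod>i=1..r. [:- c i, 1:]) + R * (\<Prod>i=1..r. [:- c i, 1:]) = 1"
begin

text \<open>\<open>T\<close> agrees modulo \<open>q\<close> with the polynomial \<open>p\<close> with constant coefficients, and so do their
  difference quotients.\<close>

definition "rel T p \<longleftrightarrow> (\<forall>f. reg V f \<longrightarrow> reg V (\<lambda>a. T a (f a)) \<and> cg V q (\<lambda>a. T a (f a)) (\<lambda>a. poly p (f a)) \<and>
  (\<forall>d. reg V d \<longrightarrow> (\<exists>h. reg V h \<and> (\<forall>a\<in>V. T a (f a + d a) - T a (f a)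
      = poly p (f a + d a) - poly p (f a) + q a * d a * h a))))"

lemma relD:
  assumes "rel T p" "reg V f"
  shows "reg V (\<lambda>a. T a (f a))" "cg V q (\<lambda>a. T a (f a)) (\<lambda>a. poly p (f a))"
    "reg V d \<Longrightarrow> \<exists>h. reg V h \<and> (\<forall>a\<in>V. T a (f a + d a) - T a (f a)
      = poly p (f a + d a) - poly p (f a) + q a * d a * h a)"
  using assms(1)[unfolded rel_def, rule_format, OF assms(2)] by simp_all

lemma rel_poly: "rel (\<lambda>a. poly p) p"
  unfolding rel_def by (auto intro!: cg_refl exI[of _ "\<lambda>_. 0"])

lemma rel_linear:
  assumes "i \<in> {1..r}" shows "rel (\<lambda>a y. y - s i a) [:- c i, 1:]"
proof -
  obtain h where h: "reg V h" "\<And>a. a \<in> V \<Longrightarrow> s i a - c i = q a * h a"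
    using s(2)[OF assms] by (rule cgE) blast
  have "cg V q (\<lambda>a. f a - s i a) (\<lambda>a. poly [:- c i, 1:] (f a))" for f
    by (rule cgI[of V "\<lambda>a. - h a"]) (use h in \<open>auto simp flip: h(2)\<close>)
  then show ?thesis
    unfolding rel_def using s(1)[OF assms] by (auto intro!: exI[of _ "\<lambda>_. 0"])
qed

text \<open>A difference of products is (B - A) B' + A (B' - A'). The increments are multiples of
  \<open>d\<close>, by \<open>poly_lipschitz\<close>, so replacing the other factors by their values
  modulo \<open>q\<close> costs only multiples of q d.\<close>

lemma rel_mult:
  assumes T: "rel T p" and T': "rel T' p'"
  shows "rel (\<lambda>a y. T a y * T' a y) (p * p')"
  unfolding rel_def
proof (intro allI impI conjI)
  fix f assume f: "reg V f"
  have T1: "reg V (\<lambda>a. T a (f a))" and T1': "reg V (\<lambda>a. T' a (f a))"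
    by (rule relD[OF T f] relD[OF T' f])+
  then show "reg V (\<lambda>a. T a (f a) * T' a (f a))" by (rule reg_mult)
  obtain e where e: "reg V e" "\<And>a. a \<in> V \<Longrightarrow> T a (f a) - poly p (f a) = q a * e a"
    by (rule cgE[OF relD(2)[OF T f]]) blast
  obtain e' where e': "reg V e'" "\<And>a. a \<in> V \<Longrightarrow> T' a (f a) - poly p' (f a) = q a * e' a"
    by (rule cgE[OF relD(2)[OF T' f]]) blast
  have E: "T a (f a) = poly p (f a) + q a * e a" "T' a (f a) = poly p' (f a) + q a * e' a" if "a \<in> V" for a
    using e(2)[OF that] e'(2)[OF that] by (simp_all add: algebra_simps)
  show "cg V q (\<lambda>a. T a (f a) * T' a (f a)) (\<lambda>a. poly (p * p') (f a))"
  proof (rule cgI)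
    show "reg V (\<lambda>a. e a * T' a (f a) + poly p (f a) * e' a)"
      by (intro reg_add reg_mult reg_poly e e' T1' f)
  qed (simp add: E algebra_simps)
  fix d assume d: "reg V d"
  have fd: "reg V (\<lambda>a. f a + d a)" using f d by (rule reg_add)
  then have T2': "reg V (\<lambda>a. T' a (f a + d a))"
    by (rule relD(1)[OF T'])
  obtain e2 where e2: "reg V e2" "\<And>a. a \<in> V \<Longrightarrow> T' a (f a + d a) - poly p' (f a + d a) = q a * e2 a"
    by (rule cgE[OF relD(2)[OF T' fd]]) blast
  obtain h where h: "reg V h" "\<And>a. a \<in> V \<Longrightarrow> T a (f a + d a) - T a (f a)
      = poly p (f a + d a) - poly p (f a) + q a * d a * h a"
    using relD(3)[OF T f d] by blast
  obtain h' where h': "reg V h'" "\<And>a. a \<in> V \<Longrightarrow> T' a (f a + d a) - T' a (f a)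
      = poly p' (f a + d a) - poly p' (f a) + q a * d a * h' a"
    using relD(3)[OF T' f d] by blast
  obtain k where k: "reg V k" "\<And>a. poly p (f a + d a) = poly p (f a) + d a * k a"
    using poly_lipschitz[OF f d] by blast
  obtain k' where k': "reg V k'" "\<And>a. poly p' (f a + d a) = poly p' (f a) + d a * k' a"
    using poly_lipschitz[OF f d] by blast
  have "T a (f a + d a) * T' a (f a + d a) - T a (f a) * T' a (f a)
      = poly (p * p') (f a + d a) - poly (p * p') (f a)
        + q a * d a * (k a * e2 a + h a * T' a (f a + d a) + e a * k' a + T a (f a) * h' a)"
    if a: "a \<in> V" for a
  proof -
    define A A' B B' where "A = T a (f a)" and "A' = T' a (f a)" and "B = T a (f a + d a)" and "B' = T' a (f a + d a)"
    have 1: "B - A = d a * k a + q a * d a * h a" using h(2)[OF a] k(2)[of a] by (simp add: A_def B_def)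
    have 2: "B' - A' = d a * k' a + q a * d a * h' a" using h'(2)[OF a] k'(2)[of a] by (simp add: A'_def B'_def)
    have 3: "B' = poly p' (f a) + d a * k' a + q a * e2 a" using e2(2)[OF a] k'(2)[of a] by (simp add: B'_def algebra_simps)
    have 4: "A = poly p (f a) + q a * e a" using E[OF a] by (simp add: A_def)
    have "B * B' - A * A' = (B - A) * B' + A * (B' - A')" by (simp add: algebra_simps)
    also have "\<dots> = d a * k a * B' + q a * d a * h a * B' + A * (d a * k' a) + A * (q a * d a * h' a)"
      unfolding 1 2 by (simp add: algebra_simps)
    also have "d a * k a * B' = d a * k a * (poly p' (f a) + d a * k' a) + q a * d a * (k a * e2 a)"
      unfolding 3 by (simp add: algebra_simps)
    also have "A * (d a * k' a) = poly p (f a) * (d a * k' a) + q a * d a * (e a * k' a)"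
      unfolding 4 by (simp add: algebra_simps)
    finally show ?thesis
      unfolding A_def A'_def B_def B'_def poly_mult k(2) k'(2) by (simp add: algebra_simps)
  qed
  then show "\<exists>h. reg V h \<and> (\<forall>a\<in>V. T a (f a + d a) * T' a (f a + d a) - T a (f a) * T' a (f a)
      = poly (p * p') (f a + d a) - poly (p * p') (f a) + q a * d a * h a)"
    by (intro exI[of _ "\<lambda>a. k a * e2 a + h a * T' a (f a + d a) + e a * k' a + T a (f a) * h' a"]
        conjI ballI reg_add reg_mult k(1) e2(1) h(1) T2' e(1) k'(1) T1 h'(1)) simp
qed

definition "p0 = (\<Prod>i=1..r. [:- c i, 1:])"
definition "pp a y = (\<Prod>i=1..r. y - s i a)"
text \<open>One step of Newton's method for a root of \<open>pp a\<close>, with \<open>Q\<close> instead of the inverse of the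
  derivative.\<close>

definition "nw a y = y - pp a y * poly Q y"

lemma rel_pp: "rel pp p0"
proof -
  have "rel (\<lambda>a y. \<Prod>i\<in>I. y - s i a) (\<Prod>i\<in>I. [:- c i, 1:])" if "finite I" "I \<subseteq> {1..r}" for I
    using that
  proof (induction I rule: finite_induct)
    case empty
    then show ?case using rel_poly[of 1] by (simp add: poly_1[abs_def])
  next
    case (insert i I)
    then show ?case using rel_mult[OF rel_linear[of i], of _ "\<Prod>i\<in>I. [:- c i, 1:]"]
      by (simp del: mult_pCons_left)
  qed
  then show ?thesis unfolding pp_def[abs_def] p0_def by simp
qed

lemma reg_pp: "reg V f \<Longrightarrow> reg V (\<lambda>a. pp a (f a))"
  by (rule relD(1)[OF rel_pp])

lemma reg_nw: "reg V f \<Longrightarrow> reg V (\<lambda>a. nw a (f a))"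
  unfolding nw_def by (intro reg_diff reg_mult reg_pp reg_poly)

lemma pp_lipschitz:
  assumes "reg V f" "reg V d"
  shows "\<exists>t. reg V t \<and> (\<forall>a\<in>V. pp a (f a + d a) = pp a (f a) + d a * t a)"
proof -
  obtain h where h: "reg V h" "\<And>a. a \<in> V \<Longrightarrow> pp a (f a + d a) - pp a (f a)
      = poly p0 (f a + d a) - poly p0 (f a) + q a * d a * h a"
    using relD(3)[OF rel_pp assms] by blast
  obtain k where k: "reg V k" "\<And>a. poly p0 (f a + d a) = poly p0 (f a) + d a * k a"
    using poly_lipschitz[OF assms] by blast
  have "pp a (f a + d a) = pp a (f a) + d a * (k a + q a * h a)" if "a \<in> V" for a
    using h(2)[OF that] k(2)[of a] by (simp add: algebra_simps)
  then show ?thesis using h k q by (intro exI[of _ "\<lambda>a. k a + q a * h a"]) auto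
qed

lemma pp_p0:
  assumes "reg V f"
  obtains e where "reg V e" "\<And>a. a \<in> V \<Longrightarrow> poly p0 (f a) = pp a (f a) - q a * e a"
proof -
  obtain e where "reg V e" "\<And>a. a \<in> V \<Longrightarrow> pp a (f a) - poly p0 (f a) = q a * e a"
    by (rule cgE[OF relD(2)[OF rel_pp assms]]) blast
  then show ?thesis by (intro that[of e]) (auto simp: algebra_simps)
qed

text \<open>The point is that the derivative of
  \<open>p0 * Q\<close> is congruent to 1 modulo \<open>p0\<close>.\<close>

lemma nw_contract:
  assumes f: "reg V f" and Pf: "cg V q (\<lambda>a. pp a (f a)) (\<lambda>_. 0)"
    and g: "cg V (\<lambda>a. q a ^ Suc k) g f"
  shows "cg V (\<lambda>a. q a ^ Suc (Suc k)) (\<lambda>a. nw a (g a)) (\<lambda>a. nw a (f a))"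
proof -
  obtain w where w: "reg V w" "\<And>a. a \<in> V \<Longrightarrow> g a - f a = q a ^ Suc k * w a" using g by (rule cgE) blast
  define d where "d a = q a ^ Suc k * w a" for a
  have d: "reg V d" unfolding d_def by (intro reg_mult reg_power q w)
  have gd: "g a = f a + d a" if "a \<in> V" for a using w(2)[OF that] by (simp add: d_def algebra_simps)
  have PQ: "rel (\<lambda>a y. pp a y * poly Q y) (p0 * Q)" by (rule rel_mult[OF rel_pp rel_poly])
  obtain h where h: "reg V h" "\<And>a. a \<in> V \<Longrightarrow> pp a (f a + d a) * poly Q (f a + d a) - pp a (f a) * poly Q (f a)
      = poly (p0 * Q) (f a + d a) - poly (p0 * Q) (f a) + q a * d a * h a"
    using relD(3)[OF PQ f d] by blast
  obtain t where t: "reg V t" "\<And>a. poly (p0 * Q) (f a + d a)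
      = poly (p0 * Q) (f a) + d a * poly (pderiv (p0 * Q)) (f a) + d a ^ 2 * t a"
    using poly_taylor2[OF f d] by blast
  obtain e where e: "reg V e" "\<And>a. a \<in> V \<Longrightarrow> poly p0 (f a) = pp a (f a) - q a * e a"
    using pp_p0[OF f] by blast
  obtain e' where e': "reg V e'" "\<And>a. a \<in> V \<Longrightarrow> pp a (f a) - 0 = q a * e' a" using Pf by (rule cgE) blast
  define U where "U = pderiv Q - R"
  have pd: "pderiv (p0 * Q) = 1 + p0 * U"
  proof -
    have "Q * pderiv p0 + R * p0 = 1" using QR by (simp only: p0_def)
    then have "Q * pderiv p0 = 1 - R * p0" by (simp add: eq_diff_eq)
    then show ?thesis by (simp add: pderiv_mult U_def algebra_simps)
  qed
  have "nw a (g a) - nw a (f a)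
      = q a ^ Suc (Suc k) * (- (w a * ((e' a - e a) * poly U (f a) + q a ^ k * w a * t a + h a)))"
    if a: "a \<in> V" for a
  proof -
    have "poly p0 (f a) = q a * (e' a - e a)" using e(2)[OF a] e'(2)[OF a] by (simp add: algebra_simps)
    then have *: "poly (pderiv (p0 * Q)) (f a) = 1 + q a * (e' a - e a) * poly U (f a)" by (simp add: pd)
    have "nw a (g a) - nw a (f a) = d a - (pp a (f a + d a) * poly Q (f a + d a) - pp a (f a) * poly Q (f a))"
      by (simp add: nw_def gd[OF a])
    \<comment> \<open>The linear terms cancel. What remains has, besides \<open>d\<close>, a further
      factor \<open>q\<close> or a second factor \<open>d\<close>, which is itself divisible by
      \<open>q\<close>.\<close>
    also have "\<dots> = - d a * (q a * ((e' a - e a) * poly U (f a)) + d a * t a + q a * h a)"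
      unfolding h(2)[OF a] t(2) * by (simp add: algebra_simps power2_eq_square)
    also have "\<dots> = q a ^ Suc (Suc k) * (- (w a * ((e' a - e a) * poly U (f a) + q a ^ k * w a * t a + h a)))"
      by (simp add: d_def algebra_simps)
    finally show ?thesis .
  qed
  moreover have "reg V (\<lambda>a. - (w a * ((e' a - e a) * poly U (f a) + q a ^ k * w a * t a + h a)))"
    by (intro reg_minus reg_mult reg_add reg_diff reg_poly reg_power w t h e e' f q)
  ultimately show ?thesis by (intro cgI)
qed


text \<open>A Newton step moves \<open>f\<close> by a multiple of \<open>pp a (f a)\<close>. In
  \<open>stable_coordinates\<close> this gives divisibility by x^m for differences that need not be
  divisible by a high power of \<open>q\<close>.\<close>

lemma nw_ideal:
  assumes f: "reg V f"
  shows "\<exists>t u. reg V t \<and> reg V u \<and> (\<forall>a\<in>V. nw a (f a) - f a = pp a (f a) * t a \<and>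
    pp a (nw a (f a)) = pp a (f a) * u a)"
proof -
  define d where "d a = - (pp a (f a) * poly Q (f a))" for a
  have d: "reg V d" unfolding d_def by (intro reg_minus reg_mult reg_pp reg_poly f)
  obtain k where k: "reg V k" "\<And>a. a \<in> V \<Longrightarrow> pp a (f a + d a) = pp a (f a) + d a * k a"
    using pp_lipschitz[OF f d] by blast
  have nw: "nw a (f a) = f a + d a" for a by (simp add: nw_def d_def)
  show ?thesis
  proof (intro exI conjI ballI)
    show "reg V (\<lambda>a. - poly Q (f a))" "reg V (\<lambda>a. 1 - poly Q (f a) * k a)"
      by (intro reg_minus reg_diff reg_mult reg_poly reg_const f k)+
    show "nw a (f a) - f a = pp a (f a) * - poly Q (f a)" for a by (simp add: nw_def)
    show "pp a (nw a (f a)) = pp a (f a) * (1 - poly Q (f a) * k a)" if "a \<in> V" for a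
      unfolding nw k(2)[OF that] by (simp add: d_def algebra_simps)
  qed
qed

text \<open>With g = N(f), contraction applied to \<open>g\<close> and \<open>f\<close> shows that
  the next step, pp(g) Q(g) up to sign, is divisible by q^(k+2). The Bezout identity removes Q(g),
  because p0(g) is divisible by \<open>q\<close>.\<close>

lemma nw_refine:
  assumes f: "reg V f" and P: "cg V (\<lambda>a. q a ^ Suc k) (\<lambda>a. pp a (f a)) (\<lambda>_. 0)"
  shows "cg V (\<lambda>a. q a ^ Suc (Suc k)) (\<lambda>a. pp a (nw a (f a))) (\<lambda>_. 0)"
proof -
  define g where "g a = nw a (f a)" for a
  have g: "reg V g" unfolding g_def by (rule reg_nw[OF f])
  obtain t u where tu: "reg V t" "reg V u"
    "\<And>a. a \<in> V \<Longrightarrow> g a - f a = pp a (f a) * t a" "\<And>a. a \<in> V \<Longrightarrow> pp a (g a) = pp a (f a) * u a"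
    using nw_ideal[OF f] unfolding g_def by blast
  obtain w where w: "reg V w" "\<And>a. a \<in> V \<Longrightarrow> pp a (f a) = q a ^ Suc k * w a"
    using P by (rule cgE) simp
  have Pf: "cg V q (\<lambda>a. pp a (f a)) (\<lambda>_. 0)"
    by (rule cgI[of V "\<lambda>a. q a ^ k * w a"]) (auto simp: w(2) intro!: reg_mult reg_power q w)
  have gf: "cg V (\<lambda>a. q a ^ Suc k) g f"
    by (rule cgI[of V "\<lambda>a. w a * t a"]) (auto simp: w(2) tu(3) intro!: reg_mult w tu)
  obtain h where h: "reg V h" "\<And>a. a \<in> V \<Longrightarrow> nw a (g a) - g a = q a ^ Suc (Suc k) * h a"
    using nw_contract[OF f Pf gf] unfolding g_def[symmetric] by (rule cgE) blast
  obtain e where e: "reg V e" "\<And>a. a \<in> V \<Longrightarrow> poly p0 (g a) = pp a (g a) - q a * e a"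
    using pp_p0[OF g] by blast
  have "pp a (g a) - 0 = q a ^ Suc (Suc k) *
      (- h a * poly (pderiv p0) (g a) + w a * u a * poly R (g a) * (q a ^ k * w a * u a - e a))"
    if a: "a \<in> V" for a
  proof -
    have 1: "poly Q (g a) * poly (pderiv p0) (g a) + poly R (g a) * poly p0 (g a) = 1"
      using arg_cong[OF QR[folded p0_def], of "\<lambda>p. poly p (g a)"] by simp
    have 2: "pp a (g a) * poly Q (g a) = - (q a ^ Suc (Suc k) * h a)"
      unfolding h(2)[OF a, symmetric] by (simp add: nw_def)
    have 3: "pp a (g a) = q a ^ Suc k * w a * u a" using tu(4)[OF a] w(2)[OF a] by simp
    have 4: "poly p0 (g a) = q a * (q a ^ k * w a * u a - e a)"
      using e(2)[OF a] 3 by (simp add: algebra_simps)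
    have "pp a (g a) = pp a (g a) * poly Q (g a) * poly (pderiv p0) (g a) + pp a (g a) * (poly R (g a) * poly p0 (g a))"
      using arg_cong[OF 1, of "\<lambda>x. pp a (g a) * x"] by (simp add: algebra_simps)
    then show ?thesis unfolding 2 unfolding 3 4 by (simp add: algebra_simps)
  qed
  moreover have "reg V (\<lambda>a. - h a * poly (pderiv p0) (g a) + w a * u a * poly R (g a) * (q a ^ k * w a * u a - e a))"
    by (intro reg_add reg_mult reg_minus reg_diff reg_power reg_poly h g w tu e q)
  ultimately show ?thesis unfolding g_def[symmetric] by (intro cgI)
qed

lemma reg_iter: "reg V f \<Longrightarrow> reg V (\<lambda>a. (nw a ^^ k) (f a))"
  by (induction k) (auto intro: reg_nw)

lemma iter_ideal:
  assumes f: "reg V f"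
  shows "\<exists>t u. reg V t \<and> reg V u \<and> (\<forall>a\<in>V. (nw a ^^ k) (f a) - f a = pp a (f a) * t a \<and>
    pp a ((nw a ^^ k) (f a)) = pp a (f a) * u a)"
proof (induction k)
  case 0
  show ?case by (intro exI[of _ "\<lambda>_. 0"] exI[of _ "\<lambda>_. 1"]) simp
next
  case (Suc k)
  then obtain t u where tu: "reg V t" "reg V u"
    "\<And>a. a \<in> V \<Longrightarrow> (nw a ^^ k) (f a) - f a = pp a (f a) * t a"
    "\<And>a. a \<in> V \<Longrightarrow> pp a ((nw a ^^ k) (f a)) = pp a (f a) * u a" by blast
  obtain t' u' where tu': "reg V t'" "reg V u'"
    "\<And>a. a \<in> V \<Longrightarrow> nw a ((nw a ^^ k) (f a)) - (nw a ^^ k) (f a) = pp a ((nw a ^^ k) (f a)) * t' a"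
    "\<And>a. a \<in> V \<Longrightarrow> pp a (nw a ((nw a ^^ k) (f a))) = pp a ((nw a ^^ k) (f a)) * u' a"
    using nw_ideal[OF reg_iter[OF f, of k]] by blast
  show ?case
  proof (intro exI conjI ballI)
    show "reg V (\<lambda>a. u a * t' a + t a)" "reg V (\<lambda>a. u a * u' a)"
      by (intro reg_add reg_mult tu tu')+
    show "(nw a ^^ Suc k) (f a) - f a = pp a (f a) * (u a * t' a + t a)" if "a \<in> V" for a
    proof -
      have "(nw a ^^ Suc k) (f a) - f a = (nw a ((nw a ^^ k) (f a)) - (nw a ^^ k) (f a)) + ((nw a ^^ k) (f a) - f a)"
        by simp
      then show ?thesis unfolding tu'(3)[OF that] tu(3)[OF that] tu(4)[OF that] by (simp add: algebra_simps)
    qed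
    show "pp a ((nw a ^^ Suc k) (f a)) = pp a (f a) * (u a * u' a)" if "a \<in> V" for a
      using tu'(4)[OF that] tu(4)[OF that] by simp
  qed
qed

lemma iter_refine:
  assumes f: "reg V f" and P: "cg V q (\<lambda>a. pp a (f a)) (\<lambda>_. 0)"
  shows "cg V (\<lambda>a. q a ^ Suc k) (\<lambda>a. pp a ((nw a ^^ k) (f a))) (\<lambda>_. 0)"
proof (induction k)
  case 0 then show ?case using P by simp
next
  case (Suc k)
  then show ?case using nw_refine[OF reg_iter[OF f, of k]] by simp
qed

lemma iter_contract:
  assumes f: "reg V f" and P: "cg V q (\<lambda>a. pp a (f a)) (\<lambda>_. 0)" and g: "cg V q g f"
  shows "cg V (\<lambda>a. q a ^ Suc k) (\<lambda>a. (nw a ^^ k) (g a)) (\<lambda>a. (nw a ^^ k) (f a))"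
proof (induction k)
  case 0 then show ?case using g by simp
next
  case (Suc k)
  have "cg V q (\<lambda>a. pp a ((nw a ^^ k) (f a))) (\<lambda>_. 0)"
    using iter_refine[OF f P, of k]
    by (rule cg_weaken[where k = "\<lambda>a. q a ^ k"]) (auto intro!: reg_power q)
  from nw_contract[OF reg_iter[OF f, of k] this Suc] show ?case by simp
qed

text \<open>\<open>A\<close> and \<open>B\<close> stand for x^m and x^m', both divisors of q^(K+1).
  With n = N^K(y), pp(n) is divisible by q^(K+1), hence by \<open>B\<close>, and \<open>y1\<close>
  differs from n by a multiple of \<open>B\<close>; this gives z1. For s1, the difference y -
  N^K(y1) is split at n and N^K(n): two pieces are multiples of pp(y) = A z, and the third is
  divisible by q^(K+1) by contraction.\<close>

lemma stable_coordinates: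
  assumes y: "reg V y" "reg V z" "\<And>a. a \<in> V \<Longrightarrow> pp a (y a) = A a * z a" and t: "reg V t"
    and A: "reg V A" "reg V \<alpha>" "\<And>a. A a = q a * \<alpha> a" "reg V \<alpha>'" "\<And>a. q a ^ Suc K = A a * \<alpha>' a"
    and B: "reg V B" "reg V \<beta>" "\<And>a. B a = q a * \<beta> a" "reg V \<beta>'" "\<And>a. q a ^ Suc K = B a * \<beta>' a"
  defines "y1 \<equiv> \<lambda>a. (nw a ^^ K) (y a) + B a * t a"
  shows "\<exists>z1 s1. reg V z1 \<and> reg V s1 \<and>
    (\<forall>a\<in>V. pp a (y1 a) = B a * z1 a \<and> y a - (nw a ^^ K) (y1 a) = A a * s1 a)"
proof -
  define n where "n a = (nw a ^^ K) (y a)" for a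
  have n: "reg V n" unfolding n_def by (rule reg_iter[OF y(1)])
  have P: "cg V q (\<lambda>a. pp a (y a)) (\<lambda>_. 0)"
    by (rule cgI[of V "\<lambda>a. \<alpha> a * z a"]) (auto intro!: reg_mult A y simp: y(3) A(3))
  obtain w where w: "reg V w" "\<And>a. a \<in> V \<Longrightarrow> pp a (n a) = q a ^ Suc K * w a"
    using iter_refine[OF y(1) P, of K] unfolding n_def[symmetric] by (rule cgE) simp
  have Bt: "reg V (\<lambda>a. B a * t a)" by (rule reg_mult[OF B(1) t])
  obtain k where k: "reg V k" "\<And>a. a \<in> V \<Longrightarrow> pp a (n a + B a * t a) = pp a (n a) + B a * t a * k a"
    using pp_lipschitz[OF n Bt] by blast
  have z1: "pp a (y1 a) = B a * (\<beta>' a * w a + t a * k a)" if "a \<in> V" for a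
    using k(2)[OF that] w(2)[OF that] unfolding y1_def n_def[symmetric] B(5) by (simp add: algebra_simps)
  have Pn: "cg V q (\<lambda>a. pp a (n a)) (\<lambda>_. 0)"
    by (rule cgI[of V "\<lambda>a. q a ^ K * w a"]) (auto simp: w(2) intro!: reg_mult reg_power q w)
  have "cg V q y1 n"
    by (rule cgI[of V "\<lambda>a. \<beta> a * t a"]) (auto simp: y1_def n_def B(3) intro!: reg_mult B t)
  from iter_contract[OF n Pn this, of K]
  obtain h where h: "reg V h" "\<And>a. a \<in> V \<Longrightarrow> (nw a ^^ K) (y1 a) - (nw a ^^ K) (n a) = q a ^ Suc K * h a"
    by (rule cgE) blast
  obtain t1 u1 where 1: "reg V t1" "reg V u1" "\<And>a. a \<in> V \<Longrightarrow> n a - y a = pp a (y a) * t1 a"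
    "\<And>a. a \<in> V \<Longrightarrow> pp a (n a) = pp a (y a) * u1 a"
    using iter_ideal[OF y(1), of K] unfolding n_def by blast
  obtain t2 u2 where 2: "reg V t2" "reg V u2" "\<And>a. a \<in> V \<Longrightarrow> (nw a ^^ K) (n a) - n a = pp a (n a) * t2 a"
    "\<And>a. a \<in> V \<Longrightarrow> pp a ((nw a ^^ K) (n a)) = pp a (n a) * u2 a"
    using iter_ideal[OF n, of K] by blast
  have s1: "y a - (nw a ^^ K) (y1 a) = A a * (- (\<alpha>' a * h a + z a * u1 a * t2 a + z a * t1 a))" if "a \<in> V" for a
  proof -
    have "y a - (nw a ^^ K) (y1 a) = - (((nw a ^^ K) (y1 a) - (nw a ^^ K) (n a)) + ((nw a ^^ K) (n a) - n a) + (n a - y a))"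
      by simp
    then show ?thesis
      unfolding h(2)[OF that] 2(3)[OF that] 1(3)[OF that] 1(4)[OF that] y(3)[OF that] A(5)
      by (simp add: algebra_simps)
  qed
  have "reg V (\<lambda>a. \<beta>' a * w a + t a * k a)"
    "reg V (\<lambda>a. - (\<alpha>' a * h a + z a * u1 a * t2 a + z a * t1 a))"
    by (intro reg_add reg_minus reg_mult A B w t k h y 1 2)+
  then show ?thesis using z1 s1 by blast
qed

end

section \<open>The isomorphism between the cylinders\<close>

definition dnw :: "complex poly \<Rightarrow> nat \<Rightarrow> (nat \<Rightarrow> 'n::finite cpoly) \<Rightarrow> ('n \<Rightarrow> complex) \<Rightarrow> complex \<Rightarrow> complex" where
  "dnw Q r \<sigma> x y = y - (\<Prod>i=1..r. y - ceval (\<sigma> i) x) * poly Q y"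

abbreviation xs :: "('n coord + unit \<Rightarrow> complex) \<Rightarrow> 'n \<Rightarrow> complex" where
  "xs a \<equiv> \<lambda>j. a (Inl (CX j))"

abbreviation cyl where
  "cyl m r \<sigma> \<equiv> variety_prod (danielewski_variety m r \<sigma>) affine_line"

lemma mem_cyl: "a \<in> cyl m r \<sigma> \<longleftrightarrow>
    (\<Prod>i=1..r. a (Inl CY) - ceval (\<sigma> i) (xs a)) = (\<Prod>j\<in>UNIV. xs a j ^ m j) * a (Inl CZ)"
  by (auto simp: variety_prod_def danielewski_variety_def)

text \<open>The last two equations are y' = N^K(y) + x^m' s and y = N^K(y') + x^m s'. Exchanging
  source and target exchanges them, since the Newton map does not involve m. The second one
  determines s' only where x^m is nonzero, and density covers the rest.\<close>

definition stable_map where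
  "stable_map K Q r \<sigma> m m' f \<longleftrightarrow> regular_map (cyl m r \<sigma>) (cyl m' r \<sigma>) f \<and>
    (\<forall>a\<in>cyl m r \<sigma>. xs (f a) = xs a \<and>
      f a (Inl CY) = (dnw Q r \<sigma> (xs a) ^^ K) (a (Inl CY)) + (\<Prod>j\<in>UNIV. xs a j ^ m' j) * a (Inr ()) \<and>
      a (Inl CY) - (dnw Q r \<sigma> (xs a) ^^ K) (f a (Inl CY)) = (\<Prod>j\<in>UNIV. xs a j ^ m j) * f a (Inr ()))"

lemma stable_map_exists:
  fixes \<sigma> :: "nat \<Rightarrow> 'n::finite cpoly"
  defines "c \<equiv> \<lambda>i. ceval (\<sigma> i) (\<lambda>_. 0)"
  assumes dvd: "\<And>i. i \<in> {1..r} \<Longrightarrow> (\<Prod>j\<in>UNIV. cvar j) dvd (\<sigma> i - cconst (c i))"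
    and QR: "Q * pderiv (\<Prod>i=1..r. [:- c i, 1:]) + R * (\<Prod>i=1..r. [:- c i, 1:]) = 1"
    and m: "\<And>j. m j \<ge> 1" "\<And>j. m' j \<ge> 1" and K: "\<And>j. m j \<le> K" "\<And>j. m' j \<le> K"
  shows "\<exists>f. stable_map K Q r \<sigma> m m' f"
proof -
  define V where "V = cyl m r \<sigma>"
  define q where "q a = (\<Prod>j\<in>UNIV. xs a j)" for a :: "'n coord + unit \<Rightarrow> complex"
  define s where "s i a = ceval (\<sigma> i) (xs a)" for i and a :: "'n coord + unit \<Rightarrow> complex"
  have reg_xs: "reg V (\<lambda>a. ceval p (xs a))" for p :: "'n cpoly"
    by (intro reg_ceval reg_coord)
  interpret newton V q r s c Q R
  proof
    show "reg V q" unfolding q_def by (intro reg_prod reg_coord)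
    show "reg V (s i)" for i unfolding s_def by (rule reg_xs)
    show "cg V q (s i) (\<lambda>_. c i)" if i: "i \<in> {1..r}" for i
    proof -
      obtain h where h: "\<sigma> i - cconst (c i) = (\<Prod>j\<in>UNIV. cvar j) * h" using dvd[OF i] by (rule dvdE)
      have "s i a - c i = q a * ceval h (xs a)" for a
        using arg_cong[OF h, of "\<lambda>p. ceval p (xs a)"] by (simp add: ceval_homs s_def q_def)
      then show ?thesis by (intro cgI[OF reg_xs])
    qed
  qed (rule QR)
  have nw: "nw a = dnw Q r \<sigma> (xs a)" for a
    by (rule ext) (simp add: nw_def pp_def dnw_def s_def)
  define A B where "A a = (\<Prod>j\<in>UNIV. xs a j ^ m j)" and "B a = (\<Prod>j\<in>UNIV. xs a j ^ m' j)"
    for a :: "'n coord + unit \<Rightarrow> complex"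
  have regp: "reg V (\<lambda>a. \<Prod>j\<in>UNIV. xs a j ^ k j)" for k
    by (intro reg_prod reg_power reg_coord)
  \<comment> \<open>\<open>q\<close> divides x^k because all exponents are at least 1, and in
    \<open>full\<close> x^k divides q^(K+1) because none exceeds \<open>K\<close>.\<close>
  have split: "(\<Prod>j\<in>UNIV. xs a j ^ k j) = q a * (\<Prod>j\<in>UNIV. xs a j ^ (k j - 1))"
    if "\<And>j. k j \<ge> 1" for k and a :: "'n coord + unit \<Rightarrow> complex"
  proof -
    have "Suc (k j - 1) = k j" for j using that[of j] by simp
    then show ?thesis
      unfolding q_def prod.distrib[symmetric] by (intro prod.cong refl) (simp only: power_Suc[symmetric])
  qed
  have full: "q a ^ Suc K = (\<Prod>j\<in>UNIV. xs a j ^ k j) * (\<Prod>j\<in>UNIV. xs a j ^ (Suc K - k j))"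
    if "\<And>j. k j \<le> K" for k and a :: "'n coord + unit \<Rightarrow> complex"
    unfolding q_def prod.distrib[symmetric] prod_power_distrib using that
    by (intro prod.cong refl) (simp add: le_SucI flip: power_add)
  define y1 where "y1 a = (nw a ^^ K) (a (Inl CY)) + B a * a (Inr ())" for a
  have "\<exists>z1 s1. reg V z1 \<and> reg V s1 \<and>
    (\<forall>a\<in>V. pp a (y1 a) = B a * z1 a \<and> a (Inl CY) - (nw a ^^ K) (y1 a) = A a * s1 a)"
    unfolding y1_def
  proof (rule stable_coordinates[where z = "\<lambda>a. a (Inl CZ)"])
    show "pp a (a (Inl CY)) = A a * a (Inl CZ)" if "a \<in> V" for a
      using that unfolding V_def mem_cyl by (simp add: pp_def s_def A_def)
    show "A a = q a * (\<Prod>j\<in>UNIV. xs a j ^ (m j - 1))" "B a = q a * (\<Prod>j\<in>UNIV. xs a j ^ (m' j - 1))"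
      "q a ^ Suc K = A a * (\<Prod>j\<in>UNIV. xs a j ^ (Suc K - m j))"
      "q a ^ Suc K = B a * (\<Prod>j\<in>UNIV. xs a j ^ (Suc K - m' j))" for a
      unfolding A_def B_def by (rule split full, rule m K)+
    show "reg V A" "reg V B" unfolding A_def B_def by (rule regp)+
  qed (rule reg_coord regp)+
  then obtain z1 s1 where z1: "reg V z1" "\<And>a. a \<in> V \<Longrightarrow> pp a (y1 a) = B a * z1 a"
    and s1: "reg V s1" "\<And>a. a \<in> V \<Longrightarrow> a (Inl CY) - (nw a ^^ K) (y1 a) = A a * s1 a" by blast
  define f where "f a v = (case v of Inl (CX j) \<Rightarrow> a (Inl (CX j)) | Inl CY \<Rightarrow> y1 a | Inl CZ \<Rightarrow> z1 a | Inr _ \<Rightarrow> s1 a)"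
    for a and v :: "'n coord + unit"
  have f: "f a (Inl (CX j)) = a (Inl (CX j))" "f a (Inl CY) = y1 a" "f a (Inl CZ) = z1 a" "f a (Inr ()) = s1 a" for a j
    by (simp_all add: f_def)
  have "reg V (\<lambda>a. f a v)" for v
  proof (cases v)
    case (Inl w)
    have "reg V y1" unfolding y1_def B_def
      by (intro reg_add reg_mult reg_iter reg_coord regp)
    then show ?thesis using Inl z1(1) by (cases w) (simp_all add: f_def reg_coord)
  qed (simp add: f_def s1)
  moreover have "f a \<in> cyl m' r \<sigma>" if "a \<in> V" for a
    using z1(2)[OF that] unfolding mem_cyl by (simp add: f pp_def s_def B_def)
  ultimately have "regular_map (cyl m r \<sigma>) (cyl m' r \<sigma>) f"
    unfolding regular_map_def reg_def V_def by blast
  then have "stable_map K Q r \<sigma> m m' f"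
    unfolding stable_map_def using s1(2) by (auto simp: V_def f nw y1_def A_def B_def)
  then show ?thesis by blast
qed

lemma cyl_dense:
  fixes p p' :: "('n::finite coord + unit) cpoly"
  assumes eq: "\<And>a. a \<in> cyl m r \<sigma> \<Longrightarrow> (\<And>j. xs a j \<noteq> 0) \<Longrightarrow> ceval p a = ceval p' a"
    and a: "a \<in> cyl m r \<sigma>" and r: "r > 0"
  shows "ceval p a = ceval p' a"
proof -
  have "(\<lambda>v. a (Inl v)) \<in> danielewski_variety m r \<sigma>" using a by (simp add: variety_prod_def)
  then obtain b where b: "\<And>n. b n \<in> danielewski_variety m r \<sigma>" "\<And>n j. b n (CX j) \<noteq> 0"
    "\<And>v. (\<lambda>n. b n v) \<longlonglongrightarrow> a (Inl v)"
    using r by (rule danielewski_dense) blast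
  define b' where "b' n v = (case v of Inl w \<Rightarrow> b n w | Inr u \<Rightarrow> a (Inr u))" for n v
  have "b' n \<in> cyl m r \<sigma>" "xs (b' n) j \<noteq> 0" for n j
    using b(1,2)[of n] by (simp_all add: variety_prod_def b'_def)
  then have "(\<lambda>n. ceval p (b' n)) = (\<lambda>n. ceval p' (b' n))" using eq by blast
  moreover have "(\<lambda>n. b' n v) \<longlonglongrightarrow> a v" for v
    using b(3) by (cases v) (simp_all add: b'_def)
  then have l: "(\<lambda>n. ceval s (b' n)) \<longlonglongrightarrow> ceval s a" for s by (rule tendsto_ceval)
  ultimately show ?thesis using LIMSEQ_unique[OF l[of p]] l[of p'] by simp
qed

text \<open>Where no x_j vanishes, x^m and x^m' can be cancelled: the two Newton equations return y
  and s, and the equation of the variety returns z. Both sides are polynomial in the point, so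
  density extends the identity to the whole cylinder.\<close>

lemma stable_map_inverse:
  fixes \<sigma> :: "nat \<Rightarrow> 'n::finite cpoly"
  assumes f: "stable_map K Q r \<sigma> m m' f" and g: "stable_map K Q r \<sigma> m' m g" and r: "r > 0"
    and a: "a \<in> cyl m r \<sigma>"
  shows "g (f a) = a"
proof -
  have fV: "f a \<in> cyl m' r \<sigma>" if "a \<in> cyl m r \<sigma>" for a
    using f that unfolding stable_map_def regular_map_def by blast
  have gV: "g b \<in> cyl m r \<sigma>" if "b \<in> cyl m' r \<sigma>" for b
    using g that unfolding stable_map_def regular_map_def by blast
  obtain F where F: "\<And>a w. a \<in> cyl m r \<sigma> \<Longrightarrow> f a w = ceval (F w) a"
    using f unfolding stable_map_def regular_map_def by metis
  obtain G where G: "\<And>a w. a \<in> cyl m' r \<sigma> \<Longrightarrow> g a w = ceval (G w) a"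
    using g unfolding stable_map_def regular_map_def by metis
  have comp: "g (f a) v = ceval (csubst F (G v)) a" if "a \<in> cyl m r \<sigma>" for a v
  proof -
    have "f a = (\<lambda>w. ceval (F w) a)" using F[OF that] by auto
    then show ?thesis using G[OF fV[OF that], of v] by (simp add: ceval_csubst)
  qed
  have "g (f a) v = a v" if a: "a \<in> cyl m r \<sigma>" and x: "\<And>j. xs a j \<noteq> 0" for a v
  proof -
    let ?A = "\<Prod>j\<in>UNIV. xs a j ^ m j" and ?B = "\<Prod>j\<in>UNIV. xs a j ^ m' j"
    let ?N = "dnw Q r \<sigma> (xs a) ^^ K"
    have nz: "?A \<noteq> 0" "?B \<noteq> 0" using x by simp_all
    have f': "xs (f a) = xs a" "f a (Inl CY) = ?N (a (Inl CY)) + ?B * a (Inr ())"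
      "a (Inl CY) - ?N (f a (Inl CY)) = ?A * f a (Inr ())"
      using f a unfolding stable_map_def by blast+
    have x': "f a (Inl (CX j)) = a (Inl (CX j))" for j using fun_cong[OF f'(1), of j] .
    have g': "xs (g (f a)) = xs a" "g (f a) (Inl CY) = ?N (f a (Inl CY)) + ?A * f a (Inr ())"
      "f a (Inl CY) - ?N (g (f a) (Inl CY)) = ?B * g (f a) (Inr ())"
      using g[unfolded stable_map_def, THEN conjunct2, THEN bspec, OF fV[OF a]]
      unfolding x' by blast+
    have X: "g (f a) (Inl (CX j)) = a (Inl (CX j))" for j using fun_cong[OF g'(1), of j] .
    have Y: "g (f a) (Inl CY) = a (Inl CY)" using g'(2) f'(3) by (simp add: algebra_simps)
    have "?B * g (f a) (Inr ()) = ?B * a (Inr ())" unfolding g'(3)[symmetric] Y f'(2) by simp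
    then have S: "g (f a) (Inr ()) = a (Inr ())" using nz(2) mult_left_cancel by blast
    have "?A * g (f a) (Inl CZ) = ?A * a (Inl CZ)"
      using gV[OF fV[OF a]] a unfolding mem_cyl X Y by simp
    then have Z: "g (f a) (Inl CZ) = a (Inl CZ)" using nz(1) mult_left_cancel by blast
    show ?thesis
    proof (cases v)
      case (Inl w) then show ?thesis using X Y Z by (cases w) simp_all
    next
      case (Inr u) then show ?thesis using S by simp
    qed
  qed
  then have "ceval (csubst F (G v)) a = ceval (cvar v) a" for v
    by (intro cyl_dense[OF _ a r]) (simp add: comp)
  then show ?thesis using comp[OF a] by auto
qed

theorem stably_isomorphic:
  fixes \<sigma> :: "nat \<Rightarrow> 'n::finite cpoly"
  assumes r: "r > 0"
    and distinct: "\<And>i j. i \<in> {1..r} \<Longrightarrow> j \<in> {1..r} \<Longrightarrow> i \<noteq> j \<Longrightarrow>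
           ceval (\<sigma> i) (\<lambda>_. 0) \<noteq> ceval (\<sigma> j) (\<lambda>_. 0)"
    and dvd: "\<And>i. i \<in> {1..r} \<Longrightarrow>
           (\<Prod>j\<in>UNIV. cvar j) dvd (\<sigma> i - cconst (ceval (\<sigma> i) (\<lambda>_. 0)))"
    and m: "\<And>j. m j \<ge> 1" "\<And>j. m' j \<ge> 1"
  shows "isomorphic_varieties (cyl m r \<sigma>) (cyl m' r \<sigma>)"
proof -
  define c where "c i = ceval (\<sigma> i) (\<lambda>_. 0)" for i
  have "inj_on c {1..r}" unfolding inj_on_def c_def using distinct by blast
  then obtain Q R where QR: "Q * pderiv (\<Prod>i=1..r. [:- c i, 1:]) + R * (\<Prod>i=1..r. [:- c i, 1:]) = 1"
    using bezout_distinct_roots[of "{1..r}" c] by blast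
  \<comment> \<open>Any common bound for the exponents would do, but the same \<open>K\<close> has
    to serve in both directions.\<close>
  define K where "K = (\<Sum>j\<in>UNIV. m j + m' j)"
  have "m j + m' j \<le> K" for j unfolding K_def by (rule member_le_sum) auto
  then have K: "m j \<le> K" "m' j \<le> K" for j by (meson le_add1 le_add2 order_trans)+
  have "\<exists>f. stable_map K Q r \<sigma> m m' f"
    by (rule stable_map_exists[OF dvd QR[unfolded c_def]]) (assumption | rule m K)+
  then obtain f where f: "stable_map K Q r \<sigma> m m' f" by blast
  have "\<exists>g. stable_map K Q r \<sigma> m' m g"
    by (rule stable_map_exists[OF dvd QR[unfolded c_def]]) (assumption | rule m K)+
  then obtain g where g: "stable_map K Q r \<sigma> m' m g" by blast
  show ?thesis
    unfolding isomorphic_varieties_def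
    using f g stable_map_inverse[OF f g r] stable_map_inverse[OF g f r]
    unfolding stable_map_def by blast
qed

theorem corollary1p20:
  fixes \<sigma> :: "nat \<Rightarrow> 'n::finite cpoly" and r :: nat
  assumes "r \<ge> 2"
    and "\<And>i j. i \<in> {1..r} \<Longrightarrow> j \<in> {1..r} \<Longrightarrow> i \<noteq> j \<Longrightarrow>
           ceval (\<sigma> i) (\<lambda>_. 0) \<noteq> ceval (\<sigma> j) (\<lambda>_. 0)"
    and "\<And>i. i \<in> {1..r} \<Longrightarrow>
           (\<Prod>j\<in>UNIV. cvar j) dvd (\<sigma> i - cconst (ceval (\<sigma> i) (\<lambda>_. 0)))"
  shows "(\<forall>m m' :: 'n \<Rightarrow> nat.
            (\<forall>j. m j > 1) \<and> (\<forall>j. m' j > 1) \<and> range m \<noteq> range m' \<longrightarrow>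
            \<not> isomorphic_varieties (danielewski_variety m r \<sigma>) (danielewski_variety m' r \<sigma>))
       \<and> (\<exists>M :: nat \<Rightarrow> 'n \<Rightarrow> nat.
            (\<forall>k j. M k j > 1) \<and>
            (\<forall>k l. k \<noteq> l \<longrightarrow>
               \<not> isomorphic_varieties (danielewski_variety (M k) r \<sigma>) (danielewski_variety (M l) r \<sigma>)) \<and>
            (\<forall>k l. isomorphic_varieties
               (variety_prod (danielewski_variety (M k) r \<sigma>) affine_line)
               (variety_prod (danielewski_variety (M l) r \<sigma>) affine_line)))"
proof -
  have noniso: "\<not> isomorphic_varieties (danielewski_variety m r \<sigma>) (danielewski_variety m' r \<sigma>)"
    if "\<And>j. m j > 1" "\<And>j. m' j > 1" "range m \<noteq> range m'" for m m' :: "'n \<Rightarrow> nat"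
    using isomorphic_imp_same_exponents[OF assms(1), of m m' \<sigma>] that by (auto simp: Suc_le_eq numeral_2_eq_2)
  \<comment> \<open>Constant multi-indices with different values have different sets of entries; the
    offset 2 keeps every exponent above 1.\<close>
  define M :: "nat \<Rightarrow> 'n \<Rightarrow> nat" where "M k j = k + 2" for k j
  have "range (M k) = {k + 2}" for k by (auto simp: M_def)
  then have "range (M k) \<noteq> range (M l)" if "k \<noteq> l" for k l using that by simp
  then have "\<forall>k l. k \<noteq> l \<longrightarrow>
      \<not> isomorphic_varieties (danielewski_variety (M k) r \<sigma>) (danielewski_variety (M l) r \<sigma>)"
    by (intro allI impI noniso) (auto simp: M_def)
  moreover have "isomorphic_varieties (cyl (M k) r \<sigma>) (cyl (M l) r \<sigma>)" for k l
    by (rule stably_isomorphic) (use assms in \<open>auto simp: M_def\<close>)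
  moreover have "\<forall>k j. M k j > 1" by (simp add: M_def)
  ultimately show ?thesis using noniso by blast
qed

end
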